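(* Let $a,b>0$, let $(X,d)$ be a locally compact Polish metric space, and let $k\geq 2$ be an integer. For every $i\in\{1,\ldots,k\}$ let $\{\mu^n_i\}_{n\in\mathbb{N}}\subset \mathcal{M}(X)$ be a sequence converging in the generalized Wasserstein distance $\widetilde{W}^{a,b}_2$ to a compactly supported measure $\mu_i\in \mathcal{M}(X)$. Let $K=\bigcup_{i=1}^k\mathrm{supp}(\mu_i)$ and let $\lambda_1,\ldots,\lambda_k$ be positive real numbers such that $\sum_{i=1}^k\lambda_i=1$. Suppose that $\mathrm{supp}(\mu_i^n)\subset K$ for every $n\in\mathbb{N}$ and $i\in\{1,\ldots,k\}$. Then $BC\left((\mu_i^n,\lambda_i)_{1\leq i\leq k}\right)$ is nonempty for every $n\in\mathbb{N}$. Moreover, if $\mu_B^n\in BC\left((\mu_i^n,\lambda_i)_{1\leq i\leq k}\right)$ for every $n\in\mathbb{N}$, then the sequence $\{\mu^n_B\}$ is precompact in $(\mathcal{M}(X),\widetilde{W}^{a,b}_2)$ and each of its limit points is a generalized Wasserstein barycenter of $(\mu_1,\ldots,\mu_k)$ with weights $(\lambda_1,\ldots,\lambda_k)$.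
   Context: $\mathcal{M}(X)$ is the set of nonnegative finite Borel measures on $X$; $\mathcal{M}_2(X)$ is the subset of those with finite second moment. For a finite signed Borel measure $\mu=\mu^+-\mu^-$, $|\mu|:=\mu^+(X)+\mu^-(X)$. For $\mu_1,\mu_2\in\mathcal{M}_2(X)$ with $|\mu_1|=|\mu_2|$, $W_2(\mu_1,\mu_2):=\left(|\mu_1|\inf_{\boldsymbol\pi\in\Pi(\mu_1,\mu_2)}\int_{X\times X}d^2(x,y)\,d\boldsymbol\pi(x,y)\right)^{1/2}$, where $\Pi(\mu_1,\mu_2)$ is the set of Borel probability measures $\boldsymbol\pi$ on $X\times X$ with $|\mu_1|\boldsymbol\pi(A\times X)=\mu_1(A)$ and $|\mu_2|\boldsymbol\pi(X\times B)=\mu_2(B)$ for all Borel $A,B$. The generalized Wasserstein distance (a metric on $\mathcal{M}(X)$) is $$\widetilde{W}^{a,b}_2(\mu_1,\mu_2):=\left(\inf\left\{a|\mu_1-\widetilde\mu_1|+a|\mu_2-\widetilde\mu_2|+b^2W_2^2(\widetilde\mu_1,\widetilde\mu_2):\ \widetilde\mu_1,\widetilde\mu_2\in\mathcal{M}_2(X),\ |\widetilde\mu_1|=|\widetilde\mu_2|\right\}\right)^{1/2}.$$ For compactly supported $\nu_1,\dots,\nu_k\in\mathcal{M}(X)$ and positive reals $\lambda_i$ with $\sum_i\lambda_i=1$, a generalized Wasserstein barycenter of $(\nu_1,\dots,\nu_k)$ with weights $(\lambda_1,\dots,\lambda_k)$ is a minimizer of $\mu\mapsto\sum_{i=1}^k\lambda_i\widetilde{W}^{a,b}_2(\nu_i,\mu)^2$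 over all $\mu\in\mathcal{M}(X)$ with $\mathrm{supp}(\mu)\subset\bigcup_{i=1}^k\mathrm{supp}(\nu_i)$. The set of all such barycenters is $BC\left((\nu_i,\lambda_i)_{1\le i\le k}\right)$. "Precompact" means that every subsequence has a further subsequence converging in $(\mathcal{M}(X),\widetilde{W}^{a,b}_2)$. *)

theory Defs
  imports "HOL-Probability.Probability"
begin

definition finite_borel_measures :: "'a::topological_space measure set" where
  "finite_borel_measures = {\<mu>. sets \<mu> = sets borel \<and> finite_measure \<mu>}"

definition finite_borel_measures2 :: "'a::metric_space measure set" where
  "finite_borel_measures2 =
     {\<mu> \<in> finite_borel_measures. \<exists>x0. (\<integral>\<^sup>+ x. ennreal ((dist x0 x)\<^sup>2) \<partial>\<mu>) < \<infinity>}"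

definition msupp :: "'a::topological_space measure \<Rightarrow> 'a set" where
  "msupp \<mu> = {x. \<forall>U. open U \<longrightarrow> x \<in> U \<longrightarrow> emeasure \<mu> U > 0}"

text \<open>A finite signed Borel measure is represented by the function giving its values on Borel
  sets; \<open>p\<close> and \<open>m\<close> are its positive and negative parts.\<close>

definition jordan_decomposition ::
    "('a::topological_space set \<Rightarrow> real) \<Rightarrow> 'a measure \<Rightarrow> 'a measure \<Rightarrow> bool" where
  "jordan_decomposition \<sigma> p m \<longleftrightarrow>
     p \<in> finite_borel_measures \<and> m \<in> finite_borel_measures \<and>
     (\<exists>S\<in>sets borel. measure p (- S) = 0 \<and> measure m S = 0) \<and>
     (\<forall>A\<in>sets borel. \<sigma> A = measure p A - measure m A)"

definition total_variation :: "('a::topological_space set \<Rightarrow> real) \<Rightarrow> real" where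
  "total_variation \<sigma> =
     (THE t. \<exists>p m. jordan_decomposition \<sigma> p m \<and> t = measure p UNIV + measure m UNIV)"

text \<open>The definite description is well defined: a Jordan decomposition of a difference of finite
  measures exists, and its total mass is unique.\<close>

lemma diff_measure_restricted:
  fixes \<mu> \<nu> :: "'a::topological_space measure"
  assumes mu: "\<mu> \<in> finite_borel_measures" and nu: "\<nu> \<in> finite_borel_measures"
    and B: "B \<in> sets borel"
    and le: "\<And>X. X \<in> sets borel \<Longrightarrow> X \<subseteq> B \<Longrightarrow> emeasure \<nu> X \<le> emeasure \<mu> X"
  shows "\<exists>p. p \<in> finite_borel_measures \<and>
    (\<forall>X\<in>sets borel. measure p X = measure \<mu> (B \<inter> X) - measure \<nu> (B \<inter> X))"
proof -
  have s[simp]: "sets \<mu> = sets borel" "sets \<nu> = sets borel"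
    and fin: "finite_measure \<mu>" "finite_measure \<nu>"
    using mu nu by (auto simp: finite_borel_measures_def)
  interpret M: finite_measure \<mu> by fact
  interpret N: finite_measure \<nu> by fact
  let ?p = "diff_measure (density \<mu> (indicator B)) (density \<nu> (indicator B))"
  have em: "emeasure ?p X = emeasure \<mu> (B \<inter> X) - emeasure \<nu> (B \<inter> X)" if "X \<in> sets borel" for X
    using that B le
    by (subst emeasure_diff_measure)
       (auto simp: emeasure_restricted M.finite_measure_restricted N.finite_measure_restricted)
  have me: "measure ?p X = measure \<mu> (B \<inter> X) - measure \<nu> (B \<inter> X)" if X: "X \<in> sets borel" for X
  proof -
    have BX: "B \<inter> X \<in> sets borel" using X B by auto
    have "measure \<nu> (B \<inter> X) \<le> measure \<mu> (B \<inter> X)"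
      using le[OF BX] by (simp add: M.emeasure_eq_measure N.emeasure_eq_measure)
    then show ?thesis
      using em[OF X]
      by (simp add: measure_def[of ?p] M.emeasure_eq_measure N.emeasure_eq_measure ennreal_minus)
  qed
  have "sets ?p = sets borel"
    by simp
  moreover from this have sp: "space ?p = UNIV"
    by (metis sets_eq_imp_space_eq space_borel)
  have "finite_measure ?p"
    by (rule finite_measureI, unfold sp)
       (use em[of UNIV] in \<open>simp add: ennreal_minus M.emeasure_eq_measure N.emeasure_eq_measure\<close>)
  ultimately show ?thesis
    using me by (intro exI[of _ ?p] conjI) (auto simp: finite_borel_measures_def)
qed

lemma jordan_decomposition_exists:
  fixes \<mu> \<nu> :: "'a::topological_space measure"
  assumes mu: "\<mu> \<in> finite_borel_measures" and nu: "\<nu> \<in> finite_borel_measures"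
  shows "\<exists>p m. jordan_decomposition (\<lambda>A. measure \<mu> A - measure \<nu> A) p m"
proof -
  have s[simp]: "sets \<mu> = sets borel" "sets \<nu> = sets borel"
    and fin: "finite_measure \<mu>" "finite_measure \<nu>"
    using mu nu by (auto simp: finite_borel_measures_def)
  interpret M: finite_measure \<mu> by fact
  interpret N: finite_measure \<nu> by fact
  obtain Y where Y: "Y \<in> sets borel"
    and pos: "\<And>X. X \<in> sets borel \<Longrightarrow> X \<subseteq> Y \<Longrightarrow> emeasure \<nu> X \<le> emeasure \<mu> X"
    and neg: "\<And>X. X \<in> sets borel \<Longrightarrow> X \<inter> Y = {} \<Longrightarrow> emeasure \<mu> X \<le> emeasure \<nu> X"
    using finite_unsigned_Hahn_decomposition[OF fin] by auto
  have Y': "- Y \<in> sets borel" using Y by (simp add: borel_comp)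
  obtain p where p: "p \<in> finite_borel_measures"
      "\<And>X. X \<in> sets borel \<Longrightarrow> measure p X = measure \<mu> (Y \<inter> X) - measure \<nu> (Y \<inter> X)"
    using diff_measure_restricted[OF mu nu Y pos] by blast
  obtain m where m: "m \<in> finite_borel_measures"
      "\<And>X. X \<in> sets borel \<Longrightarrow> measure m X = measure \<nu> (- Y \<inter> X) - measure \<mu> (- Y \<inter> X)"
    using diff_measure_restricted[OF nu mu Y'] neg by (metis Compl_disjoint2 disjoint_eq_subset_Compl)
  have split: "measure \<kappa> X = measure \<kappa> (Y \<inter> X) + measure \<kappa> (- Y \<inter> X)"
    if "X \<in> sets borel" "finite_measure \<kappa>" "sets \<kappa> = sets borel" for \<kappa> and X :: "'a set"
  proof -
    have "measure \<kappa> ((Y \<inter> X) \<union> (- Y \<inter> X)) = measure \<kappa> (Y \<inter> X) + measure \<kappa> (- Y \<inter> X)"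
      using that Y Y' by (intro finite_measure.finite_measure_Union) auto
    moreover have "(Y \<inter> X) \<union> (- Y \<inter> X) = X" by auto
    ultimately show ?thesis by simp
  qed
  have "jordan_decomposition (\<lambda>A. measure \<mu> A - measure \<nu> A) p m"
    unfolding jordan_decomposition_def
  proof (intro conjI ballI bexI[of _ Y])
    fix A :: "'a set" assume A: "A \<in> sets borel"
    show "measure \<mu> A - measure \<nu> A = measure p A - measure m A"
      using split[OF A fin(1)] split[OF A fin(2)] by (simp add: p(2)[OF A] m(2)[OF A])
  qed (use p m Y Y' in auto)
  then show ?thesis by blast
qed

lemma jordan_decomposition_mass_le:
  assumes "jordan_decomposition \<sigma> p m" "jordan_decomposition \<sigma> p' m'"
  shows "measure p UNIV + measure m UNIV \<le> measure p' UNIV + measure m' UNIV"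
proof -
  from assms(1) obtain S where S: "S \<in> sets borel" "measure p (- S) = 0" "measure m S = 0"
    and pm: "p \<in> finite_borel_measures" "m \<in> finite_borel_measures"
    and 1: "\<And>A. A \<in> sets borel \<Longrightarrow> \<sigma> A = measure p A - measure m A"
    by (auto simp: jordan_decomposition_def)
  from assms(2) have pm': "p' \<in> finite_borel_measures" "m' \<in> finite_borel_measures"
    and 2: "\<And>A. A \<in> sets borel \<Longrightarrow> \<sigma> A = measure p' A - measure m' A"
    by (auto simp: jordan_decomposition_def)
  have S': "- S \<in> sets borel" using S by (simp add: borel_comp)
  have split: "measure \<kappa> UNIV = measure \<kappa> S + measure \<kappa> (- S)"
    if "\<kappa> \<in> finite_borel_measures" for \<kappa>
    using finite_measure.finite_measure_Union[of \<kappa> S "- S"] that S S'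
    by (auto simp: finite_borel_measures_def)
  have "measure p UNIV + measure m UNIV = \<sigma> S - \<sigma> (- S)"
    using split[OF pm(1)] split[OF pm(2)] S 1[OF S(1)] 1[OF S'] by simp
  also have "\<dots> = measure p' S - measure m' S - measure p' (- S) + measure m' (- S)"
    using 2[OF S(1)] 2[OF S'] by simp
  also have "\<dots> \<le> measure p' UNIV + measure m' UNIV"
    using split[OF pm'(1)] split[OF pm'(2)]
      measure_nonneg[of p' "- S"] measure_nonneg[of m' S] by linarith
  finally show ?thesis .
qed

lemma total_variation_eq:
  assumes "jordan_decomposition \<sigma> p m"
  shows "total_variation \<sigma> = measure p UNIV + measure m UNIV"
  unfolding total_variation_def
proof (rule the_equality)
  show "\<exists>p' m'. jordan_decomposition \<sigma> p' m' \<and>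
      measure p UNIV + measure m UNIV = measure p' UNIV + measure m' UNIV"
    using assms by blast
next
  fix t assume "\<exists>p' m'. jordan_decomposition \<sigma> p' m' \<and> t = measure p' UNIV + measure m' UNIV"
  then show "t = measure p UNIV + measure m UNIV"
    using assms jordan_decomposition_mass_le by (metis order_antisym)
qed

definition tv_diff :: "'a::topological_space measure \<Rightarrow> 'a measure \<Rightarrow> real" where
  "tv_diff \<mu> \<nu> = total_variation (\<lambda>A. measure \<mu> A - measure \<nu> A)"

text \<open>A nonnegative measure has zero negative part, so its total variation is its mass.\<close>

abbreviation mass :: "'a measure \<Rightarrow> real" where
  "mass \<mu> \<equiv> measure \<mu> (space \<mu>)"

definition couplings ::
    "'a::topological_space measure \<Rightarrow> 'a measure \<Rightarrow> ('a \<times> 'a) measure set" where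
  "couplings \<mu> \<nu> =
     {\<pi>. sets \<pi> = sets borel \<and> prob_space \<pi> \<and>
        (\<forall>A\<in>sets borel. mass \<mu> * measure \<pi> (A \<times> UNIV) = measure \<mu> A) \<and>
        (\<forall>B\<in>sets borel. mass \<nu> * measure \<pi> (UNIV \<times> B) = measure \<nu> B)}"

text \<open>Only meaningful for measures in \<open>finite_borel_measures2\<close> of equal mass, where the value
  under \<open>enn2real\<close> is finite (on separable spaces, by the product coupling).\<close>

definition wasserstein2 :: "'a::metric_space measure \<Rightarrow> 'a measure \<Rightarrow> real" where
  "wasserstein2 \<mu> \<nu> =
     sqrt (enn2real (ennreal (mass \<mu>) *
       (INF \<pi>\<in>couplings \<mu> \<nu>. \<integral>\<^sup>+ z. ennreal ((dist (fst z) (snd z))\<^sup>2) \<partial>\<pi>)))"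

definition gen_wasserstein ::
    "real \<Rightarrow> real \<Rightarrow> 'a::metric_space measure \<Rightarrow> 'a measure \<Rightarrow> real" where
  "gen_wasserstein a b \<mu>1 \<mu>2 =
     sqrt (Inf {a * tv_diff \<mu>1 \<nu>1 + a * tv_diff \<mu>2 \<nu>2 + b\<^sup>2 * (wasserstein2 \<nu>1 \<nu>2)\<^sup>2 | \<nu>1 \<nu>2.
       \<nu>1 \<in> finite_borel_measures2 \<and> \<nu>2 \<in> finite_borel_measures2 \<and> mass \<nu>1 = mass \<nu>2})"

definition gen_wasserstein_converges ::
    "real \<Rightarrow> real \<Rightarrow> (nat \<Rightarrow> 'a::metric_space measure) \<Rightarrow> 'a measure \<Rightarrow> bool" where
  "gen_wasserstein_converges a b \<mu>s \<mu> \<longleftrightarrow>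
     (\<lambda>n. gen_wasserstein a b (\<mu>s n) \<mu>) \<longlonglongrightarrow> 0"

definition gen_wasserstein_barycenters ::
    "real \<Rightarrow> real \<Rightarrow> nat \<Rightarrow> (nat \<Rightarrow> 'a::metric_space measure) \<Rightarrow> (nat \<Rightarrow> real) \<Rightarrow> 'a measure set"
where
  "gen_wasserstein_barycenters a b k \<nu> w =
     {\<mu>. is_arg_min (\<lambda>\<mu>. \<Sum>i=1..k. w i * (gen_wasserstein a b (\<nu> i) \<mu>)\<^sup>2)
           (\<lambda>\<mu>. \<mu> \<in> finite_borel_measures \<and> msupp \<mu> \<subseteq> (\<Union>i\<in>{1..k}. msupp (\<nu> i))) \<mu>}"

definition gen_wasserstein_precompact ::
    "real \<Rightarrow> real \<Rightarrow> (nat \<Rightarrow> 'a::metric_space measure) \<Rightarrow> bool" where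
  "gen_wasserstein_precompact a b \<mu>s \<longleftrightarrow>
     (\<forall>r::nat \<Rightarrow> nat. strict_mono r \<longrightarrow>
        (\<exists>(s::nat \<Rightarrow> nat) \<mu>. strict_mono s \<and> \<mu> \<in> finite_borel_measures \<and>
           gen_wasserstein_converges a b (\<mu>s \<circ> r \<circ> s) \<mu>))"

definition gen_wasserstein_limit_point ::
    "real \<Rightarrow> real \<Rightarrow> (nat \<Rightarrow> 'a::metric_space measure) \<Rightarrow> 'a measure \<Rightarrow> bool" where
  "gen_wasserstein_limit_point a b \<mu>s \<mu> \<longleftrightarrow>
     \<mu> \<in> finite_borel_measures \<and>
     (\<exists>r::nat \<Rightarrow> nat. strict_mono r \<and> gen_wasserstein_converges a b (\<mu>s \<circ> r) \<mu>)"

end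

theory Submission
  imports Defs "HOL-Complex_Analysis.Great_Picard"
begin

text \<open>Up to replacing the approximating measures by their common parts with \<open>\<mu>\<close> and \<open>\<nu>\<close>, the
  squared distance is the infimum of \<open>b\<^sup>2 \<integral> d\<^sup>2 d\<gamma> + a (|\<mu>| + |\<nu>| - 2 |\<gamma>|)\<close> over plans \<open>\<gamma>\<close> whose
  marginals lie below \<open>\<mu>\<close> and \<open>\<nu>\<close>. Such plans can be glued, which gives the triangle inequality.
  On a compact set, bounded sequences have convergent subsequences: extract a subsequence along which
  the masses of all cells of a countable family converge and realise the limiting cell masses by a
  push-forward of Lebesgue measure; measures with nearly equal masses on small cells are close.
  Comparing masses of balls shows that supports cannot escape from \<open>K\<close> in the limit and that every point
  of \<open>K\<close> is eventually close to \<open>\<Union>\<^sub>i supp \<mu>\<^sub>i\<^sup>n\<close>, so any competitor for the limit problem is a limit of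
  competitors for the approximating problems. Both claims then follow from the continuity of the
  barycenter functional.\<close>

section \<open>Couplings by cells\<close>

text \<open>A single construction, \<open>cell_coupled\<close>, serves both the triangle inequality
  and compactness. Two measures whose cell masses lie below those of a third measure
  \<open>m\<close> are coupled inside the cells, and the coupling keeps at least the mass |\<alpha>|
  + |\<beta>| - |m|. For gluing, \<open>m\<close> holds the cell masses of the middle measure, so
  the unmatched masses of the two plans add up. For compactness it holds the larger of two cell
  masses, so the unmatched mass is the l1 distance of the cell masses. This is possible because
  plans only need marginals below the given measures: whatever is not matched is paid for at the
  rate \<open>a\<close>, and no marginal has to be met exactly. The obstacle in the limit statement
  is that the admissible class depends on \<open>n\<close> through the supports of the data. A
  competitor for the limit problem may be admissible for no \<open>n\<close>, and a limit of
  minimisers could leave the limiting class. Both points are settled by a local estimate, since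
  small distance forces comparable masses on concentric balls, together with compactness of
  \<open>K\<close>, which makes the resulting nearness of supports uniform.\<close>

lemma ennreal_div_le_1: "x \<le> y \<Longrightarrow> y < \<infinity> \<Longrightarrow> x / y \<le> (1::ennreal)"
  by (cases "y = 0") (auto simp: divide_le_posI_ennreal zero_less_iff_neq_zero)

text \<open>Points lying in the same cell \<open>i\<close> are coupled independently, with total weight
  \<open>\<alpha> (cell i) \<beta> (cell i) / m {i}\<close>. The junk value \<open>1 / 0 = \<infinity>\<close> occurs only on a null set when \<open>m\<close>
  dominates the cell masses of \<open>\<alpha>\<close> and \<open>\<beta>\<close>.\<close>

definition cell_coupling ::
    "'a measure \<Rightarrow> 'b measure \<Rightarrow> 'i measure \<Rightarrow> ('a \<Rightarrow> 'i) \<Rightarrow> ('b \<Rightarrow> 'i) \<Rightarrow> ('a \<times> 'b) measure" where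
  "cell_coupling \<alpha> \<beta> m c1 c2 =
     density (\<alpha> \<Otimes>\<^sub>M \<beta>) (\<lambda>z. if c1 (fst z) = c2 (snd z) then 1 / emeasure m {c1 (fst z)} else 0)"

text \<open>Asking for domination rather than equality of the cell laws makes \<open>N\<close> a
  partial coupling: its marginals lie below \<open>\<alpha>\<close> and \<open>\<beta>\<close>, and
  the loss is controlled by \<open>mass_N\<close>. Countability of the index type lets singletons
  determine \<open>m\<close>.\<close>

locale cell_coupled =
  A: finite_measure \<alpha> + B: finite_measure \<beta> + C: finite_measure m
  for \<alpha> :: "'a measure" and \<beta> :: "'b measure" and m :: "'i::countable measure" +
  fixes c1 :: "'a \<Rightarrow> 'i" and c2 :: "'b \<Rightarrow> 'i"
  assumes sets_m: "sets m = UNIV"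
    and c1[measurable]: "c1 \<in> \<alpha> \<rightarrow>\<^sub>M count_space UNIV"
    and c2[measurable]: "c2 \<in> \<beta> \<rightarrow>\<^sub>M count_space UNIV"
    and law1: "distr \<alpha> (count_space UNIV) c1 \<le> m"
    and law2: "distr \<beta> (count_space UNIV) c2 \<le> m"
begin

abbreviation "N \<equiv> cell_coupling \<alpha> \<beta> m c1 c2"

text \<open>\<open>q2 (c1 x)\<close> is the density at \<open>x\<close> of the first marginal of
  \<open>N\<close> with respect to \<open>\<alpha>\<close>: integrating out the second coordinate
  leaves the ratio to which \<open>\<beta>\<close> fills the cell of \<open>x\<close>. The indices
  therefore cross, and \<open>q1\<close> belongs to the second marginal.\<close>

definition "q1 i = emeasure \<alpha> (c1 -` {i} \<inter> space \<alpha>) / emeasure m {i}"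
definition "q2 i = emeasure \<beta> (c2 -` {i} \<inter> space \<beta>) / emeasure m {i}"

lemma sets_N [measurable_cong]: "sets N = sets (\<alpha> \<Otimes>\<^sub>M \<beta>)"
  by (simp add: cell_coupling_def)

lemma law1_le: "emeasure \<alpha> (c1 -` X \<inter> space \<alpha>) \<le> emeasure m X"
  using le_measureD3[OF law1, of X] by (simp add: sets_m emeasure_distr)

lemma law2_le: "emeasure \<beta> (c2 -` X \<inter> space \<beta>) \<le> emeasure m X"
  using le_measureD3[OF law2, of X] by (simp add: sets_m emeasure_distr)

lemma finite_m: "emeasure m X < \<infinity>"
  using C.emeasure_finite[of X] by (simp add: less_top[symmetric])

lemma q_le_1: "q1 i \<le> 1" "q2 i \<le> 1"
  unfolding q1_def q2_def using finite_m law1_le law2_le by (auto intro: ennreal_div_le_1)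

lemma kernel1:
  assumes "x \<in> space \<alpha>"
  shows "(\<integral>\<^sup>+y. (if c1 x = c2 y then 1 / emeasure m {c1 x} else 0) \<partial>\<beta>) = q2 (c1 x)"
proof -
  have "(\<integral>\<^sup>+y. (if c1 x = c2 y then 1 / emeasure m {c1 x} else 0) \<partial>\<beta>) =
        (\<integral>\<^sup>+y. 1 / emeasure m {c1 x} * indicator (c2 -` {c1 x} \<inter> space \<beta>) y \<partial>\<beta>)"
    by (intro nn_integral_cong) (auto simp: indicator_def)
  also have "\<dots> = q2 (c1 x)"
    by (subst nn_integral_cmult_indicator) (auto simp: q2_def ennreal_divide_times)
  finally show ?thesis .
qed

lemma kernel2:
  assumes "y \<in> space \<beta>"
  shows "(\<integral>\<^sup>+x. (if c1 x = c2 y then 1 / emeasure m {c1 x} else 0) \<partial>\<alpha>) = q1 (c2 y)"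
proof -
  have "(\<integral>\<^sup>+x. (if c1 x = c2 y then 1 / emeasure m {c1 x} else 0) \<partial>\<alpha>) =
        (\<integral>\<^sup>+x. 1 / emeasure m {c2 y} * indicator (c1 -` {c2 y} \<inter> space \<alpha>) x \<partial>\<alpha>)"
    by (intro nn_integral_cong) (auto simp: indicator_def)
  also have "\<dots> = q1 (c2 y)"
    by (subst nn_integral_cmult_indicator) (auto simp: q1_def ennreal_divide_times)
  finally show ?thesis .
qed

lemma kernel_measurable [measurable]:
  "(\<lambda>z. if c1 (fst z) = c2 (snd z) then 1 / emeasure m {c1 (fst z)} else 0)
     \<in> borel_measurable (\<alpha> \<Otimes>\<^sub>M \<beta>)"
proof -
  have [measurable]: "(\<lambda>z. c1 (fst z)) \<in> \<alpha> \<Otimes>\<^sub>M \<beta> \<rightarrow>\<^sub>M count_space UNIV"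
       "(\<lambda>z. c2 (snd z)) \<in> \<alpha> \<Otimes>\<^sub>M \<beta> \<rightarrow>\<^sub>M count_space UNIV"
    by measurable
  have "(\<lambda>z. (\<lambda>i z. if i = c2 (snd z) then 1 / emeasure m {i} else 0) (c1 (fst z)) z)
     \<in> borel_measurable (\<alpha> \<Otimes>\<^sub>M \<beta>)"
    by (rule measurable_compose_countable) measurable
  then show ?thesis by simp
qed

lemma nn_integral_fst_N:
  assumes [measurable]: "F \<in> borel_measurable \<alpha>"
  shows "(\<integral>\<^sup>+z. F (fst z) \<partial>N) = (\<integral>\<^sup>+x. F x * q2 (c1 x) \<partial>\<alpha>)"
proof -
  have "(\<integral>\<^sup>+z. F (fst z) \<partial>N) = (\<integral>\<^sup>+z. F (fst z) *
      (if c1 (fst z) = c2 (snd z) then 1 / emeasure m {c1 (fst z)} else 0) \<partial>(\<alpha> \<Otimes>\<^sub>M \<beta>))"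
    unfolding cell_coupling_def by (subst nn_integral_density) (auto simp: mult.commute)
  also have "\<dots> = (\<integral>\<^sup>+x. \<integral>\<^sup>+y. F x * (if c1 x = c2 y then 1 / emeasure m {c1 x} else 0) \<partial>\<beta> \<partial>\<alpha>)"
    by (subst B.nn_integral_fst[symmetric]) ((measurable; fail) | simp cong: if_cong)+
  also have "\<dots> = (\<integral>\<^sup>+x. F x * q2 (c1 x) \<partial>\<alpha>)"
    by (intro nn_integral_cong) (subst nn_integral_cmult, simp_all add: kernel1)
  finally show ?thesis .
qed

lemma nn_integral_snd_N:
  assumes [measurable]: "F \<in> borel_measurable \<beta>"
  shows "(\<integral>\<^sup>+z. F (snd z) \<partial>N) = (\<integral>\<^sup>+y. F y * q1 (c2 y) \<partial>\<beta>)"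
proof -
  interpret pair_sigma_finite \<alpha> \<beta> ..
  have "(\<integral>\<^sup>+z. F (snd z) \<partial>N) = (\<integral>\<^sup>+z. F (snd z) *
      (if c1 (fst z) = c2 (snd z) then 1 / emeasure m {c1 (fst z)} else 0) \<partial>(\<alpha> \<Otimes>\<^sub>M \<beta>))"
    unfolding cell_coupling_def by (subst nn_integral_density) (auto simp: mult.commute)
  also have "\<dots> = (\<integral>\<^sup>+y. \<integral>\<^sup>+x. F y * (if c1 x = c2 y then 1 / emeasure m {c1 x} else 0) \<partial>\<alpha> \<partial>\<beta>)"
    by (subst nn_integral_snd[symmetric]) ((measurable; fail) | simp cong: if_cong)+
  also have "\<dots> = (\<integral>\<^sup>+y. F y * q1 (c2 y) \<partial>\<beta>)"
    using measurable_compose[OF c1, of "\<lambda>j. if j = i then 1 / emeasure m {j} else 0" borel for i]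
    by (intro nn_integral_cong) (subst nn_integral_cmult, simp_all add: kernel2)
  finally show ?thesis .
qed

lemma nn_integral_fst_le:
  assumes "F \<in> borel_measurable \<alpha>"
  shows "(\<integral>\<^sup>+z. F (fst z) \<partial>N) \<le> (\<integral>\<^sup>+x. F x \<partial>\<alpha>)"
  unfolding nn_integral_fst_N[OF assms]
  by (intro nn_integral_mono) (metis mult_left_mono mult.right_neutral q_le_1(2) zero_le)

lemma nn_integral_snd_le:
  assumes "F \<in> borel_measurable \<beta>"
  shows "(\<integral>\<^sup>+z. F (snd z) \<partial>N) \<le> (\<integral>\<^sup>+x. F x \<partial>\<beta>)"
  unfolding nn_integral_snd_N[OF assms]
  by (intro nn_integral_mono) (metis mult_left_mono mult.right_neutral q_le_1(1) zero_le)

lemma space_N: "space N = space \<alpha> \<times> space \<beta>"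
  by (simp add: cell_coupling_def space_pair_measure)

lemma finite_N: "finite_measure N"
proof
  have "emeasure N (space N) = (\<integral>\<^sup>+z. 1 \<partial>N)" by simp
  also have "\<dots> \<le> (\<integral>\<^sup>+z. 1 \<partial>\<alpha>)" using nn_integral_fst_le[of "\<lambda>_. 1"] by simp
  finally show "emeasure N (space N) \<noteq> \<infinity>" by (auto simp: top_unique)
qed

lemma AE_N_same_cell: "AE z in N. c1 (fst z) = c2 (snd z)"
  unfolding cell_coupling_def by (subst AE_density) auto

lemma distr_fst_le:
  assumes [measurable]: "F \<in> \<alpha> \<rightarrow>\<^sub>M M"
  shows "distr N M (\<lambda>z. F (fst z)) \<le> distr \<alpha> M F"
proof -
  have "emeasure (distr N M (\<lambda>z. F (fst z))) A \<le> emeasure (distr \<alpha> M F) A" if [measurable]: "A \<in> sets M" for A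
  proof -
    have "emeasure (distr N M (\<lambda>z. F (fst z))) A = (\<integral>\<^sup>+z. indicator A (F (fst z)) \<partial>N)"
      by (subst nn_integral_indicator[symmetric], simp, subst nn_integral_distr) simp_all
    also have "\<dots> \<le> (\<integral>\<^sup>+x. indicator A (F x) \<partial>\<alpha>)"
      by (rule nn_integral_fst_le) simp
    also have "\<dots> = emeasure (distr \<alpha> M F) A"
      by (subst nn_integral_indicator[symmetric], simp, subst nn_integral_distr) simp_all
    finally show ?thesis .
  qed
  then show ?thesis by (subst le_measure) auto
qed

lemma distr_snd_le:
  assumes [measurable]: "F \<in> \<beta> \<rightarrow>\<^sub>M M"
  shows "distr N M (\<lambda>z. F (snd z)) \<le> distr \<beta> M F"
proof -
  have "emeasure (distr N M (\<lambda>z. F (snd z))) A \<le> emeasure (distr \<beta> M F) A" if [measurable]: "A \<in> sets M" for A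
  proof -
    have "emeasure (distr N M (\<lambda>z. F (snd z))) A = (\<integral>\<^sup>+z. indicator A (F (snd z)) \<partial>N)"
      by (subst nn_integral_indicator[symmetric], simp, subst nn_integral_distr) simp_all
    also have "\<dots> \<le> (\<integral>\<^sup>+x. indicator A (F x) \<partial>\<beta>)"
      by (rule nn_integral_snd_le) simp
    also have "\<dots> = emeasure (distr \<beta> M F) A"
      by (subst nn_integral_indicator[symmetric], simp, subst nn_integral_distr) simp_all
    finally show ?thesis .
  qed
  then show ?thesis by (subst le_measure) auto
qed

lemma AE_N_fst:
  assumes "AE x in \<alpha>. P x"
  shows "AE z in N. P (fst z)"
proof -
  obtain X where X: "{x \<in> space \<alpha>. \<not> P x} \<subseteq> X" "emeasure \<alpha> X = 0" and [measurable]: "X \<in> sets \<alpha>"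
    using AE_E[OF assms] by blast
  have "(\<integral>\<^sup>+z. indicator X (fst z) \<partial>N) \<le> (\<integral>\<^sup>+x. indicator X x \<partial>\<alpha>)"
    by (rule nn_integral_fst_le) simp
  also have "\<dots> = 0" using X by simp
  finally have "AE z in N. indicator X (fst z) = (0::ennreal)"
    by (subst (asm) le_zero_eq, subst (asm) nn_integral_0_iff_AE) auto
  then show ?thesis
    by (rule AE_mp) (use X(1) in \<open>auto simp: space_N indicator_def intro!: AE_I2 split: if_splits\<close>)
qed

lemma AE_N_snd:
  assumes "AE x in \<beta>. P x"
  shows "AE z in N. P (snd z)"
proof -
  obtain X where X: "{x \<in> space \<beta>. \<not> P x} \<subseteq> X" "emeasure \<beta> X = 0" and [measurable]: "X \<in> sets \<beta>"
    using AE_E[OF assms] by blast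
  have "(\<integral>\<^sup>+z. indicator X (snd z) \<partial>N) \<le> (\<integral>\<^sup>+x. indicator X x \<partial>\<beta>)"
    by (rule nn_integral_snd_le) simp
  also have "\<dots> = 0" using X by simp
  finally have "AE z in N. indicator X (snd z) = (0::ennreal)"
    by (subst (asm) le_zero_eq, subst (asm) nn_integral_0_iff_AE) auto
  then show ?thesis
    by (rule AE_mp) (use X(1) in \<open>auto simp: space_N indicator_def intro!: AE_I2 split: if_splits\<close>)
qed

text \<open>In one cell with masses \<open>A\<close>, \<open>B\<close> and \<open>M = m {i}\<close>
  the coupling has mass \<open>A * B / M\<close>, and \<open>A + B \<le> M + A * B / M\<close> is
  \<open>(M - A) * (M - B) \<ge> 0\<close> divided by \<open>M\<close>. The proof sums over the
  cells by integrating \<open>1 - q2\<close> against \<open>m\<close> instead of against the cell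
  law of \<open>\<alpha>\<close>.\<close>

lemma mass_N: "emeasure \<alpha> (space \<alpha>) + emeasure \<beta> (space \<beta>) \<le>
    emeasure m (space m) + emeasure N (space N)"
proof -
  have [measurable_cong]: "sets m = sets (count_space UNIV)" by (simp add: sets_m)
  have dens: "density m q2 = distr \<beta> (count_space UNIV) c2"
  proof (rule measure_eqI_countable[of _ UNIV])
    fix i :: 'i
    have "emeasure (density m q2) {i} = (\<integral>\<^sup>+j. q2 j * indicator {i} j \<partial>m)"
      by (subst emeasure_density) (auto simp: sets_m)
    also have "\<dots> = (\<integral>\<^sup>+j. q2 i * indicator {i} j \<partial>m)"
      by (intro nn_integral_cong) (auto simp: indicator_def)
    also have "\<dots> = q2 i * emeasure m {i}"
      by (subst nn_integral_cmult_indicator) (auto simp: sets_m)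
    also have "\<dots> = emeasure \<beta> (c2 -` {i} \<inter> space \<beta>)"
    \<comment> \<open>A cell that is null for \<open>m\<close> is null for \<open>\<beta>\<close> by
      \<open>law2\<close>, so both sides vanish whatever the quotient is.\<close>
    proof (cases "emeasure m {i} = 0")
      case True
      then show ?thesis using law2_le[of "{i}"] by simp
    next
      case False
      then show ?thesis using finite_m[of "{i}"] unfolding q2_def
        by (subst ennreal_divide_times) (simp add: ennreal_mult_divide_eq)
    qed
    finally show "emeasure (density m q2) {i} = emeasure (distr \<beta> (count_space UNIV) c2) {i}"
      by (simp add: emeasure_distr)
  qed (auto simp: sets_m)
  have "emeasure \<beta> (space \<beta>) = emeasure (density m q2) UNIV"
    by (simp add: dens emeasure_distr)
  also have "\<dots> = (\<integral>\<^sup>+j. q2 j \<partial>m)"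
    by (subst emeasure_density) (auto simp: sets_m)
  finally have b: "emeasure \<beta> (space \<beta>) = (\<integral>\<^sup>+j. q2 j \<partial>m)" .
  have [measurable]: "q2 \<in> borel_measurable m" by measurable
  have n: "emeasure N (space N) = (\<integral>\<^sup>+x. q2 (c1 x) \<partial>\<alpha>)"
    using nn_integral_fst_N[of "\<lambda>_. 1"] by simp
  have "emeasure \<alpha> (space \<alpha>) = (\<integral>\<^sup>+x. (1 - q2 (c1 x)) + q2 (c1 x) \<partial>\<alpha>)"
    by (simp add: diff_add_cancel_ennreal q_le_1)
  also have "\<dots> = (\<integral>\<^sup>+x. (1 - q2 (c1 x)) \<partial>\<alpha>) + emeasure N (space N)"
    unfolding n by (rule nn_integral_add) auto
  also have "(\<integral>\<^sup>+x. (1 - q2 (c1 x)) \<partial>\<alpha>) = (\<integral>\<^sup>+i. (1 - q2 i) \<partial>distr \<alpha> (count_space UNIV) c1)"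
    by (subst nn_integral_distr) auto
  also have "\<dots> \<le> (\<integral>\<^sup>+i. (1 - q2 i) \<partial>m)"
    by (rule nn_integral_mono_measure) (auto simp: sets_m law1)
  finally have "emeasure \<alpha> (space \<alpha>) + emeasure \<beta> (space \<beta>)
      \<le> ((\<integral>\<^sup>+i. (1 - q2 i) \<partial>m) + (\<integral>\<^sup>+j. q2 j \<partial>m)) + emeasure N (space N)"
    unfolding b by (simp add: add_mono add.assoc add.commute add.left_commute)
  also have "(\<integral>\<^sup>+i. (1 - q2 i) \<partial>m) + (\<integral>\<^sup>+j. q2 j \<partial>m) = (\<integral>\<^sup>+i. (1 - q2 i) + q2 i \<partial>m)"
    by (rule nn_integral_add[symmetric]) auto
  also have "\<dots> = emeasure m (space m)"
    by (simp add: diff_add_cancel_ennreal q_le_1)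
  finally show ?thesis .
qed

end

section \<open>Partial transport plans\<close>

lemma finite_borel_measuresD:
  assumes "\<mu> \<in> finite_borel_measures"
  shows "sets \<mu> = sets borel" "space \<mu> = UNIV" "finite_measure \<mu>"
  using assms sets_eq_imp_space_eq[of \<mu> borel] by (auto simp: finite_borel_measures_def)

lemma emeasure_finite_borel_measure:
  "\<mu> \<in> finite_borel_measures \<Longrightarrow> emeasure \<mu> A = ennreal (measure \<mu> A)"
  by (simp add: finite_borel_measures_def finite_measure.emeasure_eq_measure)

lemma finite_borel_measures2D: "\<mu> \<in> finite_borel_measures2 \<Longrightarrow> \<mu> \<in> finite_borel_measures"
  by (simp add: finite_borel_measures2_def)

lemma finite_borel_measures_distr:
  assumes "finite_measure N" "f \<in> N \<rightarrow>\<^sub>M borel"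
  shows "distr N borel f \<in> finite_borel_measures"
  using assms by (simp add: finite_borel_measures_def finite_measure.finite_measure_distr)

lemma mass_distr: "f \<in> N \<rightarrow>\<^sub>M borel \<Longrightarrow> measure (distr N borel f) UNIV = mass N"
  by (simp add: measure_distr)

lemma finite_borel_measures_le:
  assumes "\<kappa> \<le> \<nu>" "\<nu> \<in> finite_borel_measures" "sets \<kappa> = sets borel"
  shows "\<kappa> \<in> finite_borel_measures"
proof -
  have "emeasure \<kappa> (space \<kappa>) \<le> emeasure \<nu> (space \<kappa>)"
    using assms finite_borel_measuresD[OF assms(2)] by (intro le_measureD3) auto
  then have "finite_measure \<kappa>"
    using assms(2) by (intro finite_measureI) (auto simp: emeasure_finite_borel_measure top_unique)
  then show ?thesis using assms(3) by (simp add: finite_borel_measures_def)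
qed

lemma finite_borel_measures2_le:
  assumes "\<kappa> \<le> \<nu>" "\<nu> \<in> finite_borel_measures2" "sets \<kappa> = sets borel"
  shows "\<kappa> \<in> finite_borel_measures2"
proof -
  obtain x0 where x0: "(\<integral>\<^sup>+ x. ennreal ((dist x0 x)\<^sup>2) \<partial>\<nu>) < \<infinity>"
    using assms(2) by (auto simp: finite_borel_measures2_def)
  have \<nu>: "\<nu> \<in> finite_borel_measures" using assms(2) by (rule finite_borel_measures2D)
  have "(\<integral>\<^sup>+ x. ennreal ((dist x0 x)\<^sup>2) \<partial>\<kappa>) \<le> (\<integral>\<^sup>+ x. ennreal ((dist x0 x)\<^sup>2) \<partial>\<nu>)"
    using finite_borel_measuresD[OF \<nu>] assms by (intro nn_integral_mono_measure) auto
  with x0 finite_borel_measures_le[OF assms(1) \<nu> assms(3)] show ?thesis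
    unfolding finite_borel_measures2_def by (blast intro: le_less_trans)
qed

lemma null_borel_finite: "null_measure borel \<in> finite_borel_measures"
  by (auto simp: finite_borel_measures_def intro!: finite_measureI)

lemma null_borel_finite2: "null_measure borel \<in> finite_borel_measures2"
  by (simp add: finite_borel_measures2_def null_borel_finite)

section \<open>Total variation of differences and common parts of two measures\<close>

lemma tv_diff_nonneg:
  assumes "\<mu> \<in> finite_borel_measures" "\<nu> \<in> finite_borel_measures"
  shows "0 \<le> tv_diff \<mu> \<nu>"
proof -
  obtain p m where "jordan_decomposition (\<lambda>A. measure \<mu> A - measure \<nu> A) p m"
    using jordan_decomposition_exists[OF assms] by blast
  then show ?thesis unfolding tv_diff_def by (subst total_variation_eq) auto
qed

lemma le_borel_measureI:
  assumes "sets \<kappa> = sets borel" "sets \<mu> = sets borel"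
    "\<And>A. A \<in> sets borel \<Longrightarrow> emeasure \<kappa> A \<le> emeasure \<mu> A"
  shows "\<kappa> \<le> \<mu>"
  using assms by (subst le_measure) auto

text \<open>The difference is itself a measure, so the negative part of its Jordan decomposition is
  null.\<close>

lemma tv_diff_le_measure:
  fixes \<mu> \<nu> :: "'a::topological_space measure"
  assumes \<mu>: "\<mu> \<in> finite_borel_measures" and \<nu>: "\<nu> \<in> finite_borel_measures" and le: "\<nu> \<le> \<mu>"
  shows "tv_diff \<mu> \<nu> = measure \<mu> UNIV - measure \<nu> UNIV"
proof -
  obtain p where p: "p \<in> finite_borel_measures"
      "\<And>X. X \<in> sets borel \<Longrightarrow> measure p X = measure \<mu> X - measure \<nu> X"
  proof -
    have "sets \<nu> = sets \<mu>"
      by (simp only: finite_borel_measuresD(1)[OF \<mu>] finite_borel_measuresD(1)[OF \<nu>])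
    then have "emeasure \<nu> X \<le> emeasure \<mu> X" for X
      by (rule le_measureD3[OF le])
    then have "\<exists>p. p \<in> finite_borel_measures \<and> (\<forall>X\<in>sets borel. measure p X = measure \<mu> X - measure \<nu> X)"
      using diff_measure_restricted[OF \<mu> \<nu>, of UNIV] by simp
    then show thesis using that by blast
  qed
  have "jordan_decomposition (\<lambda>A. measure \<mu> A - measure \<nu> A) p (null_measure borel)"
    unfolding jordan_decomposition_def
  proof (intro conjI ballI bexI[of _ UNIV])
    show "null_measure borel \<in> finite_borel_measures"
      by (rule null_borel_finite)
  qed (use p in auto)
  then show ?thesis
    unfolding tv_diff_def by (subst total_variation_eq) (auto simp: p(2))
qed

text \<open>On \<open>A = {f > 1}\<close> domination bounds the integral of \<open>f\<close> by that
  of 1, so the function \<open>f - 1\<close>, positive on \<open>A\<close>, integrates to 0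
  there.\<close>

lemma AE_density_le_1:
  assumes "finite_measure \<nu>" and [measurable]: "f \<in> borel_measurable \<nu>"
    and le: "\<And>A. A \<in> sets \<nu> \<Longrightarrow> emeasure (density \<nu> f) A \<le> emeasure \<nu> A"
  shows "AE x in \<nu>. f x \<le> 1"
proof -
  interpret finite_measure \<nu> by fact
  define A where "A = {x \<in> space \<nu>. 1 < f x}"
  have [measurable]: "A \<in> sets \<nu>" unfolding A_def by measurable
  have fA: "(\<integral>\<^sup>+x. f x * indicator A x \<partial>\<nu>) \<le> emeasure \<nu> A"
    using le[of A] by (simp add: emeasure_density)
  have "(\<integral>\<^sup>+x. (f x - 1) * indicator A x \<partial>\<nu>)
      = (\<integral>\<^sup>+x. f x * indicator A x - indicator A x \<partial>\<nu>)"
    by (intro nn_integral_cong) (auto simp: indicator_def)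
  also have "\<dots> = (\<integral>\<^sup>+x. f x * indicator A x \<partial>\<nu>) - (\<integral>\<^sup>+x. indicator A x \<partial>\<nu>)"
    by (rule nn_integral_diff, simp_all add: emeasure_eq_measure) (auto simp: A_def indicator_def)
  also have "\<dots> = 0"
    by (rule diff_eq_0_ennreal) (use fA in \<open>auto intro: le_less_trans simp: emeasure_eq_measure\<close>)
  finally have "(\<integral>\<^sup>+x. (f x - 1) * indicator A x \<partial>\<nu>) = 0" .
  then have "AE x in \<nu>. (f x - 1) * indicator A x = 0"
    by (subst (asm) nn_integral_0_iff_AE) auto
  then show ?thesis
    by (rule AE_mp)
      (auto simp: A_def indicator_def not_less diff_eq_0_iff_ennreal intro!: AE_I2 split: if_splits)
qed

text \<open>\<open>h\<close> is the density of the largest common part \<open>\<mu> \<and> \<nu>\<close> with respect to \<open>\<nu>\<close>.\<close>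

lemma common_part_density:
  fixes \<mu> \<nu> :: "'a::topological_space measure"
  assumes \<mu>: "\<mu> \<in> finite_borel_measures" and \<nu>: "\<nu> \<in> finite_borel_measures"
  obtains h where "h \<in> borel_measurable borel" "\<And>x. h x \<le> (1::ennreal)" "density \<nu> h \<le> \<mu>"
    "tv_diff \<mu> \<nu> = measure \<mu> UNIV + measure \<nu> UNIV - 2 * measure (density \<nu> h) UNIV"
proof -
  note M = finite_borel_measuresD[OF \<mu>] and N = finite_borel_measuresD[OF \<nu>]
  interpret N: finite_measure \<nu> by (rule N)
  obtain p m where j: "jordan_decomposition (\<lambda>A. measure \<mu> A - measure \<nu> A) p m"
    using jordan_decomposition_exists[OF assms] by blast
  obtain S where S: "S \<in> sets borel" "measure p (- S) = 0" "measure m S = 0"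
    and pm: "p \<in> finite_borel_measures" "m \<in> finite_borel_measures"
    and eq: "\<And>A. A \<in> sets borel \<Longrightarrow> measure \<mu> A - measure \<nu> A = measure p A - measure m A"
    using j by (auto simp: jordan_decomposition_def)
  note P' = finite_borel_measuresD[OF pm(1)] and M' = finite_borel_measuresD[OF pm(2)]
  interpret P: finite_measure p by (rule P')
  interpret M: finite_measure m by (rule M')
  \<comment> \<open>\<open>m\<close> lives off \<open>S\<close>, where \<open>p\<close> vanishes;
    there it equals \<open>\<nu> - \<mu>\<close> and is thus at most \<open>\<nu>\<close>.\<close>
  have mle: "measure m X \<le> measure \<nu> X" if X: "X \<in> sets borel" for X
  proof -
    have XS: "X - S \<in> sets borel" "X \<inter> S \<in> sets borel" using X S by auto
    have 0: "measure m (X \<inter> S) = 0" "measure p (X - S) = 0"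
      using M.finite_measure_mono[of "X \<inter> S" S] P.finite_measure_mono[of "X - S" "- S"] S P' M'
      by (auto simp: measure_le_0_iff)
    have "(X - S) \<union> (X \<inter> S) = X" "(X - S) \<inter> (X \<inter> S) = {}" by auto
    then have "measure m X = measure m (X - S) + measure m (X \<inter> S)"
      using M.finite_measure_Union[of "X - S" "X \<inter> S"] XS M' by metis
    also have "\<dots> \<le> measure \<nu> (X - S)"
      using eq[OF XS(1)] measure_nonneg[of \<mu> "X - S"] 0 by linarith
    also have "measure \<nu> (X - S) \<le> measure \<nu> X"
      using X N by (intro N.finite_measure_mono) auto
    finally show ?thesis .
  qed
  \<comment> \<open>\<open>\<kappa> = \<nu> - m = \<mu> - p\<close> is the common part: what remains
    of either measure once its excess over the other is removed.\<close>
  obtain \<kappa> where \<kappa>: "\<kappa> \<in> finite_borel_measures"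
      "\<And>X. X \<in> sets borel \<Longrightarrow> measure \<kappa> X = measure \<nu> X - measure m X"
  proof -
    have "emeasure m X \<le> emeasure \<nu> X" if "X \<in> sets borel" for X
      using mle[OF that] by (simp add: emeasure_finite_borel_measure pm(2) \<nu>)
    then have "\<exists>p. p \<in> finite_borel_measures \<and> (\<forall>X\<in>sets borel. measure p X = measure \<nu> X - measure m X)"
      using diff_measure_restricted[OF \<nu> pm(2), of UNIV] by simp
    then show thesis using that by blast
  qed
  note K = finite_borel_measuresD[OF \<kappa>(1)]
  have \<kappa>\<nu>: "emeasure \<kappa> X \<le> emeasure \<nu> X" if "X \<in> sets borel" for X
    using \<kappa>(2)[OF that] by (simp add: emeasure_finite_borel_measure \<kappa>(1) \<nu>)
  have \<kappa>\<mu>: "emeasure \<kappa> X \<le> emeasure \<mu> X" if "X \<in> sets borel" for X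
  proof -
    have "measure \<kappa> X \<le> measure \<mu> X"
      using \<kappa>(2)[OF that] eq[OF that] measure_nonneg[of p X] by linarith
    then show ?thesis by (simp add: emeasure_finite_borel_measure \<kappa>(1) \<mu> ennreal_leI)
  qed
  have "absolutely_continuous \<nu> \<kappa>"
    unfolding absolutely_continuous_def 
  proof
    fix X assume "X \<in> null_sets \<nu>"
    then show "X \<in> null_sets \<kappa>" using \<kappa>\<nu>[of X] N K by (simp add: null_sets_def)
  qed
  then obtain f where f: "f \<in> borel_measurable \<nu>" "density \<nu> f = \<kappa>"
    using N.Radon_Nikodym K N by metis
  have f': "f \<in> borel_measurable borel" using f(1) N measurable_cong_sets by blast
  \<comment> \<open>The Radon-Nikodym density is at most 1 only almost everywhere; truncating it
    gives the pointwise bound and leaves the measure unchanged.\<close>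
  have "AE x in \<nu>. f x \<le> 1"
    by (rule AE_density_le_1) (use f \<kappa>\<nu> N in auto)
  then have d: "density \<nu> (\<lambda>x. min 1 (f x)) = \<kappa>"
    unfolding f(2)[symmetric] using f(1) by (intro density_cong) (auto simp: min_def)
  show thesis
  proof (rule that[of "\<lambda>x. min 1 (f x)"])
    show "density \<nu> (\<lambda>x. min 1 (f x)) \<le> \<mu>"
      unfolding d by (rule le_borel_measureI) (use K M \<kappa>\<mu> in auto)
    show "tv_diff \<mu> \<nu> = measure \<mu> UNIV + measure \<nu> UNIV - 2 * measure (density \<nu> (\<lambda>x. min 1 (f x))) UNIV"
      unfolding d tv_diff_def total_variation_eq[OF j] using \<kappa>(2)[of UNIV] eq[of UNIV] by simp
  qed (use f' in auto)
qed

section \<open>The squared distance as an infimum over partial plans\<close>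

text \<open>The carrier is any measure with two maps rather than a measure on the square: glued
  plans live on a product of two plans, and those of the compactness argument on a product with the
  real line. The last two clauses make the marginals admissible in the infimum defining
  \<open>gen_wasserstein\<close>.\<close>

definition partial_plan ::
    "'c measure \<Rightarrow> ('c \<Rightarrow> 'a::metric_space) \<Rightarrow> ('c \<Rightarrow> 'a) \<Rightarrow> 'a measure \<Rightarrow> 'a measure \<Rightarrow> bool" where
  "partial_plan N f g \<mu> \<nu> \<longleftrightarrow> finite_measure N \<and> f \<in> N \<rightarrow>\<^sub>M borel \<and> g \<in> N \<rightarrow>\<^sub>M borel \<and>
     distr N borel f \<le> \<mu> \<and> distr N borel g \<le> \<nu> \<and>
     distr N borel f \<in> finite_borel_measures2 \<and> distr N borel g \<in> finite_borel_measures2"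

text \<open>\<open>Inf\<close> and \<open>sqrt\<close> on the reals carry the intended meaning only
  for a nonempty set of nonnegative numbers; the null measures provide a member.\<close>

lemma gen_wasserstein_set:
  fixes a b :: real and \<mu>1 \<mu>2 :: "'a::metric_space measure"
  assumes "0 \<le> a" "\<mu>1 \<in> finite_borel_measures" "\<mu>2 \<in> finite_borel_measures"
  defines "S \<equiv> {a * tv_diff \<mu>1 \<nu>1 + a * tv_diff \<mu>2 \<nu>2 + b\<^sup>2 * (wasserstein2 \<nu>1 \<nu>2)\<^sup>2 | \<nu>1 \<nu>2.
       \<nu>1 \<in> finite_borel_measures2 \<and> \<nu>2 \<in> finite_borel_measures2 \<and> mass \<nu>1 = mass \<nu>2}"
  shows "S \<noteq> {}" "bdd_below S" "(gen_wasserstein a b \<mu>1 \<mu>2)\<^sup>2 = Inf S"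
proof -
  have "\<exists>(\<nu>1 :: 'a measure) (\<nu>2 :: 'a measure). \<nu>1 \<in> finite_borel_measures2 \<and> \<nu>2 \<in> finite_borel_measures2 \<and> mass \<nu>1 = mass \<nu>2"
    using null_borel_finite2 by (intro exI[of _ "null_measure borel"]) simp
  then show ne: "S \<noteq> {}" by (auto simp: S_def)
  have pos: "0 \<le> s" if "s \<in> S" for s
    using that assms unfolding S_def
    by (auto intro!: add_nonneg_nonneg mult_nonneg_nonneg tv_diff_nonneg finite_borel_measures2D)
  then show "bdd_below S" by (rule bdd_belowI)
  have "0 \<le> Inf S" using ne pos by (rule cInf_greatest)
  then show "(gen_wasserstein a b \<mu>1 \<mu>2)\<^sup>2 = Inf S"
    by (simp add: gen_wasserstein_def S_def)
qed

lemma gen_wasserstein_nonneg: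
  assumes "0 \<le> a" "\<mu>1 \<in> finite_borel_measures" "\<mu>2 \<in> finite_borel_measures"
  shows "0 \<le> gen_wasserstein a b \<mu>1 \<mu>2"
proof -
  have "0 \<le> Inf {a * tv_diff \<mu>1 \<nu>1 + a * tv_diff \<mu>2 \<nu>2 + b\<^sup>2 * (wasserstein2 \<nu>1 \<nu>2)\<^sup>2 | \<nu>1 \<nu>2.
       \<nu>1 \<in> finite_borel_measures2 \<and> \<nu>2 \<in> finite_borel_measures2 \<and> mass \<nu>1 = mass \<nu>2}"
    using gen_wasserstein_set(3)[OF assms, of b] by (metis zero_le_power2)
  then show ?thesis by (simp add: gen_wasserstein_def)
qed

text \<open>\<open>couplings\<close> contains probability measures while \<open>N\<close> has
  arbitrary mass, so the joint law of \<open>f\<close> and \<open>g\<close> is divided by the mass;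
  the prefactor in \<open>wasserstein2\<close> restores it.\<close>

lemma wasserstein2_le:
  fixes f g :: "'c \<Rightarrow> 'a::{metric_space, second_countable_topology}"
  assumes N: "finite_measure N" and [measurable]: "f \<in> N \<rightarrow>\<^sub>M borel" "g \<in> N \<rightarrow>\<^sub>M borel"
    and c: "(\<integral>\<^sup>+\<omega>. ennreal ((dist (f \<omega>) (g \<omega>))\<^sup>2) \<partial>N) \<le> ennreal c" "0 \<le> c"
  shows "(wasserstein2 (distr N borel f) (distr N borel g))\<^sup>2 \<le> c"
proof -
  interpret finite_measure N by fact
  let ?I = "\<lambda>\<pi>. \<integral>\<^sup>+ z. ennreal ((dist (fst z) (snd z))\<^sup>2) \<partial>\<pi>"
  define m where "m = mass N"
  have [measurable]: "(\<lambda>\<omega>. (f \<omega>, g \<omega>)) \<in> N \<rightarrow>\<^sub>M borel"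
    and [measurable]: "(\<lambda>z::'a \<times> 'a. (dist (fst z) (snd z))\<^sup>2) \<in> borel_measurable borel"
    unfolding borel_prod[symmetric] by measurable
  have "ennreal m * (INF \<pi>\<in>couplings (distr N borel f) (distr N borel g). ?I \<pi>) \<le> ennreal c"
  \<comment> \<open>With zero mass there is nothing to normalise: the prefactor makes the left side
    0.\<close>
  proof (cases "m = 0")
    case False
    then have m: "m > 0" by (simp add: m_def zero_less_measure_iff)
    define \<pi> where "\<pi> = scale_measure (ennreal (1 / m)) (distr N borel (\<lambda>\<omega>. (f \<omega>, g \<omega>)))"
    have em: "emeasure \<pi> A = ennreal (measure N ((\<lambda>\<omega>. (f \<omega>, g \<omega>)) -` A \<inter> space N) / m)"
      if "A \<in> sets borel" for A
      using that m by (simp add: \<pi>_def emeasure_distr emeasure_eq_measure ennreal_mult'[symmetric])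
    then have me: "measure \<pi> A = measure N ((\<lambda>\<omega>. (f \<omega>, g \<omega>)) -` A \<inter> space N) / m"
      if "A \<in> sets borel" for A
      using that m by (simp add: measure_def)
    have sp: "sets \<pi> = sets borel" by (simp add: \<pi>_def)
    have "prob_space \<pi>"
    proof
      show "emeasure \<pi> (space \<pi>) = 1"
        using em[of UNIV] m sets_eq_imp_space_eq[OF sp] by (simp add: m_def)
    qed
    moreover have "A \<times> (UNIV :: 'a set) \<in> sets borel" "(UNIV :: 'a set) \<times> A \<in> sets borel"
      if "A \<in> sets borel" for A :: "'a set"
      using that by (auto intro!: borel_Times)
    ultimately have "\<pi> \<in> couplings (distr N borel f) (distr N borel g)"
      unfolding couplings_def using m sp
      by (auto simp: me measure_distr m_def intro!: arg_cong[where f="measure N"])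
    then have "(INF \<pi>\<in>couplings (distr N borel f) (distr N borel g). ?I \<pi>) \<le> ?I \<pi>"
      by (rule INF_lower)
    also have "?I \<pi> = ennreal (1 / m) * (\<integral>\<^sup>+\<omega>. ennreal ((dist (f \<omega>) (g \<omega>))\<^sup>2) \<partial>N)"
      unfolding \<pi>_def
      by (subst nn_integral_scale_measure, simp) (subst nn_integral_distr, simp_all)
    also have "\<dots> \<le> ennreal (1 / m) * ennreal c"
      by (rule mult_left_mono) (use c in auto)
    finally have "ennreal m * (INF \<pi>\<in>couplings (distr N borel f) (distr N borel g). ?I \<pi>)
        \<le> ennreal m * (ennreal (1 / m) * ennreal c)"
      by (rule mult_left_mono) auto
    also have "\<dots> = ennreal c"
      using m by (simp add: mult.assoc[symmetric] ennreal_mult'[symmetric])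
    finally show ?thesis .
  qed simp
  then have "enn2real (ennreal m * (INF \<pi>\<in>couplings (distr N borel f) (distr N borel g). ?I \<pi>)) \<le> c"
    using c(2) by (rule enn2real_leI[rotated])
  moreover have "mass (distr N borel f) = m" by (simp add: m_def measure_distr)
  ultimately show ?thesis
    unfolding wasserstein2_def by (subst real_sqrt_pow2) (auto simp del: space_distr)
qed

text \<open>The marginals of the plan serve as the approximating measures. They lie below
  \<open>\<mu>1\<close> and \<open>\<mu>2\<close>, so both total variations are mass
  differences.\<close>

lemma gen_wasserstein_sq_le_plan:
  fixes f g :: "'c \<Rightarrow> 'a::{metric_space, second_countable_topology}"
  assumes a: "0 \<le> a" and \<mu>: "\<mu>1 \<in> finite_borel_measures" "\<mu>2 \<in> finite_borel_measures"
    and p: "partial_plan N f g \<mu>1 \<mu>2"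
    and c: "(\<integral>\<^sup>+\<omega>. ennreal ((dist (f \<omega>) (g \<omega>))\<^sup>2) \<partial>N) \<le> ennreal c" "0 \<le> c"
  shows "(gen_wasserstein a b \<mu>1 \<mu>2)\<^sup>2 \<le> b\<^sup>2 * c + a * (measure \<mu>1 UNIV + measure \<mu>2 UNIV - 2 * mass N)"
proof -
  have N: "finite_measure N" and [measurable]: "f \<in> N \<rightarrow>\<^sub>M borel" "g \<in> N \<rightarrow>\<^sub>M borel"
    and le: "distr N borel f \<le> \<mu>1" "distr N borel g \<le> \<mu>2"
    and f2: "distr N borel f \<in> finite_borel_measures2" "distr N borel g \<in> finite_borel_measures2"
    using p by (auto simp: partial_plan_def)
  have "(gen_wasserstein a b \<mu>1 \<mu>2)\<^sup>2 \<le> a * tv_diff \<mu>1 (distr N borel f) + a * tv_diff \<mu>2 (distr N borel g)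
      + b\<^sup>2 * (wasserstein2 (distr N borel f) (distr N borel g))\<^sup>2"
    unfolding gen_wasserstein_set(3)[OF a \<mu>]
  proof (rule cInf_lower[OF _ gen_wasserstein_set(2)[OF a \<mu>]], unfold mem_Collect_eq, intro exI conjI)
    show "mass (distr N borel f) = mass (distr N borel g)" by (simp add: mass_distr)
  qed (use f2 in simp_all)
  also have "\<dots> \<le> a * tv_diff \<mu>1 (distr N borel f) + a * tv_diff \<mu>2 (distr N borel g) + b\<^sup>2 * c"
    by (intro add_left_mono mult_left_mono wasserstein2_le N c) auto
  also have "\<dots> = b\<^sup>2 * c + a * (measure \<mu>1 UNIV + measure \<mu>2 UNIV - 2 * mass N)"
    unfolding tv_diff_le_measure[OF \<mu>(1) finite_borel_measures2D[OF f2(1)] le(1)]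
      tv_diff_le_measure[OF \<mu>(2) finite_borel_measures2D[OF f2(2)] le(2)]
    by (simp add: mass_distr algebra_simps)
  finally show ?thesis .
qed

lemma square_dist_bound:
  fixes x y z :: "'a::metric_space"
  shows "(dist x y)\<^sup>2 \<le> 2 * (dist z x)\<^sup>2 + 2 * (dist z y)\<^sup>2"
proof -
  have "(dist x y)\<^sup>2 \<le> (dist z x + dist z y)\<^sup>2"
    by (intro power_mono dist_triangle3 zero_le_dist)
  also have "\<dots> \<le> 2 * (dist z x)\<^sup>2 + 2 * (dist z y)\<^sup>2"
    using sum_squares_bound[of "dist z x" "dist z y"] by (simp add: power2_sum)
  finally show ?thesis .
qed

lemma finite_borel_measures2_second_moment:
  fixes \<mu> :: "'a::{metric_space, second_countable_topology} measure"
  assumes "\<mu> \<in> finite_borel_measures2"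
  shows "(\<integral>\<^sup>+ x. ennreal ((dist y x)\<^sup>2) \<partial>\<mu>) < \<infinity>"
proof -
  obtain x0 where x0: "(\<integral>\<^sup>+ x. ennreal ((dist x0 x)\<^sup>2) \<partial>\<mu>) < \<infinity>"
    using assms by (auto simp: finite_borel_measures2_def)
  note \<mu> = finite_borel_measuresD[OF finite_borel_measures2D[OF assms]]
  have [measurable_cong]: "sets \<mu> = sets borel" by (rule \<mu>)
  have sq: "(dist y x)\<^sup>2 \<le> 2 * (dist y x0)\<^sup>2 + 2 * (dist x0 x)\<^sup>2" for x
    using square_dist_bound[of y x x0] by (simp add: dist_commute)
  have "(\<integral>\<^sup>+ x. ennreal ((dist y x)\<^sup>2) \<partial>\<mu>)
      \<le> (\<integral>\<^sup>+ x. ennreal (2 * (dist y x0)\<^sup>2) + 2 * ennreal ((dist x0 x)\<^sup>2) \<partial>\<mu>)"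
    by (rule nn_integral_mono)
      (use sq in \<open>auto simp: ennreal_plus[symmetric] ennreal_numeral[symmetric] ennreal_mult'[symmetric]
         simp del: ennreal_plus ennreal_numeral intro!: ennreal_leI\<close>)
  also have "\<dots> = ennreal (2 * (dist y x0)\<^sup>2) * emeasure \<mu> (space \<mu>) + 2 * (\<integral>\<^sup>+ x. ennreal ((dist x0 x)\<^sup>2) \<partial>\<mu>)"
    by (subst nn_integral_add) (auto simp: nn_integral_cmult)
  also have "\<dots> < \<infinity>"
    using x0 \<mu>(3) by (auto simp: ennreal_mult_less_top finite_measure.emeasure_eq_measure)
  finally show ?thesis .
qed

text \<open>The normalised product measure does it. Finite cost ensures that \<open>enn2real\<close>
  in \<open>wasserstein2\<close> does not turn an infinite infimum into 0.\<close>

lemma finite_cost_coupling: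
  fixes \<nu>1 \<nu>2 :: "'a::{metric_space, second_countable_topology} measure"
  assumes \<nu>: "\<nu>1 \<in> finite_borel_measures2" "\<nu>2 \<in> finite_borel_measures2"
    and m: "measure \<nu>1 UNIV = m" "measure \<nu>2 UNIV = m" "0 < m"
  shows "\<exists>\<pi>\<in>couplings \<nu>1 \<nu>2. (\<integral>\<^sup>+ z. ennreal ((dist (fst z) (snd z))\<^sup>2) \<partial>\<pi>) < \<infinity>"
proof -
  note N1 = finite_borel_measuresD[OF finite_borel_measures2D[OF \<nu>(1)]]
  note N2 = finite_borel_measuresD[OF finite_borel_measures2D[OF \<nu>(2)]]
  interpret N1: finite_measure \<nu>1 by (rule N1)
  interpret N2: finite_measure \<nu>2 by (rule N2)
  interpret P: pair_sigma_finite \<nu>1 \<nu>2 ..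
  have [measurable_cong]: "sets \<nu>1 = sets borel" "sets \<nu>2 = sets borel" by (rule N1 N2)+
  let ?P = "\<nu>1 \<Otimes>\<^sub>M \<nu>2"
  define \<pi> where "\<pi> = scale_measure (ennreal (1 / m\<^sup>2)) ?P"
  have spP: "sets ?P = sets borel"
    unfolding borel_prod[symmetric] by (rule sets_pair_measure_cong[OF N1(1) N2(1)])
  have sp1: "sets \<pi> = sets borel" by (simp add: \<pi>_def spP)
  then have sp: "sets \<pi> = sets borel" "space \<pi> = UNIV"
    using sets_eq_imp_space_eq[OF sp1] by auto
  have em: "emeasure \<pi> (A \<times> B) = ennreal (measure \<nu>1 A * measure \<nu>2 B / m\<^sup>2)"
    if "A \<in> sets borel" "B \<in> sets borel" for A B
    using that m
    by (simp add: \<pi>_def N2.emeasure_pair_measure_Times N1.emeasure_eq_measure N2.emeasure_eq_measure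
       N1 N2 ennreal_mult'[symmetric])
  then have me: "measure \<pi> (A \<times> B) = measure \<nu>1 A * measure \<nu>2 B / m\<^sup>2"
    if "A \<in> sets borel" "B \<in> sets borel" for A B
    using that m by (simp add: measure_def)
  have "prob_space \<pi>"
  proof
    show "emeasure \<pi> (space \<pi>) = 1"
      using em[of UNIV UNIV] m by (simp add: sp power2_eq_square)
  qed
  then have "\<pi> \<in> couplings \<nu>1 \<nu>2"
    unfolding couplings_def using sp m N1(2) N2(2) by (auto simp: me power2_eq_square)
  moreover have "(\<integral>\<^sup>+ z. ennreal ((dist (fst z) (snd z))\<^sup>2) \<partial>\<pi>) < \<infinity>"
  proof -
    fix x0 :: 'a
    have [measurable]: "(\<lambda>z::'a \<times> 'a. (dist (fst z) (snd z))\<^sup>2) \<in> borel_measurable ?P"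
      by measurable
    have "(\<integral>\<^sup>+ z. ennreal ((dist (fst z) (snd z))\<^sup>2) \<partial>?P)
        \<le> (\<integral>\<^sup>+ z. 2 * ennreal ((dist x0 (fst z))\<^sup>2) + 2 * ennreal ((dist x0 (snd z))\<^sup>2) \<partial>?P)"
      by (rule nn_integral_mono)
        (use square_dist_bound in \<open>auto simp: ennreal_plus[symmetric] ennreal_numeral[symmetric]
          ennreal_mult'[symmetric] simp del: ennreal_plus ennreal_numeral intro!: ennreal_leI\<close>)
    also have "\<dots> = 2 * (\<integral>\<^sup>+ z. ennreal ((dist x0 (fst z))\<^sup>2) \<partial>?P) + 2 * (\<integral>\<^sup>+ z. ennreal ((dist x0 (snd z))\<^sup>2) \<partial>?P)"
      by (subst nn_integral_add) (auto simp: nn_integral_cmult)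
    also have "(\<integral>\<^sup>+ z. ennreal ((dist x0 (fst z))\<^sup>2) \<partial>?P) = (\<integral>\<^sup>+ x. ennreal ((dist x0 x)\<^sup>2) * emeasure \<nu>2 (space \<nu>2) \<partial>\<nu>1)"
      by (subst N2.nn_integral_fst[symmetric]) auto
    also have "\<dots> = (\<integral>\<^sup>+ x. ennreal ((dist x0 x)\<^sup>2) \<partial>\<nu>1) * emeasure \<nu>2 (space \<nu>2)"
      by (rule nn_integral_multc) measurable
    also have "(\<integral>\<^sup>+ z. ennreal ((dist x0 (snd z))\<^sup>2) \<partial>?P) = (\<integral>\<^sup>+ x. ennreal ((dist x0 x)\<^sup>2) * emeasure \<nu>1 (space \<nu>1) \<partial>\<nu>2)"
      by (subst P.nn_integral_snd[symmetric]) auto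
    also have "\<dots> = (\<integral>\<^sup>+ x. ennreal ((dist x0 x)\<^sup>2) \<partial>\<nu>2) * emeasure \<nu>1 (space \<nu>1)"
      by (rule nn_integral_multc) measurable
    also have "2 * ((\<integral>\<^sup>+ x. ennreal ((dist x0 x)\<^sup>2) \<partial>\<nu>1) * emeasure \<nu>2 (space \<nu>2)) +
        2 * ((\<integral>\<^sup>+ x. ennreal ((dist x0 x)\<^sup>2) \<partial>\<nu>2) * emeasure \<nu>1 (space \<nu>1)) < \<infinity>"
      using finite_borel_measures2_second_moment[OF \<nu>(1), of x0]
        finite_borel_measures2_second_moment[OF \<nu>(2), of x0]
      by (simp add: ennreal_mult_less_top N1.emeasure_eq_measure N2.emeasure_eq_measure)
    finally show ?thesis
      unfolding \<pi>_def by (subst nn_integral_scale_measure) (auto simp: ennreal_mult_less_top)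
  qed
  ultimately show ?thesis by blast
qed

text \<open>Multiplying a coupling by the common mass leads back from probability measures to a plan
  between \<open>\<nu>1\<close> and \<open>\<nu>2\<close>. For mass 0 the couplings say nothing
  about the two measures, and the null plan takes their place.\<close>

lemma near_optimal_coupling:
  fixes \<nu>1 \<nu>2 :: "'a::{metric_space, second_countable_topology} measure"
  assumes \<nu>: "\<nu>1 \<in> finite_borel_measures2" "\<nu>2 \<in> finite_borel_measures2"
    and eq: "measure \<nu>1 UNIV = measure \<nu>2 UNIV" and e: "0 < e"
  obtains \<gamma> :: "('a \<times> 'a) measure" where "sets \<gamma> = sets borel" "finite_measure \<gamma>"
    "distr \<gamma> borel fst = \<nu>1" "distr \<gamma> borel snd = \<nu>2"
    "(\<integral>\<^sup>+ z. ennreal ((dist (fst z) (snd z))\<^sup>2) \<partial>\<gamma>) \<le> ennreal ((wasserstein2 \<nu>1 \<nu>2)\<^sup>2 + e)"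
proof -
  note N1 = finite_borel_measuresD[OF finite_borel_measures2D[OF \<nu>(1)]]
  note N2 = finite_borel_measuresD[OF finite_borel_measures2D[OF \<nu>(2)]]
  interpret N1: finite_measure \<nu>1 by (rule N1)
  interpret N2: finite_measure \<nu>2 by (rule N2)
  have [measurable]: "(fst :: 'a \<times> 'a \<Rightarrow> 'a) \<in> borel \<rightarrow>\<^sub>M borel" "(snd :: 'a \<times> 'a \<Rightarrow> 'a) \<in> borel \<rightarrow>\<^sub>M borel"
    unfolding borel_prod[symmetric] by measurable
  define m where "m = measure \<nu>1 UNIV"
  show thesis
  proof (cases "m = 0")
    case True
    have [measurable]: "(fst :: 'a \<times> 'a \<Rightarrow> 'a) \<in> null_measure borel \<rightarrow>\<^sub>M borel"
      "(snd :: 'a \<times> 'a \<Rightarrow> 'a) \<in> null_measure borel \<rightarrow>\<^sub>M borel"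
      by (subst measurable_cong_sets[of _ borel _ borel]; simp)+
    show thesis
    proof (rule that[of "null_measure borel"])
      show "distr (null_measure borel) borel (fst :: 'a \<times> 'a \<Rightarrow> 'a) = \<nu>1"
      proof (rule measure_eqI)
        fix A assume "A \<in> sets (distr (null_measure borel) borel (fst :: 'a \<times> 'a \<Rightarrow> 'a))"
        moreover have "measure \<nu>1 A = 0"
          using N1.bounded_measure[of A] True N1(2) by (simp add: m_def measure_le_0_iff)
        ultimately show "emeasure (distr (null_measure borel) borel (fst :: 'a \<times> 'a \<Rightarrow> 'a)) A = emeasure \<nu>1 A"
          by (simp add: emeasure_distr N1.emeasure_eq_measure)
      qed (simp add: N1)
      show "distr (null_measure borel) borel (snd :: 'a \<times> 'a \<Rightarrow> 'a) = \<nu>2"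
      proof (rule measure_eqI)
        fix A assume "A \<in> sets (distr (null_measure borel) borel (snd :: 'a \<times> 'a \<Rightarrow> 'a))"
        moreover have "measure \<nu>2 A = 0"
          using N2.bounded_measure[of A] True N2(2) by (simp add: m_def measure_le_0_iff eq)
        ultimately show "emeasure (distr (null_measure borel) borel (snd :: 'a \<times> 'a \<Rightarrow> 'a)) A = emeasure \<nu>2 A"
          by (simp add: emeasure_distr N2.emeasure_eq_measure)
      qed (simp add: N2)
    qed (auto intro: finite_measureI)
  next
    case False
    then have m: "0 < m" "measure \<nu>1 UNIV = m" "measure \<nu>2 UNIV = m"
      using eq by (auto simp: m_def zero_less_measure_iff)
    let ?I = "\<lambda>\<pi>. \<integral>\<^sup>+ z. ennreal ((dist (fst z) (snd z))\<^sup>2) \<partial>\<pi>"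
    define I where "I = (INF \<pi>\<in>couplings \<nu>1 \<nu>2. ?I \<pi>)"
    have "I < \<infinity>"
      using finite_cost_coupling[OF \<nu> m(2,3,1)] unfolding I_def by (metis INF_less_iff)
    then obtain i where i: "I = ennreal i" "0 \<le> i"
      by (cases I) auto
    have w: "(wasserstein2 \<nu>1 \<nu>2)\<^sup>2 = m * i"
      unfolding wasserstein2_def I_def[symmetric] i(1) using m i(2)
      by (simp add: N1(2) ennreal_mult'[symmetric])
    \<comment> \<open>The slack is divided by \<open>m\<close> because the cost gets multiplied by
      \<open>m\<close> below.\<close>
    have "I < ennreal (i + e / m)"
      unfolding i(1) using m e i(2) by (intro ennreal_lessI add_nonneg_pos) auto
    then obtain \<pi> where \<pi>: "\<pi> \<in> couplings \<nu>1 \<nu>2" "?I \<pi> < ennreal (i + e / m)"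
      unfolding I_def INF_less_iff by blast
    have sp: "sets \<pi> = sets borel" and pr: "prob_space \<pi>"
      and c1: "\<And>A. A \<in> sets borel \<Longrightarrow> m * measure \<pi> (A \<times> UNIV) = measure \<nu>1 A"
      and c2: "\<And>A. A \<in> sets borel \<Longrightarrow> m * measure \<pi> (UNIV \<times> A) = measure \<nu>2 A"
      using \<pi>(1) m N1(2) N2(2) by (auto simp: couplings_def)
    interpret pi: prob_space \<pi> by (rule pr)
    have [measurable_cong]: "sets \<pi> = sets borel" by (rule sp)
    define \<gamma> where "\<gamma> = scale_measure (ennreal m) \<pi>"
    have spg1: "sets \<gamma> = sets borel" by (simp add: \<gamma>_def sp)
    then have spg: "sets \<gamma> = sets borel" "space \<gamma> = UNIV"
      using sets_eq_imp_space_eq[OF spg1] by auto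
    have [measurable_cong]: "sets \<gamma> = sets borel" by (rule spg)
    have emg: "emeasure \<gamma> A = ennreal (m * measure \<pi> A)" for A
      using m by (simp add: \<gamma>_def pi.emeasure_eq_measure ennreal_mult')
    show thesis
    proof (rule that[of \<gamma>])
      show "finite_measure \<gamma>" by (rule finite_measureI) (simp add: emg)
      show "distr \<gamma> borel fst = \<nu>1"
      proof (rule measure_eqI)
        fix A assume "A \<in> sets (distr \<gamma> borel (fst :: 'a \<times> 'a \<Rightarrow> 'a))"
        then have A: "A \<in> sets borel" by simp
        have "fst -` A = A \<times> (UNIV :: 'a set)" by auto
        then show "emeasure (distr \<gamma> borel fst) A = emeasure \<nu>1 A"
          using A c1[OF A] by (simp add: emeasure_distr spg emg N1.emeasure_eq_measure)
      qed (simp add: N1)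
      show "distr \<gamma> borel snd = \<nu>2"
      proof (rule measure_eqI)
        fix A assume "A \<in> sets (distr \<gamma> borel (snd :: 'a \<times> 'a \<Rightarrow> 'a))"
        then have A: "A \<in> sets borel" by simp
        have "snd -` A = (UNIV :: 'a set) \<times> A" by auto
        then show "emeasure (distr \<gamma> borel snd) A = emeasure \<nu>2 A"
          using A c2[OF A] by (simp add: emeasure_distr spg emg N2.emeasure_eq_measure)
      qed (simp add: N2)
      have "(\<lambda>z::'a \<times> 'a. (dist (fst z) (snd z))\<^sup>2) \<in> borel_measurable \<pi>"
        by measurable
      then have "?I \<gamma> = ennreal m * ?I \<pi>"
        unfolding \<gamma>_def by (subst nn_integral_scale_measure) auto
      also have "\<dots> \<le> ennreal m * ennreal (i + e / m)"
        using \<pi>(2) by (intro mult_left_mono) auto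
      also have "\<dots> = ennreal ((wasserstein2 \<nu>1 \<nu>2)\<^sup>2 + e)"
      proof -
        have "m * (i + e / m) = m * i + e" using m by (simp add: field_simps)
        then show ?thesis unfolding w using m by (subst ennreal_mult'[symmetric]) simp_all
      qed
      finally show "?I \<gamma> \<le> ennreal ((wasserstein2 \<nu>1 \<nu>2)\<^sup>2 + e)" .
    qed (rule spg)
  qed
qed

text \<open>Converse of \<open>gen_wasserstein_sq_le_plan\<close>. A near optimal coupling of near
  optimal \<open>\<nu>1\<close> and \<open>\<nu>2\<close> is thinned by the densities of the common
  parts with \<open>\<mu>1\<close> and \<open>\<mu>2\<close>. Thinning only lowers the transport
  cost, and the mass it removes is covered by the total variations.\<close>

lemma near_optimal_plan:
  fixes \<mu>1 \<mu>2 :: "'a::{metric_space, second_countable_topology} measure"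
  assumes a: "0 \<le> a" and \<mu>: "\<mu>1 \<in> finite_borel_measures" "\<mu>2 \<in> finite_borel_measures"
    and e: "0 < e"
  obtains \<gamma> :: "('a \<times> 'a) measure" and c where "partial_plan \<gamma> fst snd \<mu>1 \<mu>2"
    "sets \<gamma> = sets borel" "0 \<le> c"
    "(\<integral>\<^sup>+ z. ennreal ((dist (fst z) (snd z))\<^sup>2) \<partial>\<gamma>) \<le> ennreal c"
    "b\<^sup>2 * c + a * (measure \<mu>1 UNIV + measure \<mu>2 UNIV - 2 * measure \<gamma> UNIV)
       \<le> (gen_wasserstein a b \<mu>1 \<mu>2)\<^sup>2 + e"
proof -
  \<comment> \<open>Chosen so that \<open>b\<^sup>2 * e'\<close> uses at most half of
    \<open>e\<close>; the summand 1 covers \<open>b = 0\<close>.\<close>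
  define e' where "e' = e / (2 * (b\<^sup>2 + 1))"
  have b1: "b\<^sup>2 + 1 > 0" by (simp add: add_nonneg_pos)
  then have e': "e' > 0" "b\<^sup>2 * e' \<le> e / 2"
    using e by (auto simp: e'_def field_simps)
  note W = gen_wasserstein_set[OF a \<mu>, of b]
  obtain \<nu>1 \<nu>2 where \<nu>: "\<nu>1 \<in> finite_borel_measures2" "\<nu>2 \<in> finite_borel_measures2" "mass \<nu>1 = mass \<nu>2"
    and lt: "a * tv_diff \<mu>1 \<nu>1 + a * tv_diff \<mu>2 \<nu>2 + b\<^sup>2 * (wasserstein2 \<nu>1 \<nu>2)\<^sup>2
      < (gen_wasserstein a b \<mu>1 \<mu>2)\<^sup>2 + e / 2"
    using cInf_lessD[OF W(1), of "(gen_wasserstein a b \<mu>1 \<mu>2)\<^sup>2 + e / 2"] e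
    unfolding W(3)[symmetric] by auto
  note \<nu>' = \<nu>(1,2)[THEN finite_borel_measures2D]
  note N1 = finite_borel_measuresD[OF \<nu>'(1)] and N2 = finite_borel_measuresD[OF \<nu>'(2)]
  have meq: "measure \<nu>1 UNIV = measure \<nu>2 UNIV" using \<nu>(3) N1 N2 by simp
  obtain \<gamma>0 :: "('a \<times> 'a) measure" where g0: "sets \<gamma>0 = sets borel" "finite_measure \<gamma>0"
    "distr \<gamma>0 borel fst = \<nu>1" "distr \<gamma>0 borel snd = \<nu>2"
    "(\<integral>\<^sup>+ z. ennreal ((dist (fst z) (snd z))\<^sup>2) \<partial>\<gamma>0) \<le> ennreal ((wasserstein2 \<nu>1 \<nu>2)\<^sup>2 + e')"
    using near_optimal_coupling[OF \<nu>(1,2) meq e'(1)] .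
  interpret G0: finite_measure \<gamma>0 by (rule g0)
  have [measurable_cong]: "sets \<gamma>0 = sets borel" by (rule g0)
  have sp0: "space \<gamma>0 = UNIV" using sets_eq_imp_space_eq[OF g0(1)] by simp
  have [measurable]: "(fst :: 'a \<times> 'a \<Rightarrow> 'a) \<in> borel \<rightarrow>\<^sub>M borel" "(snd :: 'a \<times> 'a \<Rightarrow> 'a) \<in> borel \<rightarrow>\<^sub>M borel"
    unfolding borel_prod[symmetric] by measurable
  obtain h1 where h1[measurable]: "h1 \<in> borel_measurable borel" and h1_le: "\<And>x. h1 x \<le> 1"
    and h1\<mu>: "density \<nu>1 h1 \<le> \<mu>1"
    and tv1: "tv_diff \<mu>1 \<nu>1 = measure \<mu>1 UNIV + measure \<nu>1 UNIV - 2 * measure (density \<nu>1 h1) UNIV"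
    by (rule common_part_density[OF \<mu>(1) \<nu>'(1)]) (rule that)
  obtain h2 where h2[measurable]: "h2 \<in> borel_measurable borel" and h2_le: "\<And>x. h2 x \<le> 1"
    and h2\<mu>: "density \<nu>2 h2 \<le> \<mu>2"
    and tv2: "tv_diff \<mu>2 \<nu>2 = measure \<mu>2 UNIV + measure \<nu>2 UNIV - 2 * measure (density \<nu>2 h2) UNIV"
    by (rule common_part_density[OF \<mu>(2) \<nu>'(2)]) (rule that)
  have [measurable_cong]: "sets \<nu>1 = sets borel" "sets \<nu>2 = sets borel" by (rule N1 N2)+
  \<comment> \<open>Each factor is at most 1, so the product keeps both marginals below the
    respective common parts at the same time.\<close>
  define \<gamma> where "\<gamma> = density \<gamma>0 (\<lambda>z. h1 (fst z) * h2 (snd z))"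
  have spg: "sets \<gamma> = sets borel" "space \<gamma> = UNIV" using g0(1) sp0 by (auto simp: \<gamma>_def)
  have [measurable_cong]: "sets \<gamma> = sets borel" by (rule spg)
  have hh: "h1 x * h2 y \<le> h1 x" "h1 x * h2 y \<le> h2 y" for x y
    using mult_left_mono[OF h2_le[of y], of "h1 x"] mult_right_mono[OF h1_le[of x], of "h2 y"] by auto
  have hh1: "h1 x * h2 y \<le> 1" for x y
    using hh(1)[of x y] h1_le[of x] by (rule order_trans)
  have emd1: "emeasure (density \<nu>1 h1) A = (\<integral>\<^sup>+z. h1 (fst z) * indicator A (fst z) \<partial>\<gamma>0)"
    if [measurable]: "A \<in> sets borel" for A
    unfolding g0(3)[symmetric] by (simp add: emeasure_density nn_integral_distr)
  have emd2: "emeasure (density \<nu>2 h2) A = (\<integral>\<^sup>+z. h2 (snd z) * indicator A (snd z) \<partial>\<gamma>0)"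
    if [measurable]: "A \<in> sets borel" for A
    unfolding g0(4)[symmetric] by (simp add: emeasure_density nn_integral_distr)
  have em: "emeasure \<gamma> A = (\<integral>\<^sup>+z. h1 (fst z) * h2 (snd z) * indicator A z \<partial>\<gamma>0)" if "A \<in> sets borel" for A
    using that by (simp add: \<gamma>_def emeasure_density g0(1))
  have d1: "emeasure (distr \<gamma> borel fst) A \<le> emeasure (density \<nu>1 h1) A" if [measurable]: "A \<in> sets borel" for A
  proof -
    have "fst -` A \<in> sets (borel :: ('a \<times> 'a) measure)"
      using measurable_sets[OF \<open>fst \<in> borel \<rightarrow>\<^sub>M borel\<close> that] by simp
    then have "emeasure (distr \<gamma> borel fst) A = (\<integral>\<^sup>+z. h1 (fst z) * h2 (snd z) * indicator (fst -` A) z \<partial>\<gamma>0)"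
      by (simp add: emeasure_distr em spg)
    also have "\<dots> \<le> emeasure (density \<nu>1 h1) A"
      unfolding emd1[OF that]
      by (rule nn_integral_mono) (auto simp: indicator_def hh)
    finally show ?thesis .
  qed
  have d2: "emeasure (distr \<gamma> borel snd) A \<le> emeasure (density \<nu>2 h2) A" if [measurable]: "A \<in> sets borel" for A
  proof -
    have "snd -` A \<in> sets (borel :: ('a \<times> 'a) measure)"
      using measurable_sets[OF \<open>snd \<in> borel \<rightarrow>\<^sub>M borel\<close> that] by simp
    then have "emeasure (distr \<gamma> borel snd) A = (\<integral>\<^sup>+z. h1 (fst z) * h2 (snd z) * indicator (snd -` A) z \<partial>\<gamma>0)"
      by (simp add: emeasure_distr em spg)
    also have "\<dots> \<le> emeasure (density \<nu>2 h2) A"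
      unfolding emd2[OF that]
      by (rule nn_integral_mono) (auto simp: indicator_def hh)
    finally show ?thesis .
  qed
  have dens_le: "density \<nu> h \<le> \<nu>" if "sets \<nu> = sets borel" "h \<in> borel_measurable borel" "\<And>x. h x \<le> (1::ennreal)"
    for \<nu> :: "'a measure" and h
  proof (rule le_borel_measureI)
    fix A :: "'a set" assume A: "A \<in> sets borel"
    have [measurable_cong]: "sets \<nu> = sets borel" by (rule that)
    have "emeasure (density \<nu> h) A = (\<integral>\<^sup>+x. h x * indicator A x \<partial>\<nu>)"
      using A that by (simp add: emeasure_density)
    also have "\<dots> \<le> (\<integral>\<^sup>+x. indicator A x \<partial>\<nu>)"
      by (rule nn_integral_mono) (auto simp: indicator_def that(3))
    finally show "emeasure (density \<nu> h) A \<le> emeasure \<nu> A" using A that by simp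
  qed (use that in auto)
  have D1: "density \<nu>1 h1 \<in> finite_borel_measures2"
    using dens_le[OF N1(1) h1 h1_le] \<nu>(1) by (rule finite_borel_measures2_le) (simp add: N1)
  have D2: "density \<nu>2 h2 \<in> finite_borel_measures2"
    using dens_le[OF N2(1) h2 h2_le] \<nu>(2) by (rule finite_borel_measures2_le) (simp add: N2)
  have le1: "distr \<gamma> borel fst \<le> density \<nu>1 h1" "distr \<gamma> borel snd \<le> density \<nu>2 h2"
    by (rule le_borel_measureI; use N1(1) N2(1) d1 d2 in simp)+
  have fin: "finite_measure \<gamma>"
  proof (rule finite_measureI)
    have "emeasure \<gamma> (space \<gamma>) = (\<integral>\<^sup>+z. h1 (fst z) * h2 (snd z) \<partial>\<gamma>0)"
      unfolding spg using em[of UNIV] by simp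
    also have "\<dots> \<le> (\<integral>\<^sup>+z. 1 \<partial>\<gamma>0)"
      by (intro nn_integral_mono hh1)
    finally show "emeasure \<gamma> (space \<gamma>) \<noteq> \<infinity>"
      by (auto simp: G0.emeasure_eq_measure top_unique)
  qed
  interpret G: finite_measure \<gamma> by (rule fin)
  have plan: "partial_plan \<gamma> fst snd \<mu>1 \<mu>2"
    unfolding partial_plan_def
  proof (intro conjI)
    show "distr \<gamma> borel fst \<in> finite_borel_measures2"
      using le1(1) D1 by (rule finite_borel_measures2_le) simp
    show "distr \<gamma> borel snd \<in> finite_borel_measures2"
      using le1(2) D2 by (rule finite_borel_measures2_le) simp
  qed (use fin order_trans[OF le1(1) h1\<mu>] order_trans[OF le1(2) h2\<mu>] in \<open>auto\<close>)
  have "(\<integral>\<^sup>+ z. ennreal ((dist (fst z) (snd z))\<^sup>2) \<partial>\<gamma>)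
      = (\<integral>\<^sup>+ z. h1 (fst z) * h2 (snd z) * ennreal ((dist (fst z) (snd z))\<^sup>2) \<partial>\<gamma>0)"
    unfolding \<gamma>_def by (rule nn_integral_density) measurable
  also have "\<dots> \<le> (\<integral>\<^sup>+ z. 1 * ennreal ((dist (fst z) (snd z))\<^sup>2) \<partial>\<gamma>0)"
    by (intro nn_integral_mono mult_right_mono hh1) auto
  also have "\<dots> \<le> ennreal ((wasserstein2 \<nu>1 \<nu>2)\<^sup>2 + e')" using g0(5) by simp
  finally have cost: "(\<integral>\<^sup>+ z. ennreal ((dist (fst z) (snd z))\<^sup>2) \<partial>\<gamma>) \<le> ennreal ((wasserstein2 \<nu>1 \<nu>2)\<^sup>2 + e')" .
  \<comment> \<open>The inequality behind \<open>mass_N\<close>, now pointwise for the thinning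
    factors; integrated against \<open>\<gamma>0\<close> it bounds the mass lost by
    thinning.\<close>
  have "h1 x + h2 y \<le> 1 + h1 x * h2 y" for x y
  proof -
    obtain r s where rs: "h1 x = ennreal r" "h2 y = ennreal s" "0 \<le> r" "0 \<le> s"
      using h1_le[of x] h2_le[of y] by (cases "h1 x"; cases "h2 y") (auto simp: top_unique)
    then have "r \<le> 1" "s \<le> 1" using h1_le[of x] h2_le[of y] by auto
    then have "0 \<le> (1 - r) * (1 - s)" by simp
    then have "r + s \<le> 1 + r * s" by (simp add: algebra_simps)
    then have "ennreal (r + s) \<le> ennreal (1 + r * s)" by (rule ennreal_leI)
    then show ?thesis using rs by (simp add: ennreal_mult'[symmetric])
  qed
  then have "(\<integral>\<^sup>+ z. h1 (fst z) + h2 (snd z) \<partial>\<gamma>0) \<le> (\<integral>\<^sup>+ z. 1 + h1 (fst z) * h2 (snd z) \<partial>\<gamma>0)"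
    by (intro nn_integral_mono)
  then have "emeasure (density \<nu>1 h1) UNIV + emeasure (density \<nu>2 h2) UNIV
      \<le> emeasure \<gamma>0 UNIV + emeasure \<gamma> UNIV"
    using emd1[of UNIV] emd2[of UNIV] em[of UNIV] by (simp add: nn_integral_add sp0)
  also have "emeasure \<gamma>0 UNIV = emeasure \<nu>1 UNIV"
    unfolding g0(3)[symmetric] by (simp add: emeasure_distr sp0)
  finally have "measure (density \<nu>1 h1) UNIV + measure (density \<nu>2 h2) UNIV \<le> measure \<nu>1 UNIV + measure \<gamma> UNIV"
    using D1 D2 \<nu>' by (simp add: emeasure_finite_borel_measure finite_borel_measures2D G.emeasure_eq_measure
        ennreal_plus[symmetric] del: ennreal_plus)
  then have "measure \<mu>1 UNIV + measure \<mu>2 UNIV - 2 * measure \<gamma> UNIV \<le> tv_diff \<mu>1 \<nu>1 + tv_diff \<mu>2 \<nu>2"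
    unfolding tv1 tv2 using meq by simp
  then have "a * (measure \<mu>1 UNIV + measure \<mu>2 UNIV - 2 * measure \<gamma> UNIV) \<le> a * tv_diff \<mu>1 \<nu>1 + a * tv_diff \<mu>2 \<nu>2"
    using a by (metis distrib_left mult_left_mono)
  then have "b\<^sup>2 * ((wasserstein2 \<nu>1 \<nu>2)\<^sup>2 + e') +
      a * (measure \<mu>1 UNIV + measure \<mu>2 UNIV - 2 * measure \<gamma> UNIV) \<le> (gen_wasserstein a b \<mu>1 \<mu>2)\<^sup>2 + e"
    using lt e'(2) by (simp add: distrib_left)
  then show thesis
    using that[OF plan spg(1) _ cost] e'(1) by simp
qed

section \<open>The triangle inequality\<close>

lemma partial_planD:
  assumes "partial_plan N f g \<mu> \<nu>"
  shows "finite_measure N" "f \<in> N \<rightarrow>\<^sub>M borel" "g \<in> N \<rightarrow>\<^sub>M borel"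
    "distr N borel f \<le> \<mu>" "distr N borel g \<le> \<nu>"
    "distr N borel f \<in> finite_borel_measures2" "distr N borel g \<in> finite_borel_measures2"
  using assms by (auto simp: partial_plan_def)

lemma partial_plan_swap: "partial_plan N f g \<mu> \<nu> \<Longrightarrow> partial_plan N g f \<nu> \<mu>"
  by (auto simp: partial_plan_def)

lemma measure_distr_le:
  assumes "distr N borel f \<le> \<mu>" "finite_measure N" "f \<in> N \<rightarrow>\<^sub>M borel" "\<mu> \<in> finite_borel_measures"
    "A \<in> sets borel"
  shows "measure N (f -` A \<inter> space N) \<le> measure \<mu> A"
proof -
  interpret finite_measure N by fact
  have "emeasure (distr N borel f) A \<le> emeasure \<mu> A"
    using finite_borel_measuresD[OF assms(4)] by (intro le_measureD3[OF assms(1)]) simp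
  then show ?thesis
    using assms by (simp add: emeasure_distr emeasure_eq_measure emeasure_finite_borel_measure)
qed

lemma partial_plan_mass_le:
  assumes "partial_plan N f g \<mu> \<nu>" "\<mu> \<in> finite_borel_measures" "\<nu> \<in> finite_borel_measures"
  shows "mass N \<le> measure \<mu> UNIV" "mass N \<le> measure \<nu> UNIV"
  using measure_distr_le[of N f \<mu> UNIV] measure_distr_le[of N g \<nu> UNIV] partial_planD[OF assms(1)] assms(2,3)
  by auto

lemma gen_wasserstein_sq_swap_le:
  fixes \<mu> \<nu> :: "'a::{metric_space, second_countable_topology} measure"
  assumes a: "0 \<le> a" and \<mu>: "\<mu> \<in> finite_borel_measures" and \<nu>: "\<nu> \<in> finite_borel_measures"
  shows "(gen_wasserstein a b \<nu> \<mu>)\<^sup>2 \<le> (gen_wasserstein a b \<mu> \<nu>)\<^sup>2"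
proof (rule field_le_epsilon)
  fix e :: real assume "0 < e"
  then obtain \<gamma> :: "('a \<times> 'a) measure" and c where g: "partial_plan \<gamma> fst snd \<mu> \<nu>"
    "sets \<gamma> = sets borel" "0 \<le> c"
    "(\<integral>\<^sup>+ z. ennreal ((dist (fst z) (snd z))\<^sup>2) \<partial>\<gamma>) \<le> ennreal c"
    "b\<^sup>2 * c + a * (measure \<mu> UNIV + measure \<nu> UNIV - 2 * measure \<gamma> UNIV)
       \<le> (gen_wasserstein a b \<mu> \<nu>)\<^sup>2 + e"
    by (rule near_optimal_plan[OF a \<mu> \<nu>])
  have "space \<gamma> = UNIV" using sets_eq_imp_space_eq[OF g(2)] by simp
  then show "(gen_wasserstein a b \<nu> \<mu>)\<^sup>2 \<le> (gen_wasserstein a b \<mu> \<nu>)\<^sup>2 + e"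
    using gen_wasserstein_sq_le_plan[OF a \<nu> \<mu> partial_plan_swap[OF g(1)] _ g(3), of b] g(4,5)
    by (simp add: dist_commute add.commute)
qed

lemma gen_wasserstein_commute:
  fixes \<mu> \<nu> :: "'a::{metric_space, second_countable_topology} measure"
  assumes "0 \<le> a" "\<mu> \<in> finite_borel_measures" "\<nu> \<in> finite_borel_measures"
  shows "gen_wasserstein a b \<mu> \<nu> = gen_wasserstein a b \<nu> \<mu>"
  using gen_wasserstein_sq_swap_le[OF assms] gen_wasserstein_sq_swap_le[OF assms(1,3,2)]
    gen_wasserstein_nonneg[OF assms] gen_wasserstein_nonneg[OF assms(1,3,2)]
  by (metis order_antisym power2_eq_imp_eq)

text \<open>A plan carries at most the mass of \<open>\<mu>\<close>, so the excess mass of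
  \<open>\<nu>\<close> is unmatched and costs \<open>a\<close> per unit. This turns bounds on
  distances into bounds on masses.\<close>

lemma mass_le_gen_wasserstein:
  fixes \<mu> \<nu> :: "'a::{metric_space, second_countable_topology} measure"
  assumes a: "0 \<le> a" and \<mu>: "\<mu> \<in> finite_borel_measures" and \<nu>: "\<nu> \<in> finite_borel_measures"
  shows "a * measure \<nu> UNIV \<le> a * measure \<mu> UNIV + (gen_wasserstein a b \<mu> \<nu>)\<^sup>2"
proof (rule field_le_epsilon)
  fix e :: real assume "0 < e"
  then obtain \<gamma> :: "('a \<times> 'a) measure" and c where g: "partial_plan \<gamma> fst snd \<mu> \<nu>"
    "sets \<gamma> = sets borel" "0 \<le> c"
    "(\<integral>\<^sup>+ z. ennreal ((dist (fst z) (snd z))\<^sup>2) \<partial>\<gamma>) \<le> ennreal c"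
    "b\<^sup>2 * c + a * (measure \<mu> UNIV + measure \<nu> UNIV - 2 * measure \<gamma> UNIV)
       \<le> (gen_wasserstein a b \<mu> \<nu>)\<^sup>2 + e"
    by (rule near_optimal_plan[OF a \<mu> \<nu>])
  have "space \<gamma> = UNIV" using sets_eq_imp_space_eq[OF g(2)] by simp
  then have "measure \<nu> UNIV - measure \<mu> UNIV \<le> measure \<mu> UNIV + measure \<nu> UNIV - 2 * measure \<gamma> UNIV"
    using partial_plan_mass_le[OF g(1) \<mu> \<nu>] by simp
  then have "a * (measure \<nu> UNIV - measure \<mu> UNIV) \<le> a * (measure \<mu> UNIV + measure \<nu> UNIV - 2 * measure \<gamma> UNIV)"
    using a by (rule mult_left_mono)
  also have "\<dots> \<le> (gen_wasserstein a b \<mu> \<nu>)\<^sup>2 + e"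
    using g(5) g(3) by (smt (verit) mult_nonneg_nonneg zero_le_power2)
  finally show "a * measure \<nu> UNIV \<le> a * measure \<mu> UNIV + (gen_wasserstein a b \<mu> \<nu>)\<^sup>2 + e"
    by (simp add: algebra_simps)
qed

text \<open>This is the cost of the empty plan. The null measure has empty support and competes in
  every barycenter problem, so optimal costs are bounded in terms of the masses of the data.\<close>

lemma gen_wasserstein_null_le:
  fixes \<mu> :: "'a::{metric_space, second_countable_topology} measure"
  assumes a: "0 \<le> a" and \<mu>: "\<mu> \<in> finite_borel_measures"
  shows "(gen_wasserstein a b \<mu> (null_measure borel))\<^sup>2 \<le> a * measure \<mu> UNIV"
proof -
  have [measurable]: "(\<lambda>x::'a. x) \<in> null_measure borel \<rightarrow>\<^sub>M borel"
    by (subst measurable_cong_sets[of _ borel _ borel]) simp_all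
  have d: "distr (null_measure borel) borel (\<lambda>x::'a. x) = null_measure borel"
    by (rule measure_eqI) (auto simp: emeasure_distr)
  have "partial_plan (null_measure borel) (\<lambda>x. x) (\<lambda>x. x) \<mu> (null_measure borel)"
    unfolding partial_plan_def d
    using null_borel_finite2 finite_borel_measuresD[OF \<mu>]
    by (auto intro!: le_borel_measureI finite_measureI)
  from gen_wasserstein_sq_le_plan[OF a \<mu> null_borel_finite this, of 0 b] show ?thesis
    by simp
qed

section \<open>Gluing of plans along small cells\<close>

text \<open>A point goes to the first member of a dense sequence within \<open>\<delta> / 2\<close>;
  taking the least index makes the choice Borel.\<close>

lemma small_cells:
  fixes \<delta> :: real
  assumes "0 < \<delta>"
  obtains c :: "'a::{metric_space, second_countable_topology} \<Rightarrow> nat"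
  where "c \<in> borel \<rightarrow>\<^sub>M count_space UNIV" "\<And>x y. c x = c y \<Longrightarrow> dist x y < \<delta>"
proof -
  obtain D :: "'a set" where D: "countable D" "\<And>X. open X \<Longrightarrow> X \<noteq> {} \<Longrightarrow> \<exists>d\<in>D. d \<in> X"
    using countable_dense_exists by blast
  define c :: "'a \<Rightarrow> nat" where "c x = (LEAST i. dist x (from_nat_into D i) < \<delta> / 2)" for x
  have c: "dist x (from_nat_into D (c x)) < \<delta> / 2" for x
  proof -
    have "ball x (\<delta> / 2) \<noteq> {}" using assms by simp
    then obtain d where "d \<in> D" "d \<in> ball x (\<delta> / 2)" using D(2)[OF open_ball] by blast
    then have "dist x (from_nat_into D (to_nat_on D d)) < \<delta> / 2" using D(1) by simp
    then show ?thesis unfolding c_def by (rule LeastI)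
  qed
  show thesis
  proof (rule that[of c])
    show "c \<in> borel \<rightarrow>\<^sub>M count_space UNIV" unfolding c_def by measurable
    show "dist x y < \<delta>" if "c x = c y" for x y
      using c[of x] c[of y] dist_triangle2[of x y "from_nat_into D (c x)"] that by simp
  qed
qed

text \<open>Young's inequality. The weight \<open>t\<close> stays free until
  \<open>gen_wasserstein_triangle\<close>, where it is tuned to the two distances.\<close>

lemma two_term_square_bound:
  fixes p q t :: real
  assumes "0 < t"
  shows "(p + q)\<^sup>2 \<le> (1 + t) * p\<^sup>2 + (1 + 1 / t) * q\<^sup>2"
proof -
  have "0 \<le> (t * p - q)\<^sup>2 / t" using assms by simp
  also have "\<dots> = t * p\<^sup>2 - 2 * p * q + q\<^sup>2 / t"
    using assms by (simp add: power2_eq_square field_simps)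
  finally show ?thesis by (simp add: power2_eq_square algebra_simps)
qed

text \<open>Two plans with middle marginals below \<open>\<mu>2\<close> are glued after discretising the middle space into cells
  of diameter \<open>< \<delta>\<close>, which replaces disintegration by a density with respect to a product measure.\<close>

lemma gen_wasserstein_sq_glue:
  fixes \<mu>1 \<mu>2 \<mu>3 :: "'a::{metric_space, second_countable_topology} measure"
  assumes a: "0 \<le> a" and \<mu>: "\<mu>1 \<in> finite_borel_measures" "\<mu>2 \<in> finite_borel_measures"
    "\<mu>3 \<in> finite_borel_measures" and t: "0 < t" and \<delta>: "0 < \<delta>"
  shows "(gen_wasserstein a b \<mu>1 \<mu>3)\<^sup>2 \<le> (1 + t) * ((gen_wasserstein a b \<mu>1 \<mu>2)\<^sup>2 + \<delta>) +
    (1 + 1 / t) * ((1 + \<delta>) * ((gen_wasserstein a b \<mu>2 \<mu>3)\<^sup>2 + \<delta>) + b\<^sup>2 * ((\<delta>\<^sup>2 + \<delta>) * measure \<mu>2 UNIV))"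
proof -
  obtain \<alpha> :: "('a \<times> 'a) measure" and c12 where pa: "partial_plan \<alpha> fst snd \<mu>1 \<mu>2"
    "sets \<alpha> = sets borel" "0 \<le> c12"
    "(\<integral>\<^sup>+ z. ennreal ((dist (fst z) (snd z))\<^sup>2) \<partial>\<alpha>) \<le> ennreal c12"
    "b\<^sup>2 * c12 + a * (measure \<mu>1 UNIV + measure \<mu>2 UNIV - 2 * measure \<alpha> UNIV)
       \<le> (gen_wasserstein a b \<mu>1 \<mu>2)\<^sup>2 + \<delta>"
    by (rule near_optimal_plan[OF a \<mu>(1,2) \<delta>])
  obtain \<beta> :: "('a \<times> 'a) measure" and c23 where pb: "partial_plan \<beta> fst snd \<mu>2 \<mu>3"
    "sets \<beta> = sets borel" "0 \<le> c23"
    "(\<integral>\<^sup>+ z. ennreal ((dist (fst z) (snd z))\<^sup>2) \<partial>\<beta>) \<le> ennreal c23"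
    "b\<^sup>2 * c23 + a * (measure \<mu>2 UNIV + measure \<mu>3 UNIV - 2 * measure \<beta> UNIV)
       \<le> (gen_wasserstein a b \<mu>2 \<mu>3)\<^sup>2 + \<delta>"
    by (rule near_optimal_plan[OF a \<mu>(2,3) \<delta>])
  obtain c :: "'a \<Rightarrow> nat" where c[measurable]: "c \<in> borel \<rightarrow>\<^sub>M count_space UNIV"
    and cd: "\<And>x y. c x = c y \<Longrightarrow> dist x y < \<delta>"
    by (rule small_cells[OF \<delta>]) (rule that)
  note A = partial_planD[OF pa(1)] and B = partial_planD[OF pb(1)]
  note M2 = finite_borel_measuresD[OF \<mu>(2)]
  interpret A: finite_measure \<alpha> by (rule A)
  interpret B: finite_measure \<beta> by (rule B)
  interpret M2: finite_measure \<mu>2 by (rule M2)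
  have [measurable_cong]: "sets \<mu>2 = sets borel" by (rule M2)
  note [measurable] = A(2,3) B(2,3)
  let ?C = "count_space UNIV :: nat measure"
  \<comment> \<open>The two plans may have different marginals on the middle space, but both lie
    below \<open>\<mu>2\<close>, whose cell masses therefore dominate.\<close>
  define m where "m = distr \<mu>2 ?C c"
  have law: "distr \<kappa> ?C (\<lambda>z. c (f z)) \<le> m"
    if "distr \<kappa> borel f \<le> \<mu>2" and [measurable]: "f \<in> \<kappa> \<rightarrow>\<^sub>M borel"
    for \<kappa> :: "('a \<times> 'a) measure" and f
  proof -
    have "emeasure (distr \<kappa> ?C (\<lambda>z. c (f z))) X \<le> emeasure m X" for X
    proof -
      have X: "c -` X \<in> sets borel" using measurable_sets[OF c, of X] by simp
      have "emeasure (distr \<kappa> ?C (\<lambda>z. c (f z))) X = emeasure (distr \<kappa> borel f) (c -` X)"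
        using X by (simp add: emeasure_distr vimage_def)
      also have "\<dots> \<le> emeasure \<mu>2 (c -` X)"
        by (rule le_measureD3[OF that(1)]) (simp add: M2)
      also have "\<dots> = emeasure m X" by (simp add: m_def emeasure_distr M2)
      finally show ?thesis .
    qed
    then show ?thesis by (subst le_measure) (auto simp: m_def)
  qed
  interpret G: cell_coupled \<alpha> \<beta> m "\<lambda>z. c (snd z)" "\<lambda>z. c (fst z)"
  proof (intro cell_coupled.intro cell_coupled_axioms.intro)
    show "finite_measure m" unfolding m_def by (rule M2.finite_measure_distr) simp
    show "sets m = UNIV" by (simp add: m_def)
    show "distr \<alpha> ?C (\<lambda>z. c (snd z)) \<le> m" using A(5,3) by (rule law)
    show "distr \<beta> ?C (\<lambda>z. c (fst z)) \<le> m" using B(4,2) by (rule law)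
  qed (use A(1) B(1) in simp_all)
  define N where "N = G.N"
  have sN [measurable_cong]: "sets N = sets (\<alpha> \<Otimes>\<^sub>M \<beta>)" by (simp add: N_def G.sets_N)
  let ?f = "\<lambda>z::('a \<times> 'a) \<times> ('a \<times> 'a). fst (fst z)" and ?g = "\<lambda>z::('a \<times> 'a) \<times> ('a \<times> 'a). snd (snd z)"
  have le1: "distr N borel ?f \<le> distr \<alpha> borel fst" unfolding N_def by (rule G.distr_fst_le) (rule A)
  have le3: "distr N borel ?g \<le> distr \<beta> borel snd" unfolding N_def by (rule G.distr_snd_le) (rule B)
  have fN: "finite_measure N" unfolding N_def by (rule G.finite_N)
  interpret N: finite_measure N by (rule fN)
  have plan: "partial_plan N ?f ?g \<mu>1 \<mu>3"
    unfolding partial_plan_def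
  proof (intro conjI)
    show "distr N borel ?f \<in> finite_borel_measures2"
      using le1 A(6) by (rule finite_borel_measures2_le) simp
    show "distr N borel ?g \<in> finite_borel_measures2"
      using le3 B(7) by (rule finite_borel_measures2_le) simp
  qed (use fN order_trans[OF le1 A(4)] order_trans[OF le3 B(5)] in \<open>simp_all\<close>)
  have sp: "space \<alpha> = UNIV" "space \<beta> = UNIV"
    using sets_eq_imp_space_eq[OF pa(2)] sets_eq_imp_space_eq[OF pb(2)] by auto
  have NA: "mass N \<le> measure \<alpha> UNIV"
  proof -
    have "(\<integral>\<^sup>+z. 1 \<partial>N) \<le> (\<integral>\<^sup>+z. 1 \<partial>\<alpha>)" unfolding N_def by (rule G.nn_integral_fst_le) simp
    then show ?thesis by (simp add: N.emeasure_eq_measure A.emeasure_eq_measure sp)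
  qed
  have NM: "mass N \<le> measure \<mu>2 UNIV"
    using NA partial_plan_mass_le[OF pa(1) \<mu>(1,2)] sp by simp
  have "emeasure \<alpha> (space \<alpha>) + emeasure \<beta> (space \<beta>) \<le> emeasure m (space m) + emeasure N (space N)"
    unfolding N_def by (rule G.mass_N)
  also have "emeasure m (space m) = emeasure \<mu>2 UNIV" by (simp add: m_def emeasure_distr M2)
  finally have NL: "measure \<alpha> UNIV + measure \<beta> UNIV \<le> measure \<mu>2 UNIV + mass N"
    by (simp add: N.emeasure_eq_measure A.emeasure_eq_measure B.emeasure_eq_measure M2.emeasure_eq_measure sp
        ennreal_plus[symmetric] del: ennreal_plus)
  define s where "s = 1 + 1 / t"
  have s: "0 < s" "1 \<le> s" using t by (auto simp: s_def add_pos_pos)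
  define C where "C = (1 + t) * c12 + (s * (1 + \<delta>) * c23 + s * (\<delta>\<^sup>2 + \<delta>) * measure \<mu>2 UNIV)"
  have C0: "0 \<le> C"
    unfolding C_def using s t \<delta> pa(3) pb(3) by (intro add_nonneg_nonneg mult_nonneg_nonneg) auto
  have pt: "(dist (?f z) (?g z))\<^sup>2 \<le> (1 + t) * (dist (fst (fst z)) (snd (fst z)))\<^sup>2 +
      (s * (1 + \<delta>) * (dist (fst (snd z)) (snd (snd z)))\<^sup>2 + s * (\<delta>\<^sup>2 + \<delta>))"
    if "c (snd (fst z)) = c (fst (snd z))" for z
  proof -
    define p q where "p = dist (fst (fst z)) (snd (fst z))" and "q = dist (fst (snd z)) (snd (snd z))"
    have "dist (?f z) (?g z) \<le> p + (\<delta> + q)"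
      using cd[OF that] dist_triangle[of "?f z" "?g z" "snd (fst z)"]
        dist_triangle[of "snd (fst z)" "?g z" "fst (snd z)"] by (simp add: p_def q_def)
    then have "(dist (?f z) (?g z))\<^sup>2 \<le> (p + (\<delta> + q))\<^sup>2" by (rule power_mono) simp
    also have "\<dots> \<le> (1 + t) * p\<^sup>2 + s * (\<delta> + q)\<^sup>2"
      unfolding s_def by (rule two_term_square_bound[OF t])
    \<comment> \<open>Young's inequality with weight \<open>\<delta>\<close>, where \<open>(1 + 1 /
      \<delta>) * \<delta>\<^sup>2 = \<delta>\<^sup>2 + \<delta>\<close>: the jump inside a middle
      cell costs little.\<close>
    also have "(\<delta> + q)\<^sup>2 \<le> (1 + \<delta>) * q\<^sup>2 + (\<delta>\<^sup>2 + \<delta>)"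
    proof -
      have "0 \<le> \<delta> * (1 - q)\<^sup>2" using \<delta> by simp
      then show ?thesis by (simp add: power2_eq_square algebra_simps)
    qed
    finally show ?thesis using s by (simp add: p_def q_def algebra_simps)
  qed
  have "(\<integral>\<^sup>+z. ennreal ((dist (?f z) (?g z))\<^sup>2) \<partial>N)
     \<le> (\<integral>\<^sup>+z. ennreal (1 + t) * ennreal ((dist (fst (fst z)) (snd (fst z)))\<^sup>2) +
        (ennreal (s * (1 + \<delta>)) * ennreal ((dist (fst (snd z)) (snd (snd z)))\<^sup>2) + ennreal (s * (\<delta>\<^sup>2 + \<delta>))) \<partial>N)"
  proof (rule nn_integral_mono_AE)
    have "AE z in N. c (snd (fst z)) = c (fst (snd z))" unfolding N_def by (rule G.AE_N_same_cell)
    then show "AE z in N. ennreal ((dist (?f z) (?g z))\<^sup>2) \<le>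
        ennreal (1 + t) * ennreal ((dist (fst (fst z)) (snd (fst z)))\<^sup>2) +
        (ennreal (s * (1 + \<delta>)) * ennreal ((dist (fst (snd z)) (snd (snd z)))\<^sup>2) + ennreal (s * (\<delta>\<^sup>2 + \<delta>)))"
    proof (rule AE_mp, intro AE_I2 impI)
      fix z :: "('a \<times> 'a) \<times> ('a \<times> 'a)" assume "c (snd (fst z)) = c (fst (snd z))"
      from ennreal_leI[OF pt[OF this]] show "ennreal ((dist (?f z) (?g z))\<^sup>2) \<le>
        ennreal (1 + t) * ennreal ((dist (fst (fst z)) (snd (fst z)))\<^sup>2) +
        (ennreal (s * (1 + \<delta>)) * ennreal ((dist (fst (snd z)) (snd (snd z)))\<^sup>2) + ennreal (s * (\<delta>\<^sup>2 + \<delta>)))"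
        using s t \<delta> by (simp add: ennreal_mult'[symmetric] ennreal_plus[symmetric] del: ennreal_plus)
    qed
  qed
  also have "\<dots> = ennreal (1 + t) * (\<integral>\<^sup>+z. ennreal ((dist (fst (fst z)) (snd (fst z)))\<^sup>2) \<partial>N) +
      (ennreal (s * (1 + \<delta>)) * (\<integral>\<^sup>+z. ennreal ((dist (fst (snd z)) (snd (snd z)))\<^sup>2) \<partial>N) +
        ennreal (s * (\<delta>\<^sup>2 + \<delta>)) * emeasure N (space N))"
    by (simp add: nn_integral_add nn_integral_cmult)
  also have "\<dots> \<le> ennreal (1 + t) * ennreal c12 +
      (ennreal (s * (1 + \<delta>)) * ennreal c23 + ennreal (s * (\<delta>\<^sup>2 + \<delta>)) * ennreal (measure \<mu>2 UNIV))"
  proof (intro add_mono mult_left_mono)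
    have "(\<integral>\<^sup>+z. ennreal ((dist (fst (fst z)) (snd (fst z)))\<^sup>2) \<partial>N) \<le> (\<integral>\<^sup>+z. ennreal ((dist (fst z) (snd z))\<^sup>2) \<partial>\<alpha>)"
      unfolding N_def by (rule G.nn_integral_fst_le) measurable
    with pa(4) show "(\<integral>\<^sup>+z. ennreal ((dist (fst (fst z)) (snd (fst z)))\<^sup>2) \<partial>N) \<le> ennreal c12" by simp
    have "(\<integral>\<^sup>+z. ennreal ((dist (fst (snd z)) (snd (snd z)))\<^sup>2) \<partial>N) \<le> (\<integral>\<^sup>+z. ennreal ((dist (fst z) (snd z))\<^sup>2) \<partial>\<beta>)"
      unfolding N_def by (rule G.nn_integral_snd_le) measurable
    with pb(4) show "(\<integral>\<^sup>+z. ennreal ((dist (fst (snd z)) (snd (snd z)))\<^sup>2) \<partial>N) \<le> ennreal c23" by simp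
    show "emeasure N (space N) \<le> ennreal (measure \<mu>2 UNIV)"
      using NM by (simp add: N.emeasure_eq_measure ennreal_leI)
  qed auto
  also have "\<dots> = ennreal C"
    unfolding C_def using s t \<delta> pa(3) pb(3)
    by (simp add: ennreal_mult'[symmetric] ennreal_plus[symmetric] del: ennreal_plus)
  finally have cost: "(\<integral>\<^sup>+z. ennreal ((dist (?f z) (?g z))\<^sup>2) \<partial>N) \<le> ennreal C" .
  define A12 where "A12 = a * (measure \<mu>1 UNIV + measure \<mu>2 UNIV - 2 * measure \<alpha> UNIV)"
  define A23 where "A23 = a * (measure \<mu>2 UNIV + measure \<mu>3 UNIV - 2 * measure \<beta> UNIV)"
  have A0: "0 \<le> A12" "0 \<le> A23"
    unfolding A12_def A23_def
    using a partial_plan_mass_le[OF pa(1) \<mu>(1,2)] partial_plan_mass_le[OF pb(1) \<mu>(2,3)] sp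
    by (auto intro!: mult_nonneg_nonneg)
  \<comment> \<open>By \<open>NL\<close> the mass left unmatched by the glued plan is at most the
    sum of what the two plans leave unmatched.\<close>
  have "a * (measure \<mu>1 UNIV + measure \<mu>3 UNIV - 2 * mass N) \<le>
     a * ((measure \<mu>1 UNIV + measure \<mu>2 UNIV - 2 * measure \<alpha> UNIV) + (measure \<mu>2 UNIV + measure \<mu>3 UNIV - 2 * measure \<beta> UNIV))"
    using NL by (intro mult_left_mono a) simp
  then have Am: "a * (measure \<mu>1 UNIV + measure \<mu>3 UNIV - 2 * mass N) \<le> A12 + A23"
    by (simp only: A12_def A23_def distrib_left)
  have "(gen_wasserstein a b \<mu>1 \<mu>3)\<^sup>2 \<le> b\<^sup>2 * C + a * (measure \<mu>1 UNIV + measure \<mu>3 UNIV - 2 * mass N)"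
    by (rule gen_wasserstein_sq_le_plan[OF a \<mu>(1,3) plan cost C0])
  also have "\<dots> \<le> b\<^sup>2 * C + (A12 + A23)" using Am by simp
  \<comment> \<open>The mass terms are enlarged to the factors of the transport terms, so that each
    bracket becomes the full value of one of the two plans.\<close>
  also have "\<dots> \<le> b\<^sup>2 * C + ((1 + t) * A12 + s * (1 + \<delta>) * A23)"
  proof -
    have "1 \<le> s * (1 + \<delta>)" using s \<delta> mult_mono[of 1 s 1 "1 + \<delta>"] by simp
    then have "1 * A12 \<le> (1 + t) * A12" "1 * A23 \<le> s * (1 + \<delta>) * A23"
      using A0 t mult_right_mono[of 1 "1 + t" A12] mult_right_mono[of 1 "s * (1 + \<delta>)" A23] by simp_all
    then show ?thesis by simp
  qed
  also have "\<dots> = (1 + t) * (b\<^sup>2 * c12 + A12) + s * ((1 + \<delta>) * (b\<^sup>2 * c23 + A23) + b\<^sup>2 * ((\<delta>\<^sup>2 + \<delta>) * measure \<mu>2 UNIV))"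
    by (simp add: C_def algebra_simps)
  also have "\<dots> \<le> (1 + t) * ((gen_wasserstein a b \<mu>1 \<mu>2)\<^sup>2 + \<delta>) +
    s * ((1 + \<delta>) * ((gen_wasserstein a b \<mu>2 \<mu>3)\<^sup>2 + \<delta>) + b\<^sup>2 * ((\<delta>\<^sup>2 + \<delta>) * measure \<mu>2 UNIV))"
  proof -
    have "b\<^sup>2 * c12 + A12 \<le> (gen_wasserstein a b \<mu>1 \<mu>2)\<^sup>2 + \<delta>"
      "b\<^sup>2 * c23 + A23 \<le> (gen_wasserstein a b \<mu>2 \<mu>3)\<^sup>2 + \<delta>"
      using pa(5) pb(5) by (simp_all add: A12_def A23_def)
    then have "(1 + t) * (b\<^sup>2 * c12 + A12) \<le> (1 + t) * ((gen_wasserstein a b \<mu>1 \<mu>2)\<^sup>2 + \<delta>)"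
      "s * ((1 + \<delta>) * (b\<^sup>2 * c23 + A23)) \<le> s * ((1 + \<delta>) * ((gen_wasserstein a b \<mu>2 \<mu>3)\<^sup>2 + \<delta>))"
      using s t \<delta> by (simp_all add: mult_left_mono)
    then show ?thesis unfolding distrib_left[of s] by linarith
  qed
  finally show ?thesis unfolding s_def .
qed

text \<open>The discretisation error vanishes as \<open>\<delta>\<close> tends to 0 with
  \<open>t\<close> fixed.\<close>

lemma gen_wasserstein_sq_triangle:
  fixes \<mu>1 \<mu>2 \<mu>3 :: "'a::{metric_space, second_countable_topology} measure"
  assumes a: "0 \<le> a" and \<mu>: "\<mu>1 \<in> finite_borel_measures" "\<mu>2 \<in> finite_borel_measures"
    "\<mu>3 \<in> finite_borel_measures" and t: "0 < t"
  shows "(gen_wasserstein a b \<mu>1 \<mu>3)\<^sup>2 \<le> (1 + t) * (gen_wasserstein a b \<mu>1 \<mu>2)\<^sup>2 +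
    (1 + 1 / t) * (gen_wasserstein a b \<mu>2 \<mu>3)\<^sup>2"
proof (rule tendsto_lowerbound)
  let ?F = "\<lambda>\<delta>::real. (1 + t) * ((gen_wasserstein a b \<mu>1 \<mu>2)\<^sup>2 + \<delta>) +
    (1 + 1 / t) * ((1 + \<delta>) * ((gen_wasserstein a b \<mu>2 \<mu>3)\<^sup>2 + \<delta>) + b\<^sup>2 * ((\<delta>\<^sup>2 + \<delta>) * measure \<mu>2 UNIV))"
  have "(?F \<longlongrightarrow> ?F 0) (at_right 0)"
    by (intro tendsto_intros)
  then show "(?F \<longlongrightarrow> (1 + t) * (gen_wasserstein a b \<mu>1 \<mu>2)\<^sup>2 +
    (1 + 1 / t) * (gen_wasserstein a b \<mu>2 \<mu>3)\<^sup>2) (at_right 0)" by simp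
  show "\<forall>\<^sub>F \<delta> in at_right 0. (gen_wasserstein a b \<mu>1 \<mu>3)\<^sup>2 \<le> ?F \<delta>"
    using gen_wasserstein_sq_glue[OF a \<mu> t]
    by (auto simp: eventually_at_filter intro!: always_eventually)
qed simp

text \<open>With \<open>t = q / p\<close> the quadratic bound turns into
  \<open>(p + q)\<^sup>2\<close>.\<close>

lemma gen_wasserstein_triangle:
  fixes \<mu>1 \<mu>2 \<mu>3 :: "'a::{metric_space, second_countable_topology} measure"
  assumes a: "0 \<le> a" and \<mu>: "\<mu>1 \<in> finite_borel_measures" "\<mu>2 \<in> finite_borel_measures"
    "\<mu>3 \<in> finite_borel_measures"
  shows "gen_wasserstein a b \<mu>1 \<mu>3 \<le> gen_wasserstein a b \<mu>1 \<mu>2 + gen_wasserstein a b \<mu>2 \<mu>3"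
proof -
  define p q where "p = gen_wasserstein a b \<mu>1 \<mu>2" and "q = gen_wasserstein a b \<mu>2 \<mu>3"
  have p: "0 \<le> p" "0 \<le> q"
    unfolding p_def q_def using a \<mu> by (auto intro: gen_wasserstein_nonneg)
  have "gen_wasserstein a b \<mu>1 \<mu>3 \<le> p + q + e" if e: "0 < e" for e
  proof -
    \<comment> \<open>The shift by \<open>e / 2\<close> keeps the quotient meaningful and positive
      when a distance is 0.\<close>
    define p' q' where "p' = p + e / 2" and "q' = q + e / 2"
    have p': "0 < p'" "0 < q'" "p \<le> p'" "q \<le> q'" using p e by (auto simp: p'_def q'_def)
    have "(gen_wasserstein a b \<mu>1 \<mu>3)\<^sup>2 \<le> (1 + q' / p') * p\<^sup>2 + (1 + 1 / (q' / p')) * q\<^sup>2"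
      unfolding p_def q_def by (rule gen_wasserstein_sq_triangle[OF a \<mu>]) (use p' in simp)
    also have "\<dots> \<le> (1 + q' / p') * p'\<^sup>2 + (1 + 1 / (q' / p')) * q'\<^sup>2"
      using p p' by (intro add_mono mult_left_mono power_mono) auto
    also have "\<dots> = (p' + q')\<^sup>2"
      using p' by (simp add: power2_eq_square field_simps)
    finally have "gen_wasserstein a b \<mu>1 \<mu>3 \<le> p' + q'"
      by (rule power2_le_imp_le) (use p' in simp)
    then show ?thesis by (simp add: p'_def q'_def)
  qed
  then show ?thesis unfolding p_def q_def by (rule field_le_epsilon)
qed

section \<open>Supports\<close>

lemma closed_msupp: "closed (msupp \<mu>)"
proof -
  have "- msupp \<mu> = \<Union>{U. open U \<and> emeasure \<mu> U = 0}"
    by (auto simp: msupp_def zero_less_iff_neq_zero)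
  then show ?thesis by (auto simp: closed_def intro!: open_Union)
qed

text \<open>The complement is a union of null open sets, of which countably many suffice by second
  countability.\<close>

lemma emeasure_compl_msupp:
  fixes \<mu> :: "'a::second_countable_topology measure"
  assumes "sets \<mu> = sets borel"
  shows "emeasure \<mu> (- msupp \<mu>) = 0"
proof -
  obtain F where F: "F \<subseteq> {U. open U \<and> emeasure \<mu> U = 0}" "countable F"
      "\<Union>F = \<Union>{U. open U \<and> emeasure \<mu> U = 0}"
    by (rule Lindelof[of "{U. open U \<and> emeasure \<mu> U = 0}"]) auto
  have "- msupp \<mu> = \<Union>F"
    unfolding F(3) by (auto simp: msupp_def zero_less_iff_neq_zero)
  moreover have "(\<Union>U\<in>F. U) \<in> null_sets \<mu>"
    using F(1) by (intro null_sets_UN' F(2)) (auto simp: null_sets_def assms)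
  ultimately show ?thesis by auto
qed

text \<open>As an almost-everywhere statement, a support condition passes through couplings and
  image measures.\<close>

lemma msupp_subset_closed_iff:
  fixes \<mu> :: "'a::second_countable_topology measure"
  assumes "sets \<mu> = sets borel" "closed C"
  shows "msupp \<mu> \<subseteq> C \<longleftrightarrow> (AE x in \<mu>. x \<in> C)"
proof -
  have sp: "space \<mu> = UNIV" using sets_eq_imp_space_eq[OF assms(1)] by simp
  have C: "- C \<in> sets \<mu>" using assms by (simp add: borel_open open_Compl)
  have iff: "(AE x in \<mu>. x \<in> C) \<longleftrightarrow> emeasure \<mu> (- C) = 0"
    using C by (subst AE_iff_measurable[of "- C"]) (auto simp: sp)
  show ?thesis
    unfolding iff
  proof
    assume "msupp \<mu> \<subseteq> C"
    then have "emeasure \<mu> (- C) \<le> emeasure \<mu> (- msupp \<mu>)"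
      using closed_msupp[of \<mu>] assms by (intro emeasure_mono) (auto simp: borel_open open_Compl)
    then show "emeasure \<mu> (- C) = 0" using emeasure_compl_msupp[OF assms(1)] by simp
  next
    assume "emeasure \<mu> (- C) = 0"
    then show "msupp \<mu> \<subseteq> C" using assms(2) by (force simp: msupp_def open_Compl)
  qed
qed

section \<open>Transport by maps and masses of balls\<close>

lemma finite_borel_measures2_bounded:
  assumes \<mu>: "\<mu> \<in> finite_borel_measures" and K: "bounded K" and AE: "AE x in \<mu>. x \<in> K"
  shows "\<mu> \<in> finite_borel_measures2"
proof -
  interpret finite_measure \<mu> by (rule finite_borel_measuresD[OF \<mu>])
  obtain x0 e where e: "\<And>x. x \<in> K \<Longrightarrow> dist x0 x \<le> e"
    using K by (auto simp: bounded_def)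
  have "(\<integral>\<^sup>+ x. ennreal ((dist x0 x)\<^sup>2) \<partial>\<mu>) \<le> (\<integral>\<^sup>+ x. ennreal (e\<^sup>2) \<partial>\<mu>)"
    using AE by (intro nn_integral_mono_AE) (auto elim!: eventually_mono intro!: ennreal_leI power_mono e)
  also have "\<dots> < \<infinity>" by (simp add: emeasure_eq_measure ennreal_mult_less_top)
  finally show ?thesis using \<mu> by (auto simp: finite_borel_measures2_def)
qed

text \<open>The graph of \<open>f\<close> is a plan that leaves no mass unmatched, so only the
  transport cost remains.\<close>

lemma gen_wasserstein_distr_le:
  fixes \<nu> :: "'a::{metric_space, second_countable_topology} measure"
  assumes a: "0 \<le> a" and \<nu>: "\<nu> \<in> finite_borel_measures2" and [measurable]: "f \<in> borel \<rightarrow>\<^sub>M borel"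
    and f2: "distr \<nu> borel f \<in> finite_borel_measures2"
    and AE: "AE x in \<nu>. dist x (f x) \<le> \<delta>"
  shows "(gen_wasserstein a b \<nu> (distr \<nu> borel f))\<^sup>2 \<le> b\<^sup>2 * (\<delta>\<^sup>2 * measure \<nu> UNIV)"
proof -
  note \<nu>' = finite_borel_measures2D[OF \<nu>]
  note N = finite_borel_measuresD[OF \<nu>']
  interpret finite_measure \<nu> by (rule N)
  have [measurable_cong]: "sets \<nu> = sets borel" by (rule N)
  have id: "distr \<nu> borel (\<lambda>x. x) = \<nu>" using N by (intro distr_id2) simp
  have plan: "partial_plan \<nu> (\<lambda>x. x) f \<nu> (distr \<nu> borel f)"
    unfolding partial_plan_def id using \<nu> f2 N by simp
  have "(\<integral>\<^sup>+x. ennreal ((dist x (f x))\<^sup>2) \<partial>\<nu>) \<le> (\<integral>\<^sup>+x. ennreal (\<delta>\<^sup>2) \<partial>\<nu>)"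
    using AE by (intro nn_integral_mono_AE) (auto elim!: eventually_mono intro!: ennreal_leI power_mono)
  also have "\<dots> = ennreal (\<delta>\<^sup>2 * measure \<nu> UNIV)"
    by (simp add: emeasure_eq_measure N(2) ennreal_mult'[symmetric])
  finally have cost: "(\<integral>\<^sup>+x. ennreal ((dist x (f x))\<^sup>2) \<partial>\<nu>) \<le> ennreal (\<delta>\<^sup>2 * measure \<nu> UNIV)" .
  from gen_wasserstein_sq_le_plan[OF a \<nu>' finite_borel_measures2D[OF f2] plan cost, of b]
  show ?thesis by (simp add: mass_distr N(2))
qed

text \<open>Mass of \<open>\<nu>\<close> in the small ball is unmatched, or comes from the large
  ball, or has moved by at least \<open>r\<close>. The first kind costs \<open>a\<close> per unit
  and the last at least \<open>(b * r)\<^sup>2\<close> per unit, whence the two constants. The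
  lemmas on supports along convergent sequences rest on this estimate.\<close>

lemma ball_measure_le_gen_wasserstein:
  fixes \<mu> \<nu> :: "'a::{metric_space, second_countable_topology} measure"
  assumes a: "0 < a" and b: "0 < b" and \<mu>: "\<mu> \<in> finite_borel_measures" and \<nu>: "\<nu> \<in> finite_borel_measures"
    and r: "0 < r"
  shows "measure \<nu> (ball x r) \<le> measure \<mu> (ball x (2 * r)) +
    (1 / a + 1 / (b * r)\<^sup>2) * (gen_wasserstein a b \<mu> \<nu>)\<^sup>2"
proof -
  define W where "W = (gen_wasserstein a b \<mu> \<nu>)\<^sup>2"
  define k where "k = 1 / a + 1 / (b * r)\<^sup>2"
  have k: "0 < k" using a b r by (auto simp: k_def intro!: add_pos_pos)
  have a0: "0 \<le> a" using a by simp
  have main: "measure \<nu> (ball x r) \<le> measure \<mu> (ball x (2 * r)) + k * (W + e)" if e: "0 < e" for e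
  proof -
    obtain \<gamma> :: "('a \<times> 'a) measure" and c where g: "partial_plan \<gamma> fst snd \<mu> \<nu>"
      "sets \<gamma> = sets borel" "0 \<le> c"
      "(\<integral>\<^sup>+ z. ennreal ((dist (fst z) (snd z))\<^sup>2) \<partial>\<gamma>) \<le> ennreal c"
      "b\<^sup>2 * c + a * (measure \<mu> UNIV + measure \<nu> UNIV - 2 * measure \<gamma> UNIV) \<le> W + e"
      unfolding W_def by (rule near_optimal_plan[OF a0 \<mu> \<nu> e])
    note P = partial_planD[OF g(1)]
    interpret G: finite_measure \<gamma> by (rule P)
    interpret N: finite_measure \<nu> by (rule finite_borel_measuresD[OF \<nu>])
    have sp: "space \<gamma> = UNIV" using sets_eq_imp_space_eq[OF g(2)] by simp
    note [measurable] = P(2,3)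
    have mle: "measure \<gamma> UNIV \<le> measure \<mu> UNIV" "measure \<gamma> UNIV \<le> measure \<nu> UNIV"
      using partial_plan_mass_le[OF g(1) \<mu> \<nu>] sp by auto
    let ?B = "ball x r" and ?B2 = "ball x (2 * r)"
    define X where "X = snd -` ?B \<inter> space \<gamma>"
    define Y where "Y = fst -` ?B2 \<inter> space \<gamma>"
    define Z where "Z = {z \<in> space \<gamma>. r \<le> dist (fst z) (snd z)}"
    have [measurable]: "X \<in> sets \<gamma>" "Y \<in> sets \<gamma>" "Z \<in> sets \<gamma>"
      unfolding X_def Y_def Z_def by measurable
    have "X \<subseteq> Y \<union> Z"
    proof
      fix z assume z: "z \<in> X"
      show "z \<in> Y \<union> Z"
      proof (cases "r \<le> dist (fst z) (snd z)")
        case False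
        then have "dist x (fst z) < 2 * r"
          using z dist_triangle2[of x "fst z" "snd z"] by (simp add: X_def)
        then show ?thesis using z by (simp add: X_def Y_def)
      qed (use z in \<open>simp add: X_def Z_def\<close>)
    qed
    then have "measure \<gamma> X \<le> measure \<gamma> (Y \<union> Z)" by (intro G.finite_measure_mono) auto
    also have "\<dots> \<le> measure \<gamma> Y + measure \<gamma> Z" by (rule measure_Un_le) auto
    also have "measure \<gamma> Y \<le> measure \<mu> ?B2"
      unfolding Y_def by (rule measure_distr_le[OF P(4,1,2) \<mu>]) simp
    finally have X: "measure \<gamma> X \<le> measure \<mu> ?B2 + measure \<gamma> Z" by simp
    \<comment> \<open>Passing to complements: what \<open>\<gamma>\<close> misses of
      \<open>\<nu>\<close> inside the ball is at most what it misses of \<open>\<nu>\<close>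
      altogether.\<close>
    have "measure \<gamma> (snd -` (- ?B) \<inter> space \<gamma>) \<le> measure \<nu> (- ?B)"
      by (rule measure_distr_le[OF P(5,1,3) \<nu>]) (simp add: borel_open)
    also have "snd -` (- ?B) \<inter> space \<gamma> = space \<gamma> - X" by (auto simp: X_def)
    also have "measure \<gamma> (space \<gamma> - X) = measure \<gamma> UNIV - measure \<gamma> X"
      by (subst G.finite_measure_compl) (auto simp: sp)
    also have "measure \<nu> (- ?B) = measure \<nu> UNIV - measure \<nu> ?B"
      using N.finite_measure_compl[of ?B] finite_borel_measuresD[OF \<nu>] by (simp add: Compl_eq_Diff_UNIV)
    finally have "measure \<nu> ?B \<le> measure \<gamma> X + (measure \<mu> UNIV + measure \<nu> UNIV - 2 * measure \<gamma> UNIV)"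
      using mle by simp
    also have "measure \<mu> UNIV + measure \<nu> UNIV - 2 * measure \<gamma> UNIV \<le> (W + e) / a"
    proof -
      have "0 \<le> b\<^sup>2 * c" using g(3) by simp
      then show ?thesis using g(5) a by (simp add: pos_le_divide_eq mult.commute)
    qed
    finally have 1: "measure \<nu> ?B \<le> measure \<gamma> X + (W + e) / a" by simp
    \<comment> \<open>Chebyshev's inequality for the displacement.\<close>
    have "ennreal (r\<^sup>2) * emeasure \<gamma> Z = (\<integral>\<^sup>+ z. ennreal (r\<^sup>2) * indicator Z z \<partial>\<gamma>)"
      by (rule nn_integral_cmult_indicator[symmetric]) simp
    also have "\<dots> \<le> (\<integral>\<^sup>+ z. ennreal ((dist (fst z) (snd z))\<^sup>2) \<partial>\<gamma>)"
      using r by (intro nn_integral_mono) (auto simp: Z_def indicator_def intro!: ennreal_leI power_mono)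
    finally have "ennreal (r\<^sup>2) * emeasure \<gamma> Z \<le> ennreal c" using g(4) by simp
    then have "r\<^sup>2 * measure \<gamma> Z \<le> c"
      using g(3) by (simp add: G.emeasure_eq_measure ennreal_mult'[symmetric])
    then have "b\<^sup>2 * (r\<^sup>2 * measure \<gamma> Z) \<le> b\<^sup>2 * c" by (rule mult_left_mono) simp
    also have "\<dots> \<le> W + e"
    proof -
      have "0 \<le> a * (measure \<mu> UNIV + measure \<nu> UNIV - 2 * measure \<gamma> UNIV)"
        using a mle by simp
      then show ?thesis using g(5) by simp
    qed
    finally have "(b * r)\<^sup>2 * measure \<gamma> Z \<le> W + e" by (simp add: power_mult_distrib mult.assoc)
    then have "measure \<gamma> Z \<le> (W + e) / (b * r)\<^sup>2"
      using b r by (simp add: pos_le_divide_eq mult.commute)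
    with 1 X show ?thesis by (simp add: k_def algebra_simps)
  qed
  have "measure \<nu> (ball x r) \<le> measure \<mu> (ball x (2 * r)) + k * W"
  proof (rule field_le_epsilon)
    fix e :: real assume "0 < e"
    with main[of "e / k"] k show "measure \<nu> (ball x r) \<le> measure \<mu> (ball x (2 * r)) + k * W + e"
      by (simp add: distrib_left)
  qed
  then show ?thesis by (simp add: k_def W_def)
qed

section \<open>Binary codes of cells and nested intervals\<close>

text \<open>A word of length \<open>l\<close> records membership in \<open>B 0\<close>, ...,
  \<open>B (l - 1)\<close> with the newest bit in front. Refinement is then \<open>Cons\<close>: the
  cell of \<open>w\<close> is the disjoint union of the cells of \<open>True # w\<close> and
  \<open>False # w\<close>.\<close>

primrec code :: "(nat \<Rightarrow> 'a set) \<Rightarrow> nat \<Rightarrow> 'a \<Rightarrow> bool list" where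
  "code B 0 x = []"
| "code B (Suc l) x = (x \<in> B l) # code B l x"

lemma length_code [simp]: "length (code B l x) = l"
  by (induction l) auto

lemma code_eqD: "code B l x = code B l y \<Longrightarrow> i < l \<Longrightarrow> x \<in> B i \<longleftrightarrow> y \<in> B i"
  by (induction l) (auto simp: less_Suc_eq)

lemma measurable_code [measurable]:
  assumes [measurable]: "\<And>i. B i \<in> sets M"
  shows "code B l \<in> M \<rightarrow>\<^sub>M count_space UNIV"
  by (induction l) auto

text \<open>Finitely many basic sets, each inside a ball of radius \<open>e / 2\<close>, cover
  \<open>K\<close>. Once \<open>l\<close> exceeds their indices, a code reveals a member of this
  cover that contains all points of \<open>K\<close> with that code.\<close>

lemma compact_small_codes:
  fixes K :: "'a::metric_space set"
  assumes K: "compact K" and B: "topological_basis (range B)" and e: "0 < e"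
  obtains l where "\<And>x y. x \<in> K \<Longrightarrow> y \<in> K \<Longrightarrow> code B l x = code B l y \<Longrightarrow> dist x y < e"
proof -
  define I where "I = {i. \<exists>z\<in>K. B i \<subseteq> ball z (e / 2)}"
  have op: "open (B i)" for i using B by (auto dest: topological_basis_open)
  have cov: "K \<subseteq> (\<Union>i\<in>I. B i)"
  proof
    fix z assume z: "z \<in> K"
    obtain U where "U \<in> range B" "z \<in> U" "U \<subseteq> ball z (e / 2)"
      by (rule topological_basisE[OF B open_ball, of z z "e / 2"]) (use e in auto)
    then show "z \<in> (\<Union>i\<in>I. B i)" using z by (auto simp: I_def)
  qed
  obtain J where J: "J \<subseteq> I" "finite J" "K \<subseteq> (\<Union>i\<in>J. B i)"
    by (rule compactE_image[OF K _ cov]) (simp add: op, rule that)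
  have "\<exists>l. \<forall>i\<in>J. i < l" using J(2) by (simp add: finite_nat_set_iff_bounded)
  then obtain l where l: "\<And>i. i \<in> J \<Longrightarrow> i < l" by blast
  show thesis
  proof (rule that[of l])
    fix x y assume xy: "x \<in> K" "y \<in> K" "code B l x = code B l y"
    then obtain i where i: "i \<in> J" "x \<in> B i" using J(3) by blast
    then have "y \<in> B i" using code_eqD[OF xy(3) l] by blast
    moreover obtain z where "B i \<subseteq> ball z (e / 2)" using i J(1) by (auto simp: I_def)
    ultimately have "dist z x < e / 2" "dist z y < e / 2" using i by auto
    then show "dist x y < e" using dist_triangle3[of x y z] by simp
  qed
qed

text \<open>A consistent family of cell masses \<open>p\<close> is realised by nested intervals: the cell \<open>w\<close>
  corresponds to the interval of length \<open>p w\<close> starting at \<open>left_end p w\<close>.\<close>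

primrec left_end :: "(bool list \<Rightarrow> real) \<Rightarrow> bool list \<Rightarrow> real" where
  "left_end p [] = 0"
| "left_end p (c # w) = (if c then left_end p w else left_end p w + p (True # w))"

text \<open>Counterpart of \<open>code\<close> on the parameter interval: for
  \<open>0 \<le> u < p []\<close> it is the word whose interval contains \<open>u\<close>, the
  \<open>True\<close> child being the left part.\<close>

primrec address :: "(bool list \<Rightarrow> real) \<Rightarrow> nat \<Rightarrow> real \<Rightarrow> bool list" where
  "address p 0 u = []"
| "address p (Suc l) u =
     (u < left_end p (address p l u) + p (True # address p l u)) # address p l u"

lemma length_address [simp]: "length (address p l u) = l"
  by (induction l) auto

text \<open>Consistency of \<open>p\<close> makes the two children fill the parent interval, and
  half-open intervals keep them disjoint even when a child has mass 0.\<close>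

lemma address_interval:
  assumes p: "\<And>w. p w = p (True # w) + p (False # w)" "\<And>w. 0 \<le> p w"
  shows "{u. 0 \<le> u \<and> u < p [] \<and> address p (length w) u = w} = {left_end p w ..< left_end p w + p w}"
proof (induction w)
  case (Cons c w)
  have "{u. 0 \<le> u \<and> u < p [] \<and> address p (length (c # w)) u = c # w} =
      {u. 0 \<le> u \<and> u < p [] \<and> address p (length w) u = w} \<inter>
      {u. (u < left_end p w + p (True # w)) = c}"
    by auto
  also have "\<dots> = {left_end p w ..< left_end p w + p w} \<inter> {u. (u < left_end p w + p (True # w)) = c}"
    by (simp only: Cons.IH)
  also have "\<dots> = {left_end p (c # w) ..< left_end p (c # w) + p (c # w)}"
    using p(1)[of w] p(2)[of "True # w"] p(2)[of "False # w"] by (cases c) auto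
  finally show ?case .
qed auto

lemma measurable_address [measurable]: "address p l \<in> borel \<rightarrow>\<^sub>M count_space UNIV"
proof (induction l)
  case (Suc l)
  note [measurable] = Suc
  \<comment> \<open>Words form a countable type, so every real function of the address is
    measurable.\<close>
  have [measurable]: "(\<lambda>u. left_end p (address p l u) + p (True # address p l u)) \<in> borel_measurable borel"
    by (rule measurable_compose_countable[where g = "address p l"]) simp_all
  have [measurable]: "Measurable.pred borel (\<lambda>u. u < left_end p (address p l u) + p (True # address p l u))"
    by measurable
  have "(\<lambda>u. (\<lambda>w u. (u < left_end p (address p l u) + p (True # address p l u)) # w) (address p l u) u)
     \<in> borel \<rightarrow>\<^sub>M count_space UNIV"
    by (rule measurable_compose_countable) measurable
  then show ?case by simp
qed simp

text \<open>Codes and addresses of lower level are tails of those of higher level.\<close>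

lemma address_code_prefix:
  assumes "code B m x = address p m u" "l \<le> m"
  shows "code B l x = address p l u"
  using assms by (induction m) (auto simp: le_Suc_eq)

section \<open>Compactness\<close>

lemma le_measure_countableI:
  fixes M :: "'i::countable measure"
  assumes "sets M = UNIV" "sets N = UNIV" "\<And>i. emeasure M {i} \<le> emeasure N {i}"
  shows "M \<le> N"
proof -
  have "emeasure M X \<le> emeasure N X" for X
  proof -
    have "emeasure M X = (\<integral>\<^sup>+ i. emeasure M {i} \<partial>count_space X)"
      by (rule emeasure_countable_singleton) (auto simp: assms)
    also have "\<dots> \<le> (\<integral>\<^sup>+ i. emeasure N {i} \<partial>count_space X)"
      by (intro nn_integral_mono assms)
    also have "\<dots> = emeasure N X"
      by (rule emeasure_countable_singleton[symmetric]) (auto simp: assms)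
    finally show ?thesis .
  qed
  then show ?thesis using assms by (subst le_measure) auto
qed

lemma finite_bool_lists: "finite {w :: bool list. length w = l}"
  using finite_lists_length_eq[of "UNIV :: bool set" l] by simp

lemma sum_consistent_masses:
  fixes p :: "bool list \<Rightarrow> real"
  assumes p: "\<And>w. p w = p (True # w) + p (False # w)"
  shows "(\<Sum>w | length w = l. p w) = p []"
proof (induction l)
  case (Suc l)
  have "{w :: bool list. length w = Suc l} = Cons True ` {w. length w = l} \<union> Cons False ` {w. length w = l}"
    by (auto simp: length_Suc_conv image_iff)
  then have "(\<Sum>w | length w = Suc l. p w) =
      (\<Sum>w\<in>Cons True ` {w. length w = l}. p w) + (\<Sum>w\<in>Cons False ` {w. length w = l}. p w)"
    using finite_bool_lists[of l] by (auto intro!: sum.union_disjoint)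
  also have "\<dots> = (\<Sum>w | length w = l. p (True # w) + p (False # w))"
    by (simp add: sum.reindex sum.distrib)
  also have "\<dots> = (\<Sum>w | length w = l. p w)"
    by (rule sum.cong) (auto simp: p[symmetric])
  finally show ?case using Suc by simp
qed simp

lemma code_cell_borel:
  assumes "\<And>i. open (B i)"
  shows "code B l -` {w} \<in> sets borel"
proof -
  have "code B l \<in> borel \<rightarrow>\<^sub>M count_space UNIV"
    by (rule measurable_code) (simp add: assms borel_open)
  from measurable_sets[OF this, of "{w}"] show ?thesis by simp
qed

text \<open>Diagonal extraction over the countably many words of all lengths at once; consistency is
  linear and so survives the limit.\<close>

lemma convergent_cell_masses:
  fixes \<mu> :: "nat \<Rightarrow> 'a::topological_space measure"
  assumes \<mu>: "\<And>n. \<mu> n \<in> finite_borel_measures" and R: "\<And>n. measure (\<mu> n) UNIV \<le> R"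
    and B: "\<And>i. open (B i)"
  obtains k p where "strict_mono (k :: nat \<Rightarrow> nat)"
    "\<And>w. (\<lambda>n. measure (\<mu> (k n)) (code B (length w) -` {w})) \<longlonglongrightarrow> p w"
    "\<And>w. 0 \<le> p w" "\<And>w. p w = p (True # w) + p (False # w)"
proof -
  have [measurable]: "B i \<in> sets borel" for i using B by (simp add: borel_open)
  have cell: "code B l -` {w} \<in> sets borel" for l w
    by (rule code_cell_borel[OF B])
  define P where "P n w = measure (\<mu> n) (code B (length w) -` {w})" for n w
  have P: "P n w = P n (True # w) + P n (False # w)" for n w
  proof -
    note M = finite_borel_measuresD[OF \<mu>[of n]]
    interpret finite_measure "\<mu> n" by (rule M)
    have "code B (length w) -` {w} = code B (length (True # w)) -` {True # w} \<union> code B (length (False # w)) -` {False # w}"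
      "code B (length (True # w)) -` {True # w} \<inter> code B (length (False # w)) -` {False # w} = {}"
      by auto
    then show ?thesis
      unfolding P_def using cell M by (metis finite_measure_Union)
  qed
  have Pb: "norm (P n w) \<le> R" for n w
  proof -
    interpret finite_measure "\<mu> n" by (rule finite_borel_measuresD[OF \<mu>])
    show ?thesis
      using bounded_measure[of "code B (length w) -` {w}"] R[of n] finite_borel_measuresD(2)[OF \<mu>[of n]]
      by (simp add: P_def)
  qed
  obtain k where k: "strict_mono (k :: nat \<Rightarrow> nat)" "\<And>w. \<exists>l. (\<lambda>n. P (k n) w) \<longlonglongrightarrow> l"
    by (rule function_convergent_subsequence[of UNIV P R]) (simp, rule Pb, rule that, simp_all)
  then obtain p where p: "\<And>w. (\<lambda>n. P (k n) w) \<longlonglongrightarrow> p w" by metis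
  show thesis
  proof (rule that[OF k(1)])
    show "(\<lambda>n. measure (\<mu> (k n)) (code B (length w) -` {w})) \<longlonglongrightarrow> p w" for w
      using p[of w] by (simp add: P_def)
    show "0 \<le> p w" for w
      by (rule LIMSEQ_le_const[OF p[of w]]) (auto simp: P_def)
    show "p w = p (True # w) + p (False # w)" for w
    proof -
      have "(\<lambda>n. P (k n) w) \<longlonglongrightarrow> p (True # w) + p (False # w)"
        unfolding P[of _ w] by (intro tendsto_add p)
      with p[of w] show ?thesis by (rule LIMSEQ_unique)
    qed
  qed
qed

text \<open>The limit is the image under \<open>T\<close> of Lebesgue measure on
  \<open>[0, p [])\<close>, where \<open>T u\<close> is a limit of points of \<open>K\<close> coded
  by the addresses of \<open>u\<close>. Such a limit may leave the cells, so the cell masses of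
  \<open>\<mu>'\<close> need not be given by \<open>p\<close>. For this reason
  \<open>\<mu> n\<close> is coupled with the parameter measure \<open>\<rho>\<close>,
  \<open>code\<close> against \<open>address\<close>, and \<open>T\<close> is applied only
  afterwards.\<close>

lemma precompact_on_compact:
  fixes \<mu> :: "nat \<Rightarrow> 'a::polish_space measure"
  assumes a: "0 \<le> a" and \<mu>: "\<And>n. \<mu> n \<in> finite_borel_measures" and R: "\<And>n. measure (\<mu> n) UNIV \<le> R"
    and K: "compact K" and \<mu>K: "\<And>n. AE x in \<mu> n. x \<in> K"
  obtains k \<mu>' where "strict_mono (k :: nat \<Rightarrow> nat)" "\<mu>' \<in> finite_borel_measures"
    "(\<lambda>n. gen_wasserstein a b (\<mu> (k n)) \<mu>') \<longlonglongrightarrow> 0"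
proof -
  obtain Bs :: "'a set set" where Bs: "countable Bs" "topological_basis Bs"
    using ex_countable_basis by blast
  have "Bs \<noteq> {}" using topological_basisE[OF Bs(2) open_UNIV, of undefined] by auto
  then obtain B :: "nat \<Rightarrow> 'a set" where B: "topological_basis (range B)"
    using Bs range_from_nat_into by metis
  have op: "open (B i)" for i using B by (auto dest: topological_basis_open)
  have [measurable]: "B i \<in> sets borel" for i using op by (simp add: borel_open)
  have cell: "code B l -` {w} \<in> sets borel" for l w
    by (rule code_cell_borel[OF op])
  obtain k p where k: "strict_mono (k :: nat \<Rightarrow> nat)"
    and lim: "\<And>w. (\<lambda>n. measure (\<mu> (k n)) (code B (length w) -` {w})) \<longlonglongrightarrow> p w"
    and p0: "\<And>w. 0 \<le> p w" and pc: "\<And>w. p w = p (True # w) + p (False # w)"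
    by (rule convergent_cell_masses[OF \<mu> R op]) (rule that)
  define I where "I = {0 ..< p []}"
  have addr: "{u \<in> I. address p (length w) u = w} = {left_end p w ..< left_end p w + p w}" for w
    using address_interval[OF pc p0, of w] by (simp add: I_def)
  have [measurable]: "I \<in> sets borel" by (simp add: I_def)
  define \<rho> where "\<rho> = density lborel (indicator I :: real \<Rightarrow> ennreal)"
  have em\<rho>: "emeasure \<rho> A = emeasure lborel (A \<inter> I)" if "A \<in> sets borel" for A
    using that by (simp add: \<rho>_def emeasure_restricted Int_commute)
  have s\<rho> [measurable_cong]: "sets \<rho> = sets borel" by (simp add: \<rho>_def)
  have sp\<rho>: "space \<rho> = UNIV" by (simp add: \<rho>_def)
  have mass\<rho>: "emeasure \<rho> UNIV = ennreal (p [])"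
    using em\<rho>[of UNIV] p0[of "[]"] by (simp add: I_def)
  interpret \<rho>: finite_measure \<rho> by (rule finite_measureI) (simp add: sp\<rho> mass\<rho>)
  have AE\<rho>: "AE u in \<rho>. u \<in> I"
    unfolding \<rho>_def by (subst AE_density) (auto simp: indicator_def)

  \<comment> \<open>A word that codes no point of \<open>K\<close> gets mass 0 from every
    \<open>\<mu> n\<close>, hence 0 in the limit.\<close>
  have ne: "\<exists>x. x \<in> K \<and> code B (length w) x = w" if "0 < p w" for w
  proof (rule ccontr)
    assume no: "\<not> ?thesis"
    have "measure (\<mu> n) (code B (length w) -` {w}) = 0" for n
    proof -
      note M = finite_borel_measuresD[OF \<mu>[of n]]
      have "AE x in \<mu> n. x \<notin> code B (length w) -` {w}"
        using \<mu>K[of n] no by (auto elim!: eventually_mono)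
      then have "emeasure (\<mu> n) (code B (length w) -` {w}) = 0"
        using cell[of "length w" w] M by (subst (asm) AE_iff_measurable[OF _ refl]) (auto simp: vimage_def)
      then show ?thesis by (simp add: measure_def)
    qed
    then have "p w = 0" using lim[of w] by (simp add: LIMSEQ_const_iff)
    with that show False by simp
  qed
  \<comment> \<open>Possibly arbitrary for words of mass 0, but their intervals are empty and they
    are the address of no point of \<open>I\<close>.\<close>
  define pt where "pt w = (SOME x. x \<in> K \<and> code B (length w) x = w)" for w
  have pt: "pt (address p l u) \<in> K" "code B l (pt (address p l u)) = address p l u" if u: "u \<in> I" for l u
  proof -
    have "u \<in> {left_end p (address p l u) ..< left_end p (address p l u) + p (address p l u)}"
      using addr[of "address p l u"] u by auto
    then have "0 < p (address p l u)" by simp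
    from someI_ex[OF ne[OF this]]
    show "pt (address p l u) \<in> K" "code B l (pt (address p l u)) = address p l u"
      by (simp_all add: pt_def)
  qed
  have near: "dist x (pt (address p m u)) < e"
    if l: "\<And>x y. x \<in> K \<Longrightarrow> y \<in> K \<Longrightarrow> code B l x = code B l y \<Longrightarrow> dist x y < e"
      and "u \<in> I" "l \<le> m" "x \<in> K" "code B l x = address p l u" for x m u e l
    using address_code_prefix[OF pt(2)[OF \<open>u \<in> I\<close>, of m] \<open>l \<le> m\<close>] that(4,5) pt(1)[OF \<open>u \<in> I\<close>]
    by (intro l) auto
  \<comment> \<open>Points for longer addresses share their level \<open>l\<close> code and so lie
    within \<open>e\<close> of each other; completeness of the space provides the limit.\<close>
  have conv: "convergent (\<lambda>l. pt (address p l u))" if u: "u \<in> I" for u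
  proof -
    have "Cauchy (\<lambda>l. pt (address p l u))"
    proof (rule metric_CauchyI)
      fix e :: real assume "0 < e"
      then obtain l where l: "\<And>x y. x \<in> K \<Longrightarrow> y \<in> K \<Longrightarrow> code B l x = code B l y \<Longrightarrow> dist x y < e"
        by (rule compact_small_codes[OF K B]) (rule that)
      have "dist (pt (address p m u)) (pt (address p n u)) < e" if "l \<le> m" "l \<le> n" for m n
        by (rule near[OF l u that(2) pt(1)[OF u] address_code_prefix[OF pt(2)[OF u] that(1)]])
      then show "\<exists>M. \<forall>m\<ge>M. \<forall>n\<ge>M. dist (pt (address p m u)) (pt (address p n u)) < e" by blast
    qed
    then show ?thesis by (rule Cauchy_convergent)
  qed
  \<comment> \<open>The complement of \<open>I\<close> is null for \<open>\<rho>\<close>; a constant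
    value there keeps \<open>T\<close> Borel.\<close>
  define T where "T u = (if u \<in> I then lim (\<lambda>l. pt (address p l u)) else undefined)" for u
  have Tlim: "(\<lambda>l. pt (address p l u)) \<longlonglongrightarrow> T u" if "u \<in> I" for u
    using conv[OF that] that by (simp add: T_def convergent_LIMSEQ_iff)
  have TK: "T u \<in> K" if "u \<in> I" for u
    by (rule closed_sequentially[OF compact_imp_closed[OF K] _ Tlim[OF that]]) (simp add: pt that)
  have [measurable]: "T \<in> borel \<rightarrow>\<^sub>M borel"
  proof (rule borel_measurable_LIMSEQ_metric)
    show "(\<lambda>u. if u \<in> I then pt (address p l u) else undefined) \<in> borel_measurable borel" for l
    proof -
      have "(\<lambda>u. (\<lambda>w u. if u \<in> I then pt w else undefined) (address p l u) u) \<in> borel_measurable borel"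
        by (rule measurable_compose_countable) measurable
      then show ?thesis by simp
    qed
    show "(\<lambda>l. if u \<in> I then pt (address p l u) else undefined) \<longlonglongrightarrow> T u" for u
      using Tlim[of u] by (cases "u \<in> I") (auto simp: T_def)
  qed
  have Tnear: "dist x (T u) \<le> e"
    if l: "\<And>x y. x \<in> K \<Longrightarrow> y \<in> K \<Longrightarrow> code B l x = code B l y \<Longrightarrow> dist x y < e"
      and "u \<in> I" "x \<in> K" "code B l x = address p l u" for x u e l
  proof (rule LIMSEQ_le_const2)
    show "(\<lambda>m. dist x (pt (address p m u))) \<longlonglongrightarrow> dist x (T u)"
      by (intro tendsto_dist tendsto_const Tlim[OF that(2)])
    show "\<exists>N. \<forall>m\<ge>N. dist x (pt (address p m u)) \<le> e"
    proof (intro exI allI impI)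
      fix m assume "l \<le> m"
      show "dist x (pt (address p m u)) \<le> e"
        by (rule less_imp_le[OF near[OF l that(2) \<open>l \<le> m\<close> that(3,4)]])
    qed
  qed

  define \<mu>' where "\<mu>' = distr \<rho> borel T"
  have \<mu>': "\<mu>' \<in> finite_borel_measures"
    unfolding \<mu>'_def by (rule finite_borel_measures_distr) (use \<rho>.finite_measure_axioms in simp_all)
  have KB: "K \<in> sets borel" using K by (simp add: compact_imp_closed borel_closed)
  have "AE x in \<mu>'. x \<in> K"
    unfolding \<mu>'_def using AE\<rho> KB by (subst AE_distr_iff) (auto elim!: eventually_mono intro: TK)
  then have \<mu>'2: "\<mu>' \<in> finite_borel_measures2"
    by (rule finite_borel_measures2_bounded[OF \<mu>' compact_imp_bounded[OF K]])
  have \<mu>2: "\<mu> n \<in> finite_borel_measures2" for n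
    by (rule finite_borel_measures2_bounded[OF \<mu> compact_imp_bounded[OF K] \<mu>K])
  have m\<mu>': "measure \<mu>' UNIV = p []"
  proof -
    have "measure \<rho> UNIV = p []" using mass\<rho> p0[of "[]"] by (simp add: measure_def)
    then show ?thesis unfolding \<mu>'_def by (subst mass_distr) (simp_all add: sp\<rho>)
  qed
  have R0: "0 \<le> R" using R[of 0] measure_nonneg[of "\<mu> 0" UNIV] by linarith

  \<comment> \<open>Writing \<open>P\<close> for the cell masses of \<open>\<mu> n\<close>, the
    coupling keeps at least the sum of \<open>min P p\<close>, and the bracket multiplied by
    \<open>a\<close> is the sum of \<open>\<bar>P - p\<bar>\<close> over the words of length
    \<open>l\<close>.\<close>
  have bound: "(gen_wasserstein a b (\<mu> n) \<mu>')\<^sup>2 \<le> b\<^sup>2 * (e\<^sup>2 * R) +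
      a * (2 * (\<Sum>w | length w = l. max (measure (\<mu> n) (code B (length w) -` {w})) (p w))
            - measure (\<mu> n) UNIV - p [])"
    if e: "0 < e" and l: "\<And>x y. x \<in> K \<Longrightarrow> y \<in> K \<Longrightarrow> code B l x = code B l y \<Longrightarrow> dist x y < e" for n e l
  proof -
    note M = finite_borel_measuresD[OF \<mu>[of n]]
    interpret M: finite_measure "\<mu> n" by (rule M)
    have [measurable_cong]: "sets (\<mu> n) = sets borel" by (rule M)
    define P where "P w = measure (\<mu> n) (code B (length w) -` {w})" for w
    \<comment> \<open>The least cell masses dominating both laws at level \<open>l\<close>.\<close>
    define f where "f w = (if length w = l then ennreal (max (P w) (p w)) else 0)" for w
    define m where "m = point_measure UNIV f"
    have ms: "sets m = UNIV" by (simp add: m_def sets_point_measure)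
    have m1: "emeasure m {w} = f w" for w
      unfolding m_def by (subst emeasure_point_measure_finite2) auto
    have mU: "emeasure m (space m) = ennreal (\<Sum>w | length w = l. max (P w) (p w))"
    proof -
      have fin: "finite {w. 0 < f w}"
        by (rule finite_subset[OF _ finite_bool_lists[of l]]) (auto simp: f_def split: if_splits)
      have "emeasure m (space m) = (\<Sum>w | 0 < f w. f w)"
        unfolding m_def using fin by (subst emeasure_point_measure) (auto simp: space_point_measure)
      also have "\<dots> = (\<Sum>w | length w = l. f w)"
        by (rule sum.mono_neutral_left[OF finite_bool_lists])
          (force simp: f_def split: if_splits, simp add: zero_less_iff_neq_zero)
      also have "\<dots> = (\<Sum>w | length w = l. ennreal (max (P w) (p w)))"
        by (rule sum.cong) (auto simp: f_def)
      also have "\<dots> = ennreal (\<Sum>w | length w = l. max (P w) (p w))"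
        by (rule sum_ennreal) (auto simp: le_max_iff_disj p0)
      finally show ?thesis .
    qed
    have c1 [measurable]: "code B l \<in> \<mu> n \<rightarrow>\<^sub>M count_space UNIV" by measurable
    have c2 [measurable]: "address p l \<in> \<rho> \<rightarrow>\<^sub>M count_space UNIV" by measurable
    interpret G: cell_coupled "\<mu> n" \<rho> m "code B l" "address p l"
    proof (intro cell_coupled.intro cell_coupled_axioms.intro)
      show "finite_measure m" by (rule finite_measureI) (simp add: mU)
      show "distr (\<mu> n) (count_space UNIV) (code B l) \<le> m"
      proof (rule le_measure_countableI)
        fix w
        have "emeasure (distr (\<mu> n) (count_space UNIV) (code B l)) {w} = emeasure (\<mu> n) (code B l -` {w})"
          by (simp add: emeasure_distr M)
        also have "\<dots> \<le> emeasure m {w}"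
        proof (cases "length w = l")
          case False
          then have "code B l -` {w} = {}" by auto
          then show ?thesis by simp
        next
          case True
          then have "emeasure (\<mu> n) (code B l -` {w}) = ennreal (P w)"
            by (simp add: P_def M.emeasure_eq_measure)
          also have "\<dots> \<le> ennreal (max (P w) (p w))" by (intro ennreal_leI) simp
          finally show ?thesis using True by (simp add: m1 f_def)
        qed
        finally show "emeasure (distr (\<mu> n) (count_space UNIV) (code B l)) {w} \<le> emeasure m {w}" .
      qed (simp_all add: ms)
      show "distr \<rho> (count_space UNIV) (address p l) \<le> m"
      proof (rule le_measure_countableI)
        fix w
        have "emeasure (distr \<rho> (count_space UNIV) (address p l)) {w} = emeasure \<rho> (address p l -` {w})"
          by (simp add: emeasure_distr sp\<rho>)
        also have "\<dots> \<le> emeasure m {w}"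
        proof (cases "length w = l")
          case False
          then have "address p l -` {w} = {}" by auto
          then show ?thesis by simp
        next
          case True
          have "address p l -` {w} \<in> sets borel"
            using measurable_sets[OF measurable_address, of "{w}"] by simp
          then have "emeasure \<rho> (address p l -` {w}) = emeasure lborel (address p l -` {w} \<inter> I)"
            by (rule em\<rho>)
          also have "address p l -` {w} \<inter> I = {left_end p w ..< left_end p w + p w}"
            using addr[of w] True by auto
          also have "emeasure lborel \<dots> = ennreal (p w)"
            using p0[of w] by simp
          also have "\<dots> \<le> ennreal (max (P w) (p w))" by (intro ennreal_leI) simp
          finally show ?thesis using True by (simp add: m1 f_def)
        qed
        finally show "emeasure (distr \<rho> (count_space UNIV) (address p l)) {w} \<le> emeasure m {w}" .
      qed (simp_all add: ms)
    qed (use M \<rho>.finite_measure_axioms ms in simp_all)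
    define N where "N = G.N"
    have sN [measurable_cong]: "sets N = sets (\<mu> n \<Otimes>\<^sub>M \<rho>)" by (simp add: N_def G.sets_N)
    have fN: "finite_measure N" unfolding N_def by (rule G.finite_N)
    interpret N: finite_measure N by (rule fN)
    have id: "distr (\<mu> n) borel (\<lambda>x. x) = \<mu> n" using M by (intro distr_id2) simp
    have le1: "distr N borel fst \<le> \<mu> n"
      unfolding N_def using G.distr_fst_le[of "\<lambda>x. x" borel] id by simp
    have le2: "distr N borel (\<lambda>z. T (snd z)) \<le> \<mu>'"
      unfolding N_def \<mu>'_def by (rule G.distr_snd_le) measurable
    have plan: "partial_plan N fst (\<lambda>z. T (snd z)) (\<mu> n) \<mu>'"
      unfolding partial_plan_def
      using fN le1 le2 finite_borel_measures2_le[OF le1 \<mu>2] finite_borel_measures2_le[OF le2 \<mu>'2] by simp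
    have NA: "mass N \<le> R"
    proof -
      have "(\<integral>\<^sup>+z. 1 \<partial>N) \<le> (\<integral>\<^sup>+z. 1 \<partial>\<mu> n)" unfolding N_def by (rule G.nn_integral_fst_le) simp
      then show ?thesis using R[of n] by (simp add: N.emeasure_eq_measure M.emeasure_eq_measure M(2))
    qed
    have "emeasure (\<mu> n) (space (\<mu> n)) + emeasure \<rho> (space \<rho>) \<le> emeasure m (space m) + emeasure N (space N)"
      unfolding N_def by (rule G.mass_N)
    moreover have S0: "0 \<le> (\<Sum>w | length w = l. max (P w) (p w))"
      by (intro sum_nonneg) (auto simp: le_max_iff_disj p0)
    ultimately have NL: "measure (\<mu> n) UNIV + p [] \<le> (\<Sum>w | length w = l. max (P w) (p w)) + mass N"
      using p0[of "[]"]
      by (simp add: mU mass\<rho> sp\<rho> M(2) N.emeasure_eq_measure M.emeasure_eq_measure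
          ennreal_plus[symmetric] del: ennreal_plus)
    have "AE z in N. dist (fst z) (T (snd z)) \<le> e"
    proof -
      have "AE z in N. code B l (fst z) = address p l (snd z)" unfolding N_def by (rule G.AE_N_same_cell)
      moreover have "AE z in N. fst z \<in> K" unfolding N_def by (rule G.AE_N_fst[OF \<mu>K])
      moreover have "AE z in N. snd z \<in> I" unfolding N_def by (rule G.AE_N_snd[OF AE\<rho>])
      ultimately show ?thesis by eventually_elim (rule Tnear[OF l])
    qed
    then have "(\<integral>\<^sup>+z. ennreal ((dist (fst z) (T (snd z)))\<^sup>2) \<partial>N) \<le> (\<integral>\<^sup>+z. ennreal (e\<^sup>2) \<partial>N)"
      by (intro nn_integral_mono_AE) (auto elim!: eventually_mono intro!: ennreal_leI power_mono)
    also have "\<dots> = ennreal (e\<^sup>2 * mass N)"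
      by (simp add: N.emeasure_eq_measure ennreal_mult'[symmetric])
    also have "\<dots> \<le> ennreal (e\<^sup>2 * R)"
      using NA by (intro ennreal_leI mult_left_mono) auto
    finally have cost: "(\<integral>\<^sup>+z. ennreal ((dist (fst z) (T (snd z)))\<^sup>2) \<partial>N) \<le> ennreal (e\<^sup>2 * R)" .
    have "(gen_wasserstein a b (\<mu> n) \<mu>')\<^sup>2 \<le> b\<^sup>2 * (e\<^sup>2 * R) +
        a * (measure (\<mu> n) UNIV + measure \<mu>' UNIV - 2 * mass N)"
      using R0 by (intro gen_wasserstein_sq_le_plan[OF a \<mu> \<mu>' plan cost]) simp
    also have "a * (measure (\<mu> n) UNIV + measure \<mu>' UNIV - 2 * mass N) \<le>
        a * (2 * (\<Sum>w | length w = l. max (P w) (p w)) - measure (\<mu> n) UNIV - p [])"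
      using NL m\<mu>' by (intro mult_left_mono a) simp
    finally show ?thesis by (simp add: P_def)
  qed

  have ev: "\<forall>\<^sub>F n in sequentially. (gen_wasserstein a b (\<mu> (k n)) \<mu>')\<^sup>2 < b\<^sup>2 * (e\<^sup>2 * R) + e" if e: "0 < e" for e
  proof -
    obtain l where l: "\<And>x y. x \<in> K \<Longrightarrow> y \<in> K \<Longrightarrow> code B l x = code B l y \<Longrightarrow> dist x y < e"
      by (rule compact_small_codes[OF K B e]) (rule that)
    \<comment> \<open>A fixed level has finitely many words, so convergence of each cell mass
      suffices; the empty word accounts for the total masses.\<close>
    let ?S = "\<lambda>n. \<Sum>w | length w = l. max (measure (\<mu> (k n)) (code B (length w) -` {w})) (p w)"
    have "?S \<longlonglongrightarrow> (\<Sum>w | length w = l. max (p w) (p w))"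
      by (intro tendsto_sum tendsto_max lim tendsto_const)
    then have S: "?S \<longlonglongrightarrow> p []"
      using sum_consistent_masses[of p l, OF pc] by simp
    have U: "(\<lambda>n. measure (\<mu> (k n)) UNIV) \<longlonglongrightarrow> p []"
      using lim[of "[]"] by (simp add: vimage_def)
    have "(\<lambda>n. a * (2 * ?S n - measure (\<mu> (k n)) UNIV - p [])) \<longlonglongrightarrow> a * (2 * p [] - p [] - p [])"
      by (intro tendsto_intros S U)
    then have "\<forall>\<^sub>F n in sequentially. a * (2 * ?S n - measure (\<mu> (k n)) UNIV - p []) < e"
      by (rule order_tendstoD) (use e in simp)
    then show ?thesis
    proof eventually_elim
      case (elim n)
      have "(gen_wasserstein a b (\<mu> (k n)) \<mu>')\<^sup>2 \<le> b\<^sup>2 * (e\<^sup>2 * R) +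
          a * (2 * ?S n - measure (\<mu> (k n)) UNIV - p [])"
        by (rule bound[OF e l])
      with elim show ?case by linarith
    qed
  qed
  have "(\<lambda>n. (gen_wasserstein a b (\<mu> (k n)) \<mu>')\<^sup>2) \<longlonglongrightarrow> 0"
  proof (rule order_tendstoI)
    fix y :: real assume "0 < y"
    \<comment> \<open>Since \<open>e \<le> 1\<close> gives \<open>e\<^sup>2 \<le> e\<close>, the
      bound from \<open>ev\<close> is at most \<open>e * (b\<^sup>2 * R + 1)\<close>, which is at
      most \<open>y\<close>.\<close>
    define e where "e = min 1 (y / (b\<^sup>2 * R + 1))"
    have D: "0 < b\<^sup>2 * R + 1" using R0 by (simp add: add_nonneg_pos)
    then have e: "0 < e" "e \<le> 1" "e * (b\<^sup>2 * R + 1) \<le> y"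
      using \<open>0 < y\<close> unfolding pos_le_divide_eq[OF D, symmetric] by (auto simp: e_def)
    have "e\<^sup>2 \<le> e" using e by (simp add: power2_eq_square mult_left_le)
    then have "b\<^sup>2 * (e\<^sup>2 * R) + e \<le> b\<^sup>2 * (e * R) + e"
      using R0 by (intro add_right_mono mult_left_mono mult_right_mono) auto
    also have "\<dots> \<le> y" using e(3) by (simp add: algebra_simps)
    finally show "\<forall>\<^sub>F n in sequentially. (gen_wasserstein a b (\<mu> (k n)) \<mu>')\<^sup>2 < y"
      using ev[OF e(1)] by (auto elim!: eventually_mono)
  next
    fix y :: real assume "y < 0"
    then show "\<forall>\<^sub>F n in sequentially. y < (gen_wasserstein a b (\<mu> (k n)) \<mu>')\<^sup>2"
      by (intro always_eventually allI) (simp add: less_le_trans[OF _ zero_le_power2])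
  qed
  then have "(\<lambda>n. sqrt ((gen_wasserstein a b (\<mu> (k n)) \<mu>')\<^sup>2)) \<longlonglongrightarrow> sqrt 0"
    by (rule tendsto_real_sqrt)
  then have "(\<lambda>n. gen_wasserstein a b (\<mu> (k n)) \<mu>') \<longlonglongrightarrow> 0"
    using gen_wasserstein_nonneg[OF a \<mu> \<mu>'] by simp
  with k \<mu>' show thesis by (rule that)
qed

section \<open>Barycenters\<close>

text \<open>By symmetry and the triangle inequality the distance is 1-Lipschitz in each
  argument.\<close>

lemma tendsto_gen_wasserstein:
  fixes \<alpha>n \<beta>n :: "nat \<Rightarrow> 'a::{metric_space, second_countable_topology} measure"
  assumes a: "0 \<le> a" and fb: "\<And>n. \<alpha>n n \<in> finite_borel_measures" "\<And>n. \<beta>n n \<in> finite_borel_measures"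
    "\<alpha> \<in> finite_borel_measures" "\<beta> \<in> finite_borel_measures"
    and lim: "(\<lambda>n. gen_wasserstein a b (\<alpha>n n) \<alpha>) \<longlonglongrightarrow> 0" "(\<lambda>n. gen_wasserstein a b (\<beta>n n) \<beta>) \<longlonglongrightarrow> 0"
  shows "(\<lambda>n. gen_wasserstein a b (\<alpha>n n) (\<beta>n n)) \<longlonglongrightarrow> gen_wasserstein a b \<alpha> \<beta>"
proof -
  let ?W = "gen_wasserstein a b"
  have "(\<lambda>n. ?W (\<alpha>n n) (\<beta>n n) - ?W \<alpha> \<beta>) \<longlonglongrightarrow> 0"
  proof (rule Lim_null_comparison)
    show "(\<lambda>n. ?W (\<alpha>n n) \<alpha> + ?W (\<beta>n n) \<beta>) \<longlonglongrightarrow> 0"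
      using tendsto_add[OF lim] by simp
    show "\<forall>\<^sub>F n in sequentially. norm (?W (\<alpha>n n) (\<beta>n n) - ?W \<alpha> \<beta>) \<le> ?W (\<alpha>n n) \<alpha> + ?W (\<beta>n n) \<beta>"
    proof (rule always_eventually, rule allI)
      fix n
      have "?W (\<alpha>n n) (\<beta>n n) \<le> ?W (\<alpha>n n) \<alpha> + (?W \<alpha> \<beta> + ?W \<beta> (\<beta>n n))"
        using gen_wasserstein_triangle[OF a fb(1,3,2), of b n n] gen_wasserstein_triangle[OF a fb(3,4,2), of b n]
        by simp
      moreover have "?W \<alpha> \<beta> \<le> ?W \<alpha> (\<alpha>n n) + (?W (\<alpha>n n) (\<beta>n n) + ?W (\<beta>n n) \<beta>)"
        using gen_wasserstein_triangle[OF a fb(3,1,4), of b n] gen_wasserstein_triangle[OF a fb(1,2,4), of b n n]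
        by simp
      ultimately show "norm (?W (\<alpha>n n) (\<beta>n n) - ?W \<alpha> \<beta>) \<le> ?W (\<alpha>n n) \<alpha> + ?W (\<beta>n n) \<beta>"
        using gen_wasserstein_commute[OF a fb(3,1), of b n] gen_wasserstein_commute[OF a fb(4,2), of b n]
        by simp
    qed
  qed
  then show ?thesis by (rule LIM_zero_cancel)
qed

section \<open>Supports along convergent sequences\<close>

lemma measure_open_pos_msupp:
  fixes \<mu> :: "'a::second_countable_topology measure"
  assumes "sets \<mu> = sets borel" "open U" "0 < measure \<mu> U"
  shows "\<exists>x\<in>U. x \<in> msupp \<mu>"
proof (rule ccontr)
  assume "\<not> ?thesis"
  then have "emeasure \<mu> U \<le> emeasure \<mu> (- msupp \<mu>)"
    using closed_msupp[of \<mu>] assms(1) by (intro emeasure_mono) (auto simp: borel_open open_Compl)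
  then have "emeasure \<mu> U = 0" using emeasure_compl_msupp[OF assms(1)] by simp
  with assms(3) show False by (simp add: measure_def)
qed

lemma msupp_measure_ball_pos:
  assumes "\<mu> \<in> finite_borel_measures" "x \<in> msupp \<mu>" "0 < r"
  shows "0 < measure \<mu> (ball x r)"
  using assms by (auto simp: msupp_def emeasure_finite_borel_measure)

text \<open>Around a point outside \<open>K\<close> some ball is null for every
  \<open>\<mu>n n\<close>; by the ball estimate the ball of half the radius is null for the
  limit.\<close>

lemma msupp_limit_subset:
  fixes \<mu>n :: "nat \<Rightarrow> 'a::{metric_space, second_countable_topology} measure"
  assumes a: "0 < a" and b: "0 < b" and \<mu>n: "\<And>n. \<mu>n n \<in> finite_borel_measures" and \<mu>: "\<mu> \<in> finite_borel_measures"
    and K: "closed K" "\<And>n. msupp (\<mu>n n) \<subseteq> K"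
    and lim: "(\<lambda>n. gen_wasserstein a b (\<mu>n n) \<mu>) \<longlonglongrightarrow> 0"
  shows "msupp \<mu> \<subseteq> K"
proof
  fix x assume x: "x \<in> msupp \<mu>"
  show "x \<in> K"
  proof (rule ccontr)
    assume "x \<notin> K"
    then obtain e where e: "0 < e" "ball x e \<subseteq> - K"
      using K(1) by (metis ComplI closed_def openE)
    define r where "r = e / 2"
    have r: "0 < r" "ball x (2 * r) \<subseteq> - K" using e by (auto simp: r_def)
    have "measure (\<mu>n n) (ball x (2 * r)) = 0" for n
    proof (rule ccontr)
      assume "measure (\<mu>n n) (ball x (2 * r)) \<noteq> 0"
      then have "0 < measure (\<mu>n n) (ball x (2 * r))" by (simp add: zero_less_measure_iff)
      from measure_open_pos_msupp[OF finite_borel_measuresD(1)[OF \<mu>n] open_ball this]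
      show False using r(2) K(2)[of n] by blast
    qed
    then have "measure \<mu> (ball x r) \<le> (1 / a + 1 / (b * r)\<^sup>2) * (gen_wasserstein a b (\<mu>n n) \<mu>)\<^sup>2" for n
      using ball_measure_le_gen_wasserstein[OF a b \<mu>n \<mu> r(1), of x n] by simp
    moreover have "(\<lambda>n. (1 / a + 1 / (b * r)\<^sup>2) * (gen_wasserstein a b (\<mu>n n) \<mu>)\<^sup>2) \<longlonglongrightarrow> (1 / a + 1 / (b * r)\<^sup>2) * 0\<^sup>2"
      by (intro tendsto_mult tendsto_power lim tendsto_const)
    ultimately have "measure \<mu> (ball x r) \<le> (1 / a + 1 / (b * r)\<^sup>2) * 0\<^sup>2"
      by (intro LIMSEQ_le_const) auto
    with msupp_measure_ball_pos[OF \<mu> x r(1)] show False by simp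
  qed
qed

text \<open>The ball estimate with the limit on the smaller side: the ball of radius
  \<open>e / 2\<close> has positive limit mass, so the ball of radius \<open>e\<close> is eventually
  charged by \<open>\<mu>n n\<close>.\<close>

lemma eventually_msupp_near:
  fixes \<mu>n :: "nat \<Rightarrow> 'a::{metric_space, second_countable_topology} measure"
  assumes a: "0 < a" and b: "0 < b" and \<mu>n: "\<And>n. \<mu>n n \<in> finite_borel_measures" and \<mu>: "\<mu> \<in> finite_borel_measures"
    and lim: "(\<lambda>n. gen_wasserstein a b (\<mu>n n) \<mu>) \<longlonglongrightarrow> 0" and x: "x \<in> msupp \<mu>" and e: "0 < e"
  shows "\<forall>\<^sub>F n in sequentially. \<exists>y\<in>msupp (\<mu>n n). dist x y < e"
proof -
  define r where "r = e / 2"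
  have r: "0 < r" "2 * r = e" using e by (auto simp: r_def)
  have "(\<lambda>n. (1 / a + 1 / (b * r)\<^sup>2) * (gen_wasserstein a b (\<mu>n n) \<mu>)\<^sup>2) \<longlonglongrightarrow> (1 / a + 1 / (b * r)\<^sup>2) * 0\<^sup>2"
    by (intro tendsto_mult tendsto_power lim tendsto_const)
  then have "\<forall>\<^sub>F n in sequentially. (1 / a + 1 / (b * r)\<^sup>2) * (gen_wasserstein a b (\<mu>n n) \<mu>)\<^sup>2 < measure \<mu> (ball x r)"
    by (rule order_tendstoD) (use msupp_measure_ball_pos[OF \<mu> x r(1)] in simp)
  then show ?thesis
  proof eventually_elim
    case (elim n)
    then have "0 < measure (\<mu>n n) (ball x e)"
      using ball_measure_le_gen_wasserstein[OF a b \<mu>n \<mu> r(1), of x n] r by simp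
    from measure_open_pos_msupp[OF finite_borel_measuresD(1)[OF \<mu>n] open_ball this]
    show ?case by auto
  qed
qed

text \<open>Choosing a nearby point cell by cell gives a map through a countable index set, which is
  Borel without any measurable selection. In \<open>2 * e\<close> one \<open>e\<close> is the cell
  diameter, the other the distance from a point of the cell to its image.\<close>

lemma transport_to_nearby_set:
  fixes \<nu> :: "'a::{metric_space, second_countable_topology} measure"
  assumes a: "0 \<le> a" and \<nu>: "\<nu> \<in> finite_borel_measures" and \<nu>K: "msupp \<nu> \<subseteq> K" and K: "compact K"
    and K': "closed K'" "K' \<subseteq> K" and e: "0 < e" and near: "\<And>x. x \<in> K \<Longrightarrow> \<exists>y\<in>K'. dist x y < e"
  obtains \<nu>' where "\<nu>' \<in> finite_borel_measures" "msupp \<nu>' \<subseteq> K'"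
    "(gen_wasserstein a b \<nu> \<nu>')\<^sup>2 \<le> b\<^sup>2 * ((2 * e)\<^sup>2 * measure \<nu> UNIV)"
proof -
  note N = finite_borel_measuresD[OF \<nu>]
  have [measurable_cong]: "sets \<nu> = sets borel" by (rule N)
  obtain c :: "'a \<Rightarrow> nat" where c[measurable]: "c \<in> borel \<rightarrow>\<^sub>M count_space UNIV"
    and cd: "\<And>x y. c x = c y \<Longrightarrow> dist x y < e"
    by (rule small_cells[OF e]) (rule that)
  \<comment> \<open>Cells away from \<open>K\<close> may receive an arbitrary value;
    \<open>\<nu>\<close> does not charge them.\<close>
  define y where "y j = (SOME y. y \<in> K' \<and> (\<exists>x. c x = j \<and> dist x y < e))" for j
  have y: "y (c x) \<in> K'" "dist x (y (c x)) \<le> 2 * e" if "x \<in> K" for x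
  proof -
    have "\<exists>z. z \<in> K' \<and> (\<exists>x'. c x' = c x \<and> dist x' z < e)" using near[OF that] by blast
    from someI_ex[OF this] have *: "y (c x) \<in> K'" "\<exists>x'. c x' = c x \<and> dist x' (y (c x)) < e"
      unfolding y_def by auto
    then obtain x' where "c x' = c x" "dist x' (y (c x)) < e" by blast
    then show "y (c x) \<in> K'" "dist x (y (c x)) \<le> 2 * e"
      using * cd[of x x'] dist_triangle[of x "y (c x)" x'] by auto
  qed
  have AE: "AE x in \<nu>. x \<in> K"
    using msupp_subset_closed_iff[OF N(1) compact_imp_closed[OF K]] \<nu>K by simp
  have [measurable]: "(\<lambda>x. y (c x)) \<in> borel \<rightarrow>\<^sub>M borel"
    by (rule measurable_compose[OF c]) simp
  define \<nu>' where "\<nu>' = distr \<nu> borel (\<lambda>x. y (c x))"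
  have \<nu>': "\<nu>' \<in> finite_borel_measures"
    unfolding \<nu>'_def by (rule finite_borel_measures_distr) (use N in simp_all)
  have KB: "K' \<in> sets borel" using K' by (simp add: borel_closed)
  have AE': "AE x in \<nu>'. x \<in> K'"
    unfolding \<nu>'_def using AE KB by (subst AE_distr_iff) (auto elim!: eventually_mono intro: y)
  show thesis
  proof (rule that[OF \<nu>'])
    show "msupp \<nu>' \<subseteq> K'"
      using AE' K'(1) by (subst msupp_subset_closed_iff) (simp_all add: \<nu>'_def)
    have "bounded K'" using bounded_subset[OF compact_imp_bounded[OF K] K'(2)] .
    then have "\<nu>' \<in> finite_borel_measures2" using finite_borel_measures2_bounded[OF \<nu>' _ AE'] by simp
    moreover have "\<nu> \<in> finite_borel_measures2"
      using finite_borel_measures2_bounded[OF \<nu> compact_imp_bounded[OF K] AE] .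
    ultimately show "(gen_wasserstein a b \<nu> \<nu>')\<^sup>2 \<le> b\<^sup>2 * ((2 * e)\<^sup>2 * measure \<nu> UNIV)"
      unfolding \<nu>'_def using AE
      by (intro gen_wasserstein_distr_le a) (auto elim!: eventually_mono intro: y)
  qed
qed

section \<open>The barycenter functional and its minimisers\<close>

definition barycenter_cost ::
    "real \<Rightarrow> real \<Rightarrow> nat \<Rightarrow> (nat \<Rightarrow> 'a::metric_space measure) \<Rightarrow> (nat \<Rightarrow> real) \<Rightarrow> 'a measure \<Rightarrow> real" where
  "barycenter_cost a b k \<nu> w \<mu> = (\<Sum>i=1..k. w i * (gen_wasserstein a b (\<nu> i) \<mu>)\<^sup>2)"

lemma gen_wasserstein_barycenters_iff:
  "\<mu> \<in> gen_wasserstein_barycenters a b k \<nu> w \<longleftrightarrow>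
     \<mu> \<in> finite_borel_measures \<and> msupp \<mu> \<subseteq> (\<Union>i\<in>{1..k}. msupp (\<nu> i)) \<and>
     (\<forall>\<mu>'. \<mu>' \<in> finite_borel_measures \<longrightarrow> msupp \<mu>' \<subseteq> (\<Union>i\<in>{1..k}. msupp (\<nu> i)) \<longrightarrow>
        barycenter_cost a b k \<nu> w \<mu> \<le> barycenter_cost a b k \<nu> w \<mu>')"
  by (auto simp: gen_wasserstein_barycenters_def is_arg_min_def barycenter_cost_def not_less)

lemma msupp_null [simp]: "msupp (null_measure M) = {}"
  by (auto simp: msupp_def intro: exI[of _ UNIV])

text \<open>Coercivity: a single summand controls the distance to \<open>\<nu> 1\<close> and thereby
  the mass.\<close>

lemma mass_le_barycenter_cost:
  fixes \<nu> :: "nat \<Rightarrow> 'a::{metric_space, second_countable_topology} measure"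
  assumes a: "0 < a" and k: "1 \<le> k" and w: "\<And>i. i \<in> {1..k} \<Longrightarrow> 0 < w i"
    and \<nu>: "\<nu> 1 \<in> finite_borel_measures" and \<mu>: "\<mu> \<in> finite_borel_measures"
  shows "measure \<mu> UNIV \<le> measure (\<nu> 1) UNIV + barycenter_cost a b k \<nu> w \<mu> / (a * w 1)"
proof -
  have w1: "0 < w 1" using w k by simp
  have "w 1 * (gen_wasserstein a b (\<nu> 1) \<mu>)\<^sup>2 \<le> barycenter_cost a b k \<nu> w \<mu>"
    unfolding barycenter_cost_def using k w
    by (intro member_le_sum[of 1 "{1..k}" "\<lambda>i. w i * (gen_wasserstein a b (\<nu> i) \<mu>)\<^sup>2"])
      (auto intro!: mult_nonneg_nonneg intro: less_imp_le)
  then have "(gen_wasserstein a b (\<nu> 1) \<mu>)\<^sup>2 \<le> barycenter_cost a b k \<nu> w \<mu> / w 1"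
    using w1 by (simp add: pos_le_divide_eq mult.commute)
  then have "a * measure \<mu> UNIV \<le> a * measure (\<nu> 1) UNIV + barycenter_cost a b k \<nu> w \<mu> / w 1"
    using mass_le_gen_wasserstein[OF less_imp_le[OF a] \<nu> \<mu>, of b] by simp
  then have "a * measure \<mu> UNIV \<le> a * (measure (\<nu> 1) UNIV + barycenter_cost a b k \<nu> w \<mu> / (a * w 1))"
    using a w1 by (simp add: distrib_left)
  then show ?thesis using a by simp
qed

lemma tendsto_barycenter_cost:
  fixes \<nu>n :: "nat \<Rightarrow> nat \<Rightarrow> 'a::{metric_space, second_countable_topology} measure"
  assumes a: "0 \<le> a" and fb: "\<And>n i. i \<in> {1..k} \<Longrightarrow> \<nu>n n i \<in> finite_borel_measures"
    "\<And>i. i \<in> {1..k} \<Longrightarrow> \<nu> i \<in> finite_borel_measures" "\<And>n. \<mu>n n \<in> finite_borel_measures"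
    "\<mu> \<in> finite_borel_measures"
    and lim: "\<And>i. i \<in> {1..k} \<Longrightarrow> (\<lambda>n. gen_wasserstein a b (\<nu>n n i) (\<nu> i)) \<longlonglongrightarrow> 0"
      "(\<lambda>n. gen_wasserstein a b (\<mu>n n) \<mu>) \<longlonglongrightarrow> 0"
  shows "(\<lambda>n. barycenter_cost a b k (\<nu>n n) w (\<mu>n n)) \<longlonglongrightarrow> barycenter_cost a b k \<nu> w \<mu>"
  unfolding barycenter_cost_def
  by (intro tendsto_sum tendsto_mult tendsto_const tendsto_power tendsto_gen_wasserstein[OF a])
    (use fb lim in auto)

text \<open>The identity plan needs marginals with finite second moment, hence the assumption. It
  makes constant data converge to themselves when \<open>tendsto_barycenter_cost\<close> is applied
  to a fixed problem.\<close>

lemma gen_wasserstein_self: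
  fixes \<mu> :: "'a::{metric_space, second_countable_topology} measure"
  assumes "0 \<le> a" "\<mu> \<in> finite_borel_measures2"
  shows "gen_wasserstein a b \<mu> \<mu> = 0"
proof -
  note \<mu> = finite_borel_measures2D[OF assms(2)]
  have "distr \<mu> borel (\<lambda>x. x) = \<mu>" using finite_borel_measuresD[OF \<mu>] by (intro distr_id2) simp
  then show ?thesis
    using gen_wasserstein_distr_le[OF assms, of "\<lambda>x. x" 0 b] assms(2) by simp
qed

text \<open>Direct method: coercivity bounds the masses of a minimising sequence, compactness yields
  a limit, the support constraint is closed by \<open>msupp_limit_subset\<close>, and the cost is
  continuous.\<close>

lemma gen_wasserstein_barycenter_exists:
  fixes \<nu> :: "nat \<Rightarrow> 'a::polish_space measure"
  assumes a: "0 < a" and b: "0 < b" and k: "1 \<le> k" and w: "\<And>i. i \<in> {1..k} \<Longrightarrow> 0 < w i"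
    and \<nu>: "\<And>i. i \<in> {1..k} \<Longrightarrow> \<nu> i \<in> finite_borel_measures"
    and K: "compact (\<Union>i\<in>{1..k}. msupp (\<nu> i))"
  shows "gen_wasserstein_barycenters a b k \<nu> w \<noteq> {}"
proof -
  define S where "S = (\<Union>i\<in>{1..k}. msupp (\<nu> i))"
  define C where "C = {\<mu>. \<mu> \<in> finite_borel_measures \<and> msupp \<mu> \<subseteq> S}"
  let ?F = "barycenter_cost a b k \<nu> w"
  have a0: "0 \<le> a" using a by simp
  have S: "compact S" "closed S" using K by (auto simp: S_def compact_imp_closed)
  have F0: "0 \<le> ?F \<mu>" for \<mu>
    unfolding barycenter_cost_def using w by (intro sum_nonneg mult_nonneg_nonneg) (auto intro: less_imp_le)
  have C0: "null_measure borel \<in> C" by (simp add: C_def null_borel_finite)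
  have bdd: "bdd_below (?F ` C)" using F0 by (intro bdd_belowI2)
  define v where "v = Inf (?F ` C)"
  have v: "v \<le> ?F \<mu>" if "\<mu> \<in> C" for \<mu>
    unfolding v_def by (rule cInf_lower[OF _ bdd]) (use that in simp)
  have "\<exists>\<mu>\<in>C. ?F \<mu> < v + 1 / real (Suc n)" for n
    using cInf_lessD[of "?F ` C" "v + 1 / real (Suc n)"] C0 unfolding v_def by auto
  then obtain \<mu> where \<mu>C: "\<And>n. \<mu> n \<in> C" and \<mu>v: "\<And>n. ?F (\<mu> n) < v + 1 / real (Suc n)"
    by metis
  have \<mu>: "\<mu> n \<in> finite_borel_measures" "msupp (\<mu> n) \<subseteq> S" for n using \<mu>C[of n] by (auto simp: C_def)
  have AE: "AE x in \<mu> n. x \<in> S" for n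
    using msupp_subset_closed_iff[OF finite_borel_measuresD(1)[OF \<mu>(1)] S(2)] \<mu>(2) by blast
  have \<nu>1: "\<nu> 1 \<in> finite_borel_measures" and w1: "0 < w 1" using \<nu> w k by auto
  have mass: "measure (\<mu> n) UNIV \<le> measure (\<nu> 1) UNIV + (v + 1) / (a * w 1)" for n
  proof -
    have "?F (\<mu> n) \<le> v + 1" using \<mu>v[of n] by (smt (verit) divide_le_eq_1 of_nat_0_le_iff of_nat_Suc)
    then have "?F (\<mu> n) / (a * w 1) \<le> (v + 1) / (a * w 1)" using a w1 by (intro divide_right_mono) auto
    then show ?thesis
      using mass_le_barycenter_cost[where a=a and b=b and k=k and w=w and \<nu>=\<nu>, OF a k w \<nu>1 \<mu>(1)[of n]] by simp
  qed
  obtain r \<mu>' where r: "strict_mono (r :: nat \<Rightarrow> nat)" and \<mu>': "\<mu>' \<in> finite_borel_measures"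
    and lim: "(\<lambda>n. gen_wasserstein a b (\<mu> (r n)) \<mu>') \<longlonglongrightarrow> 0"
    by (rule precompact_on_compact[OF a0 \<mu>(1) mass S(1) AE]) (rule that)
  have self: "gen_wasserstein a b (\<nu> i) (\<nu> i) = 0" if i: "i \<in> {1..k}" for i
  proof (rule gen_wasserstein_self[OF a0])
    have "AE x in \<nu> i. x \<in> S"
      using msupp_subset_closed_iff[OF finite_borel_measuresD(1)[OF \<nu>[OF i]] S(2)] i by (auto simp: S_def)
    then show "\<nu> i \<in> finite_borel_measures2"
      by (rule finite_borel_measures2_bounded[OF \<nu>[OF i] compact_imp_bounded[OF S(1)]])
  qed
  have "msupp \<mu>' \<subseteq> S" by (rule msupp_limit_subset[OF a b \<mu>(1) \<mu>' S(2) \<mu>(2) lim])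
  moreover have "?F \<mu>' \<le> v"
  proof (rule LIMSEQ_le)
    show "(\<lambda>n. ?F (\<mu> (r n))) \<longlonglongrightarrow> ?F \<mu>'"
      by (rule tendsto_barycenter_cost[OF a0 \<nu> \<nu> \<mu>(1) \<mu>' _ lim]) (simp_all add: self)
    have "(\<lambda>n. 1 / real (Suc n)) \<longlonglongrightarrow> 0" using LIMSEQ_inverse_real_of_nat by (simp add: inverse_eq_divide)
    then have "(\<lambda>n. v + 1 / real (Suc n)) \<longlonglongrightarrow> v + 0" by (intro tendsto_add tendsto_const)
    from LIMSEQ_subseq_LIMSEQ[OF this r] show "(\<lambda>n. v + 1 / real (Suc (r n))) \<longlonglongrightarrow> v" by (simp add: o_def)
    show "\<exists>N. \<forall>n\<ge>N. ?F (\<mu> (r n)) \<le> v + 1 / real (Suc (r n))" using \<mu>v by (auto intro: less_imp_le)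
  qed
  ultimately have "\<mu>' \<in> gen_wasserstein_barycenters a b k \<nu> w"
    unfolding gen_wasserstein_barycenters_iff S_def[symmetric]
    using \<mu>' v by (auto simp: C_def intro: order_trans)
  then show ?thesis by blast
qed

theorem theorem4p5:
  fixes a b :: real and k :: nat and w :: "nat \<Rightarrow> real"
    and \<mu> :: "nat \<Rightarrow> 'a::polish_space measure"
    and \<mu>n :: "nat \<Rightarrow> nat \<Rightarrow> 'a measure"
    and K :: "'a set"
  assumes "a > 0" and "b > 0"
    and "locally_compact_space (euclidean :: 'a topology)"
    and "k \<ge> 2"
    and "\<And>i n. i \<in> {1..k} \<Longrightarrow> \<mu>n n i \<in> finite_borel_measures"
    and "\<And>i. i \<in> {1..k} \<Longrightarrow> \<mu> i \<in> finite_borel_measures"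
    and "\<And>i. i \<in> {1..k} \<Longrightarrow> compact (msupp (\<mu> i))"
    and "\<And>i. i \<in> {1..k} \<Longrightarrow> gen_wasserstein_converges a b (\<lambda>n. \<mu>n n i) (\<mu> i)"
    and "K = (\<Union>i\<in>{1..k}. msupp (\<mu> i))"
    and "\<And>i. i \<in> {1..k} \<Longrightarrow> w i > 0"
    and "(\<Sum>i=1..k. w i) = 1"
    and "\<And>i n. i \<in> {1..k} \<Longrightarrow> msupp (\<mu>n n i) \<subseteq> K"
  shows "(\<forall>n. gen_wasserstein_barycenters a b k (\<mu>n n) w \<noteq> {}) \<and>
    (\<forall>\<mu>B. (\<forall>n. \<mu>B n \<in> gen_wasserstein_barycenters a b k (\<mu>n n) w) \<longrightarrow>
       gen_wasserstein_precompact a b \<mu>B \<and>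
       (\<forall>\<mu>'. gen_wasserstein_limit_point a b \<mu>B \<mu>' \<longrightarrow>
          \<mu>' \<in> gen_wasserstein_barycenters a b k \<mu> w))"
proof -
  note a = assms(1) and b = assms(2) and \<mu>n = assms(5) and \<mu> = assms(6) and w = assms(10)
  have a0: "0 \<le> a" and k1: "1 \<le> k" and i1: "1 \<in> {1..k}" using a assms(4) by auto
  have lim: "(\<lambda>n. gen_wasserstein a b (\<mu>n n i) (\<mu> i)) \<longlonglongrightarrow> 0" if "i \<in> {1..k}" for i
    using assms(8)[OF that] by (simp add: gen_wasserstein_converges_def)
  have K: "compact K" unfolding assms(9) using assms(7) by (intro compact_UN) auto
  define Kn where "Kn n = (\<Union>i\<in>{1..k}. msupp (\<mu>n n i))" for n
  have KnK: "Kn n \<subseteq> K" for n unfolding Kn_def by (intro UN_least assms(12))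
  have clKn: "closed (Kn n)" for n unfolding Kn_def by (intro closed_UN) (auto simp: closed_msupp)
  have cKn: "compact (Kn n)" for n
    using compact_Int_closed[OF K clKn[of n]] KnK[of n] by (simp add: Int_absorb1)
  \<comment> \<open>Nearness at single points is made uniform over \<open>K\<close> by a finite net
    of mesh \<open>e / 2\<close>.\<close>
  have near: "\<forall>\<^sub>F n in sequentially. \<forall>x\<in>K. \<exists>y\<in>Kn n. dist x y < e" if e: "0 < e" for e
  proof -
    obtain Z where Z: "Z \<subseteq> K" "finite Z" "K \<subseteq> (\<Union>z\<in>Z. ball z (e / 2))"
      by (rule compactE_image[OF K, of K "\<lambda>z. ball z (e / 2)"]) (use e in \<open>auto intro: that\<close>)
    have "\<forall>\<^sub>F n in sequentially. \<forall>z\<in>Z. \<exists>y\<in>Kn n. dist z y < e / 2"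
    proof (rule eventually_ball_finite[OF Z(2)], rule ballI)
      fix z assume "z \<in> Z"
      then obtain i where i: "i \<in> {1..k}" "z \<in> msupp (\<mu> i)" using Z(1) by (auto simp: assms(9))
      have "\<forall>\<^sub>F n in sequentially. \<exists>y\<in>msupp (\<mu>n n i). dist z y < e / 2"
        by (rule eventually_msupp_near[OF a b \<mu>n[OF i(1)] \<mu>[OF i(1)] lim[OF i(1)] i(2)]) (use e in simp)
      then show "\<forall>\<^sub>F n in sequentially. \<exists>y\<in>Kn n. dist z y < e / 2"
        by eventually_elim (use i in \<open>auto simp: Kn_def\<close>)
    qed
    then show ?thesis
    proof eventually_elim
      case (elim n)
      show ?case
      proof
        fix x assume "x \<in> K"
        then obtain z where z: "z \<in> Z" "dist z x < e / 2" using Z(3) by auto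
        then obtain y where "y \<in> Kn n" "dist z y < e / 2" using elim by blast
        then show "\<exists>y\<in>Kn n. dist x y < e" using z dist_triangle3[of x y z] by (intro bexI[of _ y]) auto
      qed
    qed
  qed
  \<comment> \<open>Convergent distances are bounded, and a bounded distance to
    \<open>\<mu> i\<close> bounds the mass.\<close>
  have "\<exists>R. \<forall>n. measure (\<mu>n n i) UNIV \<le> R" if i: "i \<in> {1..k}" for i
  proof -
    have "Bseq (\<lambda>n. gen_wasserstein a b (\<mu>n n i) (\<mu> i))"
      using lim[OF i] by (intro convergent_imp_Bseq convergentI)
    then obtain B where B: "\<And>n. \<bar>gen_wasserstein a b (\<mu>n n i) (\<mu> i)\<bar> \<le> B"
      by (auto simp: Bseq_def)
    have "measure (\<mu>n n i) UNIV \<le> measure (\<mu> i) UNIV + B\<^sup>2 / a" for n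
    proof -
      have "(gen_wasserstein a b (\<mu> i) (\<mu>n n i))\<^sup>2 \<le> B\<^sup>2"
        using power_mono[OF B[of n], of 2] gen_wasserstein_commute[OF a0 \<mu>[OF i] \<mu>n[OF i, of n], of b] by simp
      then have "a * measure (\<mu>n n i) UNIV \<le> a * (measure (\<mu> i) UNIV + B\<^sup>2 / a)"
        using mass_le_gen_wasserstein[OF a0 \<mu>[OF i] \<mu>n[OF i, of n], of b] a by (simp add: distrib_left)
      then show ?thesis using a by simp
    qed
    then show ?thesis by blast
  qed
  then obtain Ri where Ri: "\<And>i n. i \<in> {1..k} \<Longrightarrow> measure (\<mu>n n i) UNIV \<le> Ri i" by metis
  \<comment> \<open>Bounds the cost of the null measure, and hence every optimal cost, uniformly in
    \<open>n\<close>.\<close>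
  define R where "R = (\<Sum>i=1..k. w i * (a * Ri i))"

  have ex: "gen_wasserstein_barycenters a b k (\<mu>n n) w \<noteq> {}" for n
    by (rule gen_wasserstein_barycenter_exists[OF a b k1 w \<mu>n]) (use cKn[of n] in \<open>simp_all add: Kn_def\<close>)
  moreover have "gen_wasserstein_precompact a b \<mu>B \<and>
       (\<forall>\<mu>'. gen_wasserstein_limit_point a b \<mu>B \<mu>' \<longrightarrow> \<mu>' \<in> gen_wasserstein_barycenters a b k \<mu> w)"
    if BC: "\<forall>n. \<mu>B n \<in> gen_wasserstein_barycenters a b k (\<mu>n n) w" for \<mu>B
  proof -
    have \<mu>B: "\<mu>B n \<in> finite_borel_measures" "msupp (\<mu>B n) \<subseteq> Kn n"
      and opt: "\<And>\<nu>. \<nu> \<in> finite_borel_measures \<Longrightarrow> msupp \<nu> \<subseteq> Kn n \<Longrightarrow>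
        barycenter_cost a b k (\<mu>n n) w (\<mu>B n) \<le> barycenter_cost a b k (\<mu>n n) w \<nu>" for n
      using BC[rule_format, of n] unfolding gen_wasserstein_barycenters_iff Kn_def by auto
    have \<mu>BK: "msupp (\<mu>B n) \<subseteq> K" for n using \<mu>B(2)[of n] KnK[of n] by blast
    have AE: "AE x in \<mu>B n. x \<in> K" for n
      using msupp_subset_closed_iff[OF finite_borel_measuresD(1)[OF \<mu>B(1)] compact_imp_closed[OF K]] \<mu>BK by blast
    have mass: "measure (\<mu>B n) UNIV \<le> Ri 1 + R / (a * w 1)" for n
    proof -
      have "barycenter_cost a b k (\<mu>n n) w (\<mu>B n) \<le> barycenter_cost a b k (\<mu>n n) w (null_measure borel)"
        by (rule opt) (simp_all add: null_borel_finite)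
      also have "\<dots> \<le> R"
        unfolding barycenter_cost_def R_def
      proof (intro sum_mono mult_left_mono)
        fix i assume i: "i \<in> {1..k}"
        have "(gen_wasserstein a b (\<mu>n n i) (null_measure borel))\<^sup>2 \<le> a * measure (\<mu>n n i) UNIV"
          by (rule gen_wasserstein_null_le[OF a0 \<mu>n[OF i]])
        also have "\<dots> \<le> a * Ri i" by (rule mult_left_mono[OF Ri[OF i] a0])
        finally show "(gen_wasserstein a b (\<mu>n n i) (null_measure borel))\<^sup>2 \<le> a * Ri i" .
        show "0 \<le> w i" using w[OF i] by simp
      qed
      finally have "barycenter_cost a b k (\<mu>n n) w (\<mu>B n) / (a * w 1) \<le> R / (a * w 1)"
        using a w[OF i1] by (intro divide_right_mono) auto
      moreover have "measure (\<mu>B n) UNIV \<le> measure (\<mu>n n 1) UNIV + barycenter_cost a b k (\<mu>n n) w (\<mu>B n) / (a * w 1)"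
        by (rule mass_le_barycenter_cost[where \<nu> = "\<mu>n n" and w = w, OF a k1 w \<mu>n[OF i1] \<mu>B(1)])
      ultimately show ?thesis using Ri[OF i1, of n] by linarith
    qed
    have "gen_wasserstein_precompact a b \<mu>B"
      unfolding gen_wasserstein_precompact_def
    proof (intro allI impI)
      fix r :: "nat \<Rightarrow> nat" assume "strict_mono r"
      obtain s \<mu>' where "strict_mono (s :: nat \<Rightarrow> nat)" "\<mu>' \<in> finite_borel_measures"
        "(\<lambda>n. gen_wasserstein a b (\<mu>B (r (s n))) \<mu>') \<longlonglongrightarrow> 0"
        by (rule precompact_on_compact[of a "\<lambda>n. \<mu>B (r n)", OF a0 \<mu>B(1) mass K AE]) (rule that)
      then show "\<exists>(s::nat \<Rightarrow> nat) \<mu>'. strict_mono s \<and> \<mu>' \<in> finite_borel_measures \<and>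
           gen_wasserstein_converges a b (\<mu>B \<circ> r \<circ> s) \<mu>'"
        by (auto simp: gen_wasserstein_converges_def)
    qed
    moreover have "\<mu>' \<in> gen_wasserstein_barycenters a b k \<mu> w"
      if lp: "gen_wasserstein_limit_point a b \<mu>B \<mu>'" for \<mu>'
    proof -
      obtain r :: "nat \<Rightarrow> nat" where \<mu>': "\<mu>' \<in> finite_borel_measures" and r: "strict_mono r"
        and rlim: "(\<lambda>n. gen_wasserstein a b (\<mu>B (r n)) \<mu>') \<longlonglongrightarrow> 0"
        using lp by (auto simp: gen_wasserstein_limit_point_def gen_wasserstein_converges_def o_def)
      have supp: "msupp \<mu>' \<subseteq> K"
        by (rule msupp_limit_subset[OF a b \<mu>B(1) \<mu>' compact_imp_closed[OF K] \<mu>BK rlim])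
      \<comment> \<open>\<open>\<nu>\<close> may charge points of \<open>K\<close> outside
        \<open>Kn n\<close> and then does not compete with \<open>\<mu>B n\<close>; it is
        approximated by measures supported in sets \<open>Kn (r n)\<close>.\<close>
      have "barycenter_cost a b k \<mu> w \<mu>' \<le> barycenter_cost a b k \<mu> w \<nu>"
        if \<nu>: "\<nu> \<in> finite_borel_measures" "msupp \<nu> \<subseteq> K" for \<nu>
      proof -
        have "\<exists>n \<nu>'. m \<le> n \<and> \<nu>' \<in> finite_borel_measures \<and> msupp \<nu>' \<subseteq> Kn (r n) \<and>
            (gen_wasserstein a b \<nu> \<nu>')\<^sup>2 \<le> b\<^sup>2 * ((2 * (1 / real (Suc m)))\<^sup>2 * measure \<nu> UNIV)" for m
        proof -
          have e: "0 < 1 / real (Suc m)" by simp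
          obtain M where M: "\<And>n x. M \<le> n \<Longrightarrow> x \<in> K \<Longrightarrow> \<exists>y\<in>Kn n. dist x y < 1 / real (Suc m)"
            using near[OF e] unfolding eventually_sequentially by blast
          define n where "n = max m M"
          have n: "m \<le> n" "M \<le> r n" using seq_suble[OF r, of n] by (auto simp: n_def)
          obtain \<nu>' where "\<nu>' \<in> finite_borel_measures" "msupp \<nu>' \<subseteq> Kn (r n)"
            "(gen_wasserstein a b \<nu> \<nu>')\<^sup>2 \<le> b\<^sup>2 * ((2 * (1 / real (Suc m)))\<^sup>2 * measure \<nu> UNIV)"
            by (rule transport_to_nearby_set[OF a0 \<nu> K clKn KnK e M[OF n(2)]]) (assumption, rule that)
          with n(1) show ?thesis by blast
        qed
        \<comment> \<open>\<open>N\<close> need not be monotone; \<open>m \<le> N m\<close> already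
          suffices to compose limits with it.\<close>
        then obtain N \<nu>' where N: "\<And>m. m \<le> N m" and \<nu>': "\<And>m. \<nu>' m \<in> finite_borel_measures"
          "\<And>m. msupp (\<nu>' m) \<subseteq> Kn (r (N m))"
          and \<nu>W: "\<And>m. (gen_wasserstein a b \<nu> (\<nu>' m))\<^sup>2 \<le> b\<^sup>2 * ((2 * (1 / real (Suc m)))\<^sup>2 * measure \<nu> UNIV)"
          by metis
        have Ninf: "filterlim N at_top sequentially"
          by (rule filterlim_at_top_mono[OF filterlim_ident]) (simp add: N)
        have rinf: "filterlim (\<lambda>m. r (N m)) at_top sequentially"
          using filterlim_compose[OF filterlim_subseq[OF r] Ninf] .
        have "(\<lambda>m. 1 / real (Suc m)) \<longlonglongrightarrow> 0" using LIMSEQ_inverse_real_of_nat by (simp add: inverse_eq_divide)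
        then have "(\<lambda>m. b\<^sup>2 * ((2 * (1 / real (Suc m)))\<^sup>2 * measure \<nu> UNIV)) \<longlonglongrightarrow> b\<^sup>2 * ((2 * 0)\<^sup>2 * measure \<nu> UNIV)"
          by (intro tendsto_mult tendsto_power tendsto_const)
        then have "(\<lambda>m. b\<^sup>2 * ((2 * (1 / real (Suc m)))\<^sup>2 * measure \<nu> UNIV)) \<longlonglongrightarrow> 0" by simp
        then have "(\<lambda>m. (gen_wasserstein a b \<nu> (\<nu>' m))\<^sup>2) \<longlonglongrightarrow> 0"
          by (rule Lim_null_comparison[rotated])
            (intro always_eventually allI, use \<nu>W in \<open>simp only: real_norm_def abs_power2\<close>)
        then have "(\<lambda>m. sqrt ((gen_wasserstein a b \<nu> (\<nu>' m))\<^sup>2)) \<longlonglongrightarrow> sqrt 0" by (rule tendsto_real_sqrt)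
        then have \<nu>lim: "(\<lambda>m. gen_wasserstein a b (\<nu>' m) \<nu>) \<longlonglongrightarrow> 0"
          using gen_wasserstein_nonneg[OF a0 \<nu>(1) \<nu>'(1)] gen_wasserstein_commute[OF a0 \<nu>(1) \<nu>'(1)] by simp
        have 1: "(\<lambda>m. barycenter_cost a b k (\<mu>n (r (N m))) w (\<mu>B (r (N m)))) \<longlonglongrightarrow> barycenter_cost a b k \<mu> w \<mu>'"
          by (intro tendsto_barycenter_cost a0 \<mu>n \<mu> \<mu>B(1) \<mu>' filterlim_compose[OF lim rinf]
              filterlim_compose[OF rlim Ninf])
        have 2: "(\<lambda>m. barycenter_cost a b k (\<mu>n (r (N m))) w (\<nu>' m)) \<longlonglongrightarrow> barycenter_cost a b k \<mu> w \<nu>"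
          by (intro tendsto_barycenter_cost a0 \<mu>n \<mu> \<nu>'(1) \<nu>(1) filterlim_compose[OF lim rinf] \<nu>lim)
        \<comment> \<open>Optimality of \<open>\<mu>B (r (N m))\<close> against the competitor
          \<open>\<nu>' m\<close> is passed to the limit on both sides.\<close>
        show ?thesis
          by (rule LIMSEQ_le[OF 1 2]) (use opt[OF \<nu>'] in blast)
      qed
      with \<mu>' supp show ?thesis
        unfolding gen_wasserstein_barycenters_iff assms(9)[symmetric] by blast
    qed
    ultimately show ?thesis by blast
  qed
  ultimately show ?thesis by blast
qed

end
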